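(* Every infinite dimensional subspace of $Y=Ti(2;1/2)$ contains an (infinite dimensional) asymptotic $\ell_2$ subspace, that is, a subspace having an asymptotic $\ell_2$ basis; hence it contains an (infinite dimensional) asymptotically symmetric subspace.
   Context: Definition of $Y=Ti(2;1/2)$: let $c_{00}$ be the space of finitely supported real sequences. For $x\in c_{00}$ and $E\subseteq\mathbb{N}$ let $Ex(i)=x(i)$ if $i\in E$ and $Ex(i)=0$ otherwise; $E<F$ means $\max E<\min F$. $Y$ is the completion of $c_{00}$ under the norm given by the implicit equation $$\|x\|=\max\Big(\|x\|_\infty,\ \sup\frac1{2\sqrt n}\sum_{i=1}^n\|E_ix\|\Big),$$ where the sup is taken over all $n\in\mathbb{N}$ and all subsets $E_1<\cdots<E_n$ of $\mathbb{N}$. A basis $(e_i)$ of a Banach space is an asymptotic $\ell_2$ basis if there is $C<\infty$ such that for all $n$, every normalized block basis $(x_i)_{i=1}^n$ of $(e_i)_{i=n}^\infty$ is $C$-equivalent to the unit vector basis of $\ell_2^n$. Two sequences $(x_i),(y_i)$ are $C$-equivalent if there are $A,B>0$ with $AB\le C$ such that $A^{-1}\|\sum a_iy_i\|\le\|\sum a_ix_i\|\le B\|\sum a_iy_i\|$ for all scalars $(a_i)$. A Banach space $X$ is asymptotically symmetric if there is $C<\infty$ such that for all $m\in\mathbb{N}$, all bounded sequences $(x_n^i)_{n=1}^\infty\subseteq X$, $1\le i\le m$, and all permutations $\sigma$ of $\{1,\ldots,m\}$, $$\lim_{n_1\to\infty}\cdots\lim_{n_m\to\infty}\Big\|\sum_{i=1}^m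 x_{n_i}^i\Big\|\le C\lim_{n_{\sigma(1)}\to\infty}\cdots\lim_{n_{\sigma(m)}\to\infty}\Big\|\sum_{i=1}^m x_{n_i}^i\Big\|,$$ provided that these iterated limits exist. Subspaces are closed. *)

theory Defs
  imports "HOL-Analysis.Analysis" "HOL-Combinatorics.Permutations"
begin

section \<open>The Tirilman space $Ti(2;1/2)$\<close>

definition c00 :: "(nat \<Rightarrow> real) set" where
  "c00 = {x. finite {i. x i \<noteq> 0}}"

definition restr :: "nat set \<Rightarrow> (nat \<Rightarrow> real) \<Rightarrow> nat \<Rightarrow> real" where
  "restr E x = (\<lambda>i. if i \<in> E then x i else 0)"

text \<open>
  \<open>E 1 < \<dots> < E n\<close>, where \<open>E < F\<close> means \<open>max E < min F\<close>.  Stating this elementwise, for all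
  pairs of indices, makes sense for empty and for infinite sets too; admitting these does not
  change the supremum in the norm below.
\<close>
definition successive :: "nat \<Rightarrow> (nat \<Rightarrow> nat set) \<Rightarrow> bool" where
  "successive n E \<longleftrightarrow>
     (\<forall>i j. 1 \<le> i \<longrightarrow> i < j \<longrightarrow> j \<le> n \<longrightarrow> (\<forall>a\<in>E i. \<forall>b\<in>E j. a < b))"

definition is_norm_on_c00 :: "((nat \<Rightarrow> real) \<Rightarrow> real) \<Rightarrow> bool" where
  "is_norm_on_c00 N \<longleftrightarrow>
     (\<forall>x\<in>c00. 0 \<le> N x \<and> (N x = 0 \<longleftrightarrow> x = (\<lambda>i. 0))) \<and>
     (\<forall>x\<in>c00. \<forall>c. N (\<lambda>i. c * x i) = \<bar>c\<bar> * N x) \<and>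
     (\<forall>x\<in>c00. \<forall>y\<in>c00. N (\<lambda>i. x i + y i) \<le> N x + N y)"

definition Ti_sums :: "((nat \<Rightarrow> real) \<Rightarrow> real) \<Rightarrow> (nat \<Rightarrow> real) \<Rightarrow> real set" where
  "Ti_sums N x =
     {1 / (2 * sqrt (real n)) * (\<Sum>i=1..n. N (restr (E i) x)) | n E. 1 \<le> n \<and> successive n E}"

text \<open>
  The norm given by the implicit equation.  Finiteness of the supremum is part of the equation
  and has to be said explicitly, since \<open>Sup\<close> on the reals is total.  Such a norm exists
  and is unique on \<open>c00\<close>: see \<open>is_Ti_norm_exists\<close> and \<open>is_Ti_norm_unique\<close> below.
\<close>
definition is_Ti_norm :: "((nat \<Rightarrow> real) \<Rightarrow> real) \<Rightarrow> bool" where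
  "is_Ti_norm N \<longleftrightarrow>
     is_norm_on_c00 N \<and>
     (\<forall>x\<in>c00. bdd_above (Ti_sums N x) \<and> N x = max (SUP i. \<bar>x i\<bar>) (Sup (Ti_sums N x)))"

text \<open>
  The Banach space \<open>'y\<close>, together with the embedding \<open>J\<close>, is the completion of \<open>c00\<close> under
  the norm above.
\<close>
definition is_Ti_completion :: "((nat \<Rightarrow> real) \<Rightarrow> 'y::banach) \<Rightarrow> bool" where
  "is_Ti_completion J \<longleftrightarrow>
     (\<exists>N. is_Ti_norm N \<and> (\<forall>x\<in>c00. norm (J x) = N x)) \<and>
     (\<forall>x\<in>c00. \<forall>c. J (\<lambda>i. c * x i) = c *\<^sub>R J x) \<and>
     (\<forall>x\<in>c00. \<forall>y\<in>c00. J (\<lambda>i. x i + y i) = J x + J y) \<and>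
     closure (J ` c00) = UNIV"


section \<open>Subspaces and bases\<close>

definition infinite_dim_subspace :: "'a::real_normed_vector set \<Rightarrow> bool" where
  "infinite_dim_subspace X \<longleftrightarrow>
     subspace X \<and> closed X \<and> \<not> (\<exists>B. finite B \<and> span B = X)"

definition basis_of :: "(nat \<Rightarrow> 'a::real_normed_vector) \<Rightarrow> 'a set \<Rightarrow> bool" where
  "basis_of e X \<longleftrightarrow>
     (\<forall>i. e i \<in> X) \<and> (\<forall>x\<in>X. \<exists>!a :: nat \<Rightarrow> real. (\<lambda>i. a i *\<^sub>R e i) sums x)"

text \<open>\<open>x 0, \<dots>, x (n - 1)\<close> is a normalized block basis of \<open>e k, e (k + 1), \<dots>\<close>.\<close>
definition normalized_block_basis ::
  "(nat \<Rightarrow> 'a::real_normed_vector) \<Rightarrow> nat \<Rightarrow> nat \<Rightarrow> (nat \<Rightarrow> 'a) \<Rightarrow> bool" where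
  "normalized_block_basis e k n x \<longleftrightarrow>
     (\<exists>(p :: nat \<Rightarrow> nat) (a :: nat \<Rightarrow> real). k \<le> p 0 \<and>
        (\<forall>i<n. p i < p (Suc i) \<and> x i = (\<Sum>j\<in>{p i..<p (Suc i)}. a j *\<^sub>R e j) \<and> norm (x i) = 1))"

text \<open>
  \<open>C\<close>-equivalence of \<open>x 0, \<dots>, x (n - 1)\<close> to the unit vector basis of $\ell_2^n$; the norm
  of \<open>(a 0, \<dots>, a (n - 1))\<close> in the latter space is \<open>L2_set a {..<n}\<close>.
\<close>
definition equivalent_to_l2_basis ::
  "real \<Rightarrow> nat \<Rightarrow> (nat \<Rightarrow> 'a::real_normed_vector) \<Rightarrow> bool" where
  "equivalent_to_l2_basis C n x \<longleftrightarrow>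
     (\<exists>A B. 0 < A \<and> 0 < B \<and> A * B \<le> C \<and>
        (\<forall>a :: nat \<Rightarrow> real.
           inverse A * L2_set a {..<n} \<le> norm (\<Sum>i<n. a i *\<^sub>R x i) \<and>
           norm (\<Sum>i<n. a i *\<^sub>R x i) \<le> B * L2_set a {..<n}))"

text \<open>
  The basis is indexed from \<open>0\<close> here, so the tail that is traditionally written
  $(e_i)_{i=n}^\infty$ starts at \<open>e (n - 1)\<close>.
\<close>
definition asymptotic_l2_basis_of :: "(nat \<Rightarrow> 'a::real_normed_vector) \<Rightarrow> 'a set \<Rightarrow> bool" where
  "asymptotic_l2_basis_of e X \<longleftrightarrow>
     basis_of e X \<and>
     (\<exists>C. \<forall>n\<ge>1. \<forall>x. normalized_block_basis e (n - 1) n x \<longrightarrow> equivalent_to_l2_basis C n x)"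


section \<open>Asymptotic symmetry\<close>

text \<open>
  \<open>has_iterated_limit [i\<^sub>1, \<dots>, i\<^sub>m] f \<nu> L\<close>: the iterated limit of \<open>f\<close>, taken over the
  coordinates \<open>i\<^sub>1\<close> (outermost), \dots, \<open>i\<^sub>m\<close> (innermost) of its argument, exists and equals
  \<open>L\<close>; the other coordinates are kept at their values in \<open>\<nu>\<close>.
\<close>
primrec has_iterated_limit ::
  "nat list \<Rightarrow> ((nat \<Rightarrow> nat) \<Rightarrow> real) \<Rightarrow> (nat \<Rightarrow> nat) \<Rightarrow> real \<Rightarrow> bool" where
  "has_iterated_limit [] f \<nu> L \<longleftrightarrow> f \<nu> = L"
| "has_iterated_limit (i # is) f \<nu> L \<longleftrightarrow>
     (\<exists>g. (\<forall>k. has_iterated_limit is f (\<nu>(i := k)) (g k)) \<and> g \<longlonglongrightarrow> L)"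

text \<open>
  In the following, \<open>x i n\<close> is $x^i_n$ and \<open>\<nu> i\<close> is $n_i$.  The iterated limits run over all
  coordinates \<open>1, \<dots>, m\<close> on which the norm depends, so the starting point \<open>\<lambda>_. 0\<close> is
  immaterial.
\<close>
definition asymptotically_symmetric :: "'a::real_normed_vector set \<Rightarrow> bool" where
  "asymptotically_symmetric X \<longleftrightarrow>
     (\<exists>C. \<forall>m (x :: nat \<Rightarrow> nat \<Rightarrow> 'a) \<sigma> L L'.
        (\<forall>i\<in>{1..m}. range (x i) \<subseteq> X \<and> bounded (range (x i))) \<longrightarrow>
        \<sigma> permutes {1..m} \<longrightarrow>
        has_iterated_limit [1..<Suc m] (\<lambda>\<nu>. norm (\<Sum>i=1..m. x i (\<nu> i))) (\<lambda>_. 0) L \<longrightarrow>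
        has_iterated_limit (map \<sigma> [1..<Suc m]) (\<lambda>\<nu>. norm (\<Sum>i=1..m. x i (\<nu> i))) (\<lambda>_. 0) L' \<longrightarrow>
        L \<le> C * L')"


section \<open>Existence and uniqueness of the norm\<close>

lemma c00_zero: "(\<lambda>i. 0) \<in> c00"
  by (simp add: c00_def)

lemma c00_add: "x \<in> c00 \<Longrightarrow> y \<in> c00 \<Longrightarrow> (\<lambda>i. x i + y i) \<in> c00"
  unfolding c00_def
  by (auto intro: finite_subset[where B = "{i. x i \<noteq> 0} \<union> {i. y i \<noteq> 0}"])

lemma c00_scale: "x \<in> c00 \<Longrightarrow> (\<lambda>i. c * x i) \<in> c00"
  unfolding c00_def by (auto elim: finite_subset[rotated])

lemma c00_restr: "x \<in> c00 \<Longrightarrow> restr E x \<in> c00"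
  unfolding c00_def restr_def by (auto elim: finite_subset[rotated])

inductive_set norming :: "(nat \<Rightarrow> real) set" where
  unit: "\<bar>s\<bar> = 1 \<Longrightarrow> (\<lambda>i. if i = j then s else 0) \<in> norming"
| step: "\<lbrakk>1 \<le> n; successive n E; \<forall>i\<in>{1..n}. f i \<in> norming\<rbrakk>
    \<Longrightarrow> (\<lambda>j. 1 / (2 * sqrt (real n)) * (\<Sum>i=1..n. restr (E i) (f i) j)) \<in> norming"

definition pairing :: "(nat \<Rightarrow> real) \<Rightarrow> (nat \<Rightarrow> real) \<Rightarrow> real" where
  "pairing f x = (\<Sum>j | x j \<noteq> 0. f j * x j)"

definition Ti_nrm :: "(nat \<Rightarrow> real) \<Rightarrow> real" where
  "Ti_nrm x = (SUP f\<in>norming. pairing f x)"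

lemma pairing_eq:
  assumes "finite S" "{j. x j \<noteq> 0} \<subseteq> S"
  shows "pairing f x = (\<Sum>j\<in>S. f j * x j)"
  unfolding pairing_def using assms by (intro sum.mono_neutral_left) auto

lemma successive_disjoint:
  assumes "successive n E" "i \<in> {1..n}" "k \<in> {1..n}" "i \<noteq> k" "j \<in> E k"
  shows "j \<notin> E i"
proof (cases "i < k")
  case True
  then show ?thesis using assms unfolding successive_def by (metis atLeastAtMost_iff less_irrefl)
next
  case False
  then have "k < i" using assms by simp
  then show ?thesis using assms unfolding successive_def by (metis atLeastAtMost_iff less_irrefl)
qed

lemma coeff_bounds:
  assumes "1 \<le> n"
  shows "0 \<le> 1 / (2 * sqrt (real n))" "1 / (2 * sqrt (real n)) \<le> 1"
proof -
  have "1 \<le> sqrt (real n)" using assms by simp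
  then have "1 \<le> 2 * sqrt (real n)" by linarith
  then show "0 \<le> 1 / (2 * sqrt (real n))" "1 / (2 * sqrt (real n)) \<le> 1"
    using assms by (simp_all add: divide_le_eq)
qed

lemma norming_bound: "f \<in> norming \<Longrightarrow> \<bar>f j\<bar> \<le> 1"
proof (induction rule: norming.induct)
  case (unit s k)
  then show ?case by auto
next
  case (step n E f)
  have c: "1 / (2 * sqrt (real n)) \<le> 1" "0 \<le> 1 / (2 * sqrt (real n))"
    using coeff_bounds[OF step.hyps(1)] by auto
  have "\<bar>\<Sum>i=1..n. restr (E i) (f i) j\<bar> \<le> 1"
  proof (cases "\<exists>k\<in>{1..n}. j \<in> E k")
    case True
    then obtain k where k: "k \<in> {1..n}" "j \<in> E k" by blast
    have z: "restr (E i) (f i) j = 0" if "i \<in> {1..n} - {k}" for i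
    proof -
      have "j \<notin> E i" using successive_disjoint[OF step.hyps(2) _ _ _ k(2)] that k(1) by auto
      then show ?thesis by (simp add: restr_def)
    qed
    have "(\<Sum>i=1..n. restr (E i) (f i) j) = (\<Sum>i\<in>{k}. restr (E i) (f i) j)"
      using k z by (intro sum.mono_neutral_right) auto
    then show ?thesis using k step by (simp add: restr_def)
  next
    case False
    then have "(\<Sum>i=1..n. restr (E i) (f i) j) = 0"
      by (intro sum.neutral) (auto simp: restr_def)
    then show ?thesis by simp
  qed
  then have "\<bar>1 / (2 * sqrt (real n))\<bar> * \<bar>\<Sum>i=1..n. restr (E i) (f i) j\<bar> \<le> 1 * 1"
    using c by (intro mult_mono) auto
  then show ?case by (simp only: abs_mult mult_1)
qed

lemma norming_uminus: "f \<in> norming \<Longrightarrow> (\<lambda>j. - f j) \<in> norming"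
proof (induction rule: norming.induct)
  case (unit s k)
  have "(\<lambda>j. - (if j = k then s else 0)) = (\<lambda>j. if j = k then - s else 0)" by auto
  then show ?case using norming.unit[of "- s" k] unit by simp
next
  case (step n E f)
  have "(\<lambda>j. - (1 / (2 * sqrt (real n)) * (\<Sum>i=1..n. restr (E i) (f i) j)))
      = (\<lambda>j. 1 / (2 * sqrt (real n)) * (\<Sum>i=1..n. restr (E i) (\<lambda>j. - f i j) j))"
  proof
    fix j
    have "(\<Sum>i=1..n. restr (E i) (\<lambda>j. - f i j) j) = - (\<Sum>i=1..n. restr (E i) (f i) j)"
      unfolding sum_negf[symmetric] by (intro sum.cong) (auto simp: restr_def)
    then show "- (1 / (2 * sqrt (real n)) * (\<Sum>i=1..n. restr (E i) (f i) j))
      = 1 / (2 * sqrt (real n)) * (\<Sum>i=1..n. restr (E i) (\<lambda>j. - f i j) j)" by simp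
  qed
  then show ?case using norming.step[of n E "\<lambda>i j. - f i j"] step by simp
qed

lemma norming_nonempty: "norming \<noteq> {}"
  using norming.unit[of 1 0] by auto

lemma pairing_le_l1: "f \<in> norming \<Longrightarrow> pairing f x \<le> (\<Sum>j | x j \<noteq> 0. \<bar>x j\<bar>)"
  unfolding pairing_def
proof (rule sum_mono)
  fix j assume f: "f \<in> norming"
  have "f j * x j \<le> \<bar>f j\<bar> * \<bar>x j\<bar>" by (metis abs_ge_self abs_mult)
  also have "\<dots> \<le> 1 * \<bar>x j\<bar>" by (intro mult_right_mono norming_bound f) simp
  finally show "f j * x j \<le> \<bar>x j\<bar>" by simp
qed

lemma pairing_le_Ti_nrm: "f \<in> norming \<Longrightarrow> pairing f x \<le> Ti_nrm x"
  unfolding Ti_nrm_def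
  by (intro cSUP_upper bdd_aboveI2[where M = "\<Sum>j | x j \<noteq> 0. \<bar>x j\<bar>"] pairing_le_l1)

lemma Ti_nrm_le: "(\<And>f. f \<in> norming \<Longrightarrow> pairing f x \<le> b) \<Longrightarrow> Ti_nrm x \<le> b"
  unfolding Ti_nrm_def using norming_nonempty by (intro cSUP_least)

lemma pairing_add:
  assumes "x \<in> c00" "y \<in> c00"
  shows "pairing f (\<lambda>i. x i + y i) = pairing f x + pairing f y"
proof -
  define S where "S = {j. x j \<noteq> 0} \<union> {j. y j \<noteq> 0}"
  have S: "finite S" using assms by (auto simp: S_def c00_def)
  have "pairing f (\<lambda>i. x i + y i) = (\<Sum>j\<in>S. f j * (x j + y j))"
    "pairing f x = (\<Sum>j\<in>S. f j * x j)" "pairing f y = (\<Sum>j\<in>S. f j * y j)"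
    by (rule pairing_eq[OF S]; auto simp: S_def)+
  then show ?thesis by (simp add: algebra_simps sum.distrib)
qed

lemma pairing_scale: "x \<in> c00 \<Longrightarrow> pairing f (\<lambda>i. c * x i) = c * pairing f x"
proof -
  assume "x \<in> c00"
  then have S: "finite {j. x j \<noteq> 0}" by (simp add: c00_def)
  have "pairing f (\<lambda>i. c * x i) = (\<Sum>j | x j \<noteq> 0. f j * (c * x j))"
    by (rule pairing_eq[OF S]) auto
  then show ?thesis by (simp add: pairing_def sum_distrib_left algebra_simps)
qed

lemma pairing_uminus: "pairing (\<lambda>j. - f j) x = - pairing f x"
  by (simp add: pairing_def sum_negf)

lemma abs_pairing_le_Ti_nrm: "f \<in> norming \<Longrightarrow> \<bar>pairing f x\<bar> \<le> Ti_nrm x"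
  using pairing_le_Ti_nrm[of f x] pairing_le_Ti_nrm[OF norming_uminus, of f x]
  by (simp add: pairing_uminus)

lemma pairing_unit:
  assumes "x \<in> c00"
  shows "pairing (\<lambda>i. if i = j then s else 0) x = s * x j"
proof -
  have "finite ({j. x j \<noteq> 0} \<union> {j})" using assms by (simp add: c00_def)
  then have "pairing (\<lambda>i. if i = j then s else 0) x
      = (\<Sum>i\<in>{j. x j \<noteq> 0} \<union> {j}. (if i = j then s else 0) * x i)"
    by (rule pairing_eq) auto
  also have "\<dots> = (\<Sum>i\<in>{j}. (if i = j then s else 0) * x i)"
    using assms by (intro sum.mono_neutral_right) (auto simp: c00_def)
  finally show ?thesis by simp
qed

lemma pairing_step:
  assumes "x \<in> c00"
  shows "pairing (\<lambda>j. c * (\<Sum>i=1..n. restr (E i) (f i) j)) x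
       = c * (\<Sum>i=1..n. pairing (f i) (restr (E i) x))"
proof -
  define S where "S = {j. x j \<noteq> 0}"
  have S: "finite S" using assms by (simp add: S_def c00_def)
  have "pairing (f i) (restr (E i) x) = (\<Sum>j\<in>S. f i j * restr (E i) x j)" for i
    by (rule pairing_eq[OF S]) (auto simp: S_def restr_def)
  then have "pairing (f i) (restr (E i) x) = (\<Sum>j\<in>S. restr (E i) (f i) j * x j)" for i
    by (auto simp: restr_def intro!: sum.cong)
  then have "(\<Sum>i=1..n. pairing (f i) (restr (E i) x))
      = (\<Sum>i=1..n. \<Sum>j\<in>S. restr (E i) (f i) j * x j)" by simp
  also have "\<dots> = (\<Sum>j\<in>S. \<Sum>i=1..n. restr (E i) (f i) j * x j)" by (rule sum.swap)
  finally show ?thesis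
    unfolding pairing_def S_def[symmetric]
    by (simp only: sum_distrib_left sum_distrib_right mult.assoc)
qed

lemma abs_le_Ti_nrm: "x \<in> c00 \<Longrightarrow> \<bar>x j\<bar> \<le> Ti_nrm x"
  using abs_pairing_le_Ti_nrm[OF norming.unit[of 1 j], of x] by (simp add: pairing_unit)

lemma bdd_above_range_c00:
  assumes "x \<in> c00"
  shows "bdd_above (range (\<lambda>i. \<bar>x i\<bar>))"
  using abs_le_Ti_nrm[OF assms] by (intro bdd_aboveI2)

lemma Ti_nrm_zero: "Ti_nrm (\<lambda>i. 0) = 0"
  using norming_nonempty by (simp add: Ti_nrm_def pairing_def)

lemma Ti_nrm_scale_le:
  assumes "x \<in> c00"
  shows "Ti_nrm (\<lambda>i. c * x i) \<le> \<bar>c\<bar> * Ti_nrm x"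
proof (rule Ti_nrm_le)
  fix f assume f: "f \<in> norming"
  have "c * pairing f x \<le> \<bar>c\<bar> * \<bar>pairing f x\<bar>" by (metis abs_ge_self abs_mult)
  also have "\<dots> \<le> \<bar>c\<bar> * Ti_nrm x"
    using abs_pairing_le_Ti_nrm[OF f] by (intro mult_left_mono) auto
  finally show "pairing f (\<lambda>i. c * x i) \<le> \<bar>c\<bar> * Ti_nrm x" by (simp add: pairing_scale[OF assms])
qed

lemma is_norm_on_c00_Ti_nrm: "is_norm_on_c00 Ti_nrm"
  unfolding is_norm_on_c00_def
proof (intro conjI ballI allI)
  fix x assume x: "x \<in> c00"
  show "0 \<le> Ti_nrm x" using abs_le_Ti_nrm[OF x, of 0] by linarith
  show "Ti_nrm x = 0 \<longleftrightarrow> x = (\<lambda>i. 0)"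
  proof
    assume "Ti_nrm x = 0"
    then show "x = (\<lambda>i. 0)" using abs_le_Ti_nrm[OF x] by (simp add: fun_eq_iff)
  qed (simp add: Ti_nrm_zero)
next
  fix x c assume x: "x \<in> c00"
  show "Ti_nrm (\<lambda>i. c * x i) = \<bar>c\<bar> * Ti_nrm x"
  proof (cases "c = 0")
    case False
    have "Ti_nrm x \<le> \<bar>inverse c\<bar> * Ti_nrm (\<lambda>i. c * x i)"
      using Ti_nrm_scale_le[OF c00_scale[OF x], of "inverse c" c] False
      by (simp add: mult.assoc[symmetric])
    then have "\<bar>c\<bar> * Ti_nrm x \<le> Ti_nrm (\<lambda>i. c * x i)" using False by (simp add: field_simps)
    then show ?thesis using Ti_nrm_scale_le[OF x, of c] by linarith
  qed (simp add: Ti_nrm_zero)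
next
  fix x y assume xy: "x \<in> c00" "y \<in> c00"
  show "Ti_nrm (\<lambda>i. x i + y i) \<le> Ti_nrm x + Ti_nrm y"
    by (rule Ti_nrm_le) (simp add: pairing_add[OF xy] add_mono pairing_le_Ti_nrm)
qed

lemma Ti_sumsI:
  "1 \<le> n \<Longrightarrow> successive n E
    \<Longrightarrow> 1 / (2 * sqrt (real n)) * (\<Sum>i=1..n. N (restr (E i) x)) \<in> Ti_sums N x"
  unfolding Ti_sums_def by (intro CollectI exI[of _ n] exI[of _ E] conjI refl)

lemma Ti_sumsE:
  assumes "v \<in> Ti_sums N x"
  obtains n E where "1 \<le> n" "successive n E"
    "v = 1 / (2 * sqrt (real n)) * (\<Sum>i=1..n. N (restr (E i) x))"
  using assms unfolding Ti_sums_def by (elim CollectE exE conjE) (rule that)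

lemma Ti_sums_nonempty: "Ti_sums N x \<noteq> {}"
  unfolding ex_in_conv[symmetric]
  by (rule exI, rule Ti_sumsI[of 1 "\<lambda>_. {}"]) (simp_all add: successive_def)

lemma Ti_sums_Ti_nrm_le:
  assumes x: "x \<in> c00" and v: "v \<in> Ti_sums Ti_nrm x"
  shows "v \<le> Ti_nrm x"
proof -
  obtain n E where n: "1 \<le> n" and E: "successive n E"
    and v: "v = 1 / (2 * sqrt (real n)) * (\<Sum>i=1..n. Ti_nrm (restr (E i) x))"
    using v by (rule Ti_sumsE)
  show ?thesis
  proof (rule field_le_epsilon)
    fix e :: real assume e: "0 < e"
    have "\<exists>f\<in>norming. Ti_nrm (restr (E i) x) - e / n < pairing f (restr (E i) x)" for i
    proof (rule ccontr)
      assume "\<not> ?thesis"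
      then have "Ti_nrm (restr (E i) x) \<le> Ti_nrm (restr (E i) x) - e / n"
        by (intro Ti_nrm_le) force
      then show False using e n by (simp add: field_simps)
    qed
    then obtain f where f: "\<And>i. f i \<in> norming"
      "\<And>i. Ti_nrm (restr (E i) x) - e / n < pairing (f i) (restr (E i) x)" by metis
    note c = coeff_bounds[OF n]
    have "(\<Sum>i=1..n. Ti_nrm (restr (E i) x)) \<le> (\<Sum>i=1..n. pairing (f i) (restr (E i) x) + e / n)"
      using f(2) by (intro sum_mono) (simp add: less_imp_le algebra_simps)
    also have "\<dots> = (\<Sum>i=1..n. pairing (f i) (restr (E i) x)) + e"
      using n by (simp add: sum.distrib)
    finally have "v \<le> 1 / (2 * sqrt (real n)) * ((\<Sum>i=1..n. pairing (f i) (restr (E i) x)) + e)"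
      unfolding v using c by (intro mult_left_mono)
    also have "\<dots> \<le> pairing (\<lambda>j. 1 / (2 * sqrt (real n)) * (\<Sum>i=1..n. restr (E i) (f i) j)) x + e"
      unfolding pairing_step[OF x] distrib_left
      by (intro add_left_mono mult_left_le_one_le c less_imp_le[OF e])
    also have "\<dots> \<le> Ti_nrm x + e"
      by (intro add_right_mono pairing_le_Ti_nrm norming.step n E) (simp add: f)
    finally show "v \<le> Ti_nrm x + e" .
  qed
qed

theorem is_Ti_norm_exists: "\<exists>N. is_Ti_norm N"
proof
  show "is_Ti_norm Ti_nrm"
    unfolding is_Ti_norm_def
  proof (intro conjI is_norm_on_c00_Ti_nrm ballI antisym)
    fix x assume x: "x \<in> c00"
    show bdd: "bdd_above (Ti_sums Ti_nrm x)"
      using Ti_sums_Ti_nrm_le[OF x] by (intro bdd_aboveI)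
    show "max (SUP i. \<bar>x i\<bar>) (Sup (Ti_sums Ti_nrm x)) \<le> Ti_nrm x"
      by (intro max.boundedI cSUP_least cSup_least Ti_sums_nonempty)
        (auto simp: abs_le_Ti_nrm[OF x] Ti_sums_Ti_nrm_le[OF x])
    show "Ti_nrm x \<le> max (SUP i. \<bar>x i\<bar>) (Sup (Ti_sums Ti_nrm x))"
    proof (rule Ti_nrm_le)
      fix f assume "f \<in> norming"
      then show "pairing f x \<le> max (SUP i. \<bar>x i\<bar>) (Sup (Ti_sums Ti_nrm x))"
      proof cases
        case (unit s j)
        have "pairing f x = s * x j" using unit by (simp add: pairing_unit[OF x])
        also have "\<dots> \<le> \<bar>x j\<bar>" using unit(2) by (metis abs_ge_self abs_mult mult_1)
        also have "\<dots> \<le> (SUP i. \<bar>x i\<bar>)"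
          by (rule cSUP_upper[OF _ bdd_above_range_c00[OF x]]) simp
        finally show ?thesis by simp
      next
        case (step n E g)
        have "pairing f x = 1 / (2 * sqrt (real n)) * (\<Sum>i=1..n. pairing (g i) (restr (E i) x))"
          unfolding step(1) by (rule pairing_step[OF x])
        also have "\<dots> \<le> 1 / (2 * sqrt (real n)) * (\<Sum>i=1..n. Ti_nrm (restr (E i) x))"
          using step(4) by (intro mult_left_mono sum_mono pairing_le_Ti_nrm) auto
        also have "\<dots> \<le> Sup (Ti_sums Ti_nrm x)"
          by (rule cSup_upper[OF Ti_sumsI[OF step(2,3)] bdd])
        finally show ?thesis by simp
      qed
    qed
  qed
qed

lemma is_Ti_normD:
  assumes "is_Ti_norm N" "x \<in> c00"
  shows "bdd_above (Ti_sums N x)" "N x = max (SUP i. \<bar>x i\<bar>) (Sup (Ti_sums N x))"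
    "0 \<le> N x" "N (\<lambda>i. 0) = 0"
proof -
  show "bdd_above (Ti_sums N x)" "N x = max (SUP i. \<bar>x i\<bar>) (Sup (Ti_sums N x))"
    using bspec[OF conjunct2[OF assms(1)[unfolded is_Ti_norm_def]] assms(2)]
    by (rule conjunct1, rule conjunct2)
  have *: "\<forall>x\<in>c00. 0 \<le> N x \<and> (N x = 0 \<longleftrightarrow> x = (\<lambda>i. 0))"
    using assms(1) unfolding is_Ti_norm_def is_norm_on_c00_def by (elim conjE)
  show "0 \<le> N x" using bspec[OF * assms(2)] by (rule conjunct1)
  show "N (\<lambda>i. 0) = 0" using bspec[OF * c00_zero] by simp
qed

theorem is_Ti_norm_unique:
  assumes M: "is_Ti_norm M" and N: "is_Ti_norm N" and x: "x \<in> c00"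
  shows "M x = N x"
proof -
  have le: "M x \<le> N x"
    if M: "is_Ti_norm M" and N: "is_Ti_norm N" and x: "x \<in> c00"
      and IH: "\<And>y. y \<in> c00 \<Longrightarrow> {i. y i \<noteq> 0} \<subset> {i. x i \<noteq> 0} \<Longrightarrow> M y = N y"
    for M N x
  proof -
    note Nx = is_Ti_normD(1-3)[OF N x] and Mx = is_Ti_normD(2,3)[OF M x]
      and M0 = is_Ti_normD(4)[OF M x]
    have "v \<le> max (N x) (M x / 2)" if vM: "v \<in> Ti_sums M x" for v
    proof -
      obtain n E where n: "1 \<le> n" and E: "successive n E"
        and v: "v = 1 / (2 * sqrt (real n)) * (\<Sum>i=1..n. M (restr (E i) x))"
        using vM by (rule Ti_sumsE)
      show ?thesis
      proof (cases "\<exists>k\<in>{1..n}. {j. x j \<noteq> 0} \<subseteq> E k")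
        case True
        then obtain k where k: "k \<in> {1..n}" "{j. x j \<noteq> 0} \<subseteq> E k" by blast
        have z: "M (restr (E i) x) = 0" if "i \<in> {1..n} - {k}" for i
        proof -
          have "x j = 0" if "j \<in> E i" for j
          proof (rule ccontr)
            assume "x j \<noteq> 0"
            then have "j \<in> E k" using k by blast
            then show False
              using successive_disjoint[OF E, of i k j] that \<open>i \<in> {1..n} - {k}\<close> k(1) by auto
          qed
          then have "restr (E i) x = (\<lambda>i. 0)" by (auto simp: restr_def)
          then show ?thesis using M0 by simp
        qed
        have xk: "restr (E k) x = x" using k(2) by (auto simp: restr_def fun_eq_iff)
        have "(\<Sum>i=1..n. M (restr (E i) x)) = (\<Sum>i\<in>{k}. M (restr (E i) x))"
          using k(1) z by (intro sum.mono_neutral_right) auto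
        then have "v = M x / (2 * sqrt (real n))" using xk v by simp
        also have "\<dots> \<le> M x / 2" using n Mx(2) by (intro divide_left_mono) auto
        finally show ?thesis by simp
      next
        case False
        have "M (restr (E i) x) = N (restr (E i) x)" if "i \<in> {1..n}" for i
        proof -
          have "{j. restr (E i) x j \<noteq> 0} \<subset> {j. x j \<noteq> 0}"
            using False that by (auto simp: restr_def)
          then show ?thesis by (intro IH c00_restr x)
        qed
        then have "v = 1 / (2 * sqrt (real n)) * (\<Sum>i=1..n. N (restr (E i) x))" using v by simp
        then have "v \<in> Ti_sums N x" using Ti_sumsI[OF n E] by simp
        then have "v \<le> Sup (Ti_sums N x)" by (rule cSup_upper[OF _ Nx(1)])
        then show ?thesis using Nx(2) by linarith
      qed
    qed
    then have "Sup (Ti_sums M x) \<le> max (N x) (M x / 2)" by (intro cSup_least Ti_sums_nonempty)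
    then have "M x \<le> max (N x) (M x / 2)" using Mx(1) Nx(2) by linarith
    then show ?thesis using Nx(3) Mx(2) by linarith
  qed
  have "finite {i. x i \<noteq> 0}" using x by (simp add: c00_def)
  then show ?thesis using x
  proof (induction "{i. x i \<noteq> 0}" arbitrary: x rule: finite_psubset_induct)
    case psubset
    have IH: "M y = N y" if "y \<in> c00" "{i. y i \<noteq> 0} \<subset> {i. x i \<noteq> 0}" for y
      using psubset.hyps(2)[OF that(2,1)] .
    show ?case
      using le[OF M N psubset.prems] le[OF N M psubset.prems] IH by (metis order.antisym)
  qed
qed

end

theory Submission
  imports Defs "HOL-Complex_Analysis.Great_Picard"
begin

text \<open>
  Two estimates for the norm $N$ of $Ti(2;1/2)$ carry the proof. Let \<open>v 1 < \<dots> < v n\<close> be finitely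
  supported successive vectors and write \<open>\<ell>\<close> for the $\ell_2$-norm of \<open>(N (v 1), \<dots>, N (v n))\<close>.

  \<^item> Upper estimate: \<open>N (v 1 + \<dots> + v n) \<le> 2 * \<ell>\<close>. It is proved by induction on norming
    functionals; see \<open>pairing_le_upper_l2\<close>.

  \<^item> Lower estimate: if all coordinates are bounded by \<open>t\<close>, then
    \<open>\<ell> \<le> 8 * N (v 1 + \<dots> + v n) + 4 * t * sqrt n\<close>. The defining equation of the norm gives a good
    lower bound for sums of pieces of nearly \<^emph>\<open>equal\<close> norm: \<open>K\<close> successive pieces of norm at
    least \<open>t\<close> add up to norm at least \<open>t * sqrt K / 2\<close>. Vectors with small coordinates can be
    cut into such pieces, and by the upper estimate the number of pieces cut from \<open>v i\<close> is at
    least proportional to \<open>(N (v i) / t)\<^sup>2\<close>, up to a bounded error. So unequal norms turn into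
    unequal numbers of pieces; see \<open>many_large_pieces\<close> and \<open>Ti_nrm_lower_l2_cuts\<close>.

  The lower estimate is only useful if the coordinates of the vectors are small compared with
  their norms. Sums of many successive vectors of norm 1 have this property, because \<open>N\<close> grows
  like \<open>sqrt n\<close> on such sums while the coordinates stay bounded. Hence every infinite
  dimensional subspace contains a normalized sequence \<open>z\<close> of almost successive vectors whose sup
  norms tend to \<open>0\<close> as fast as desired (\<open>exists_small_coord\<close>, \<open>exists_almost_block\<close>). Such a
  sequence is a basis of its closed span \<open>Z\<close>, and all coordinates of a normalized block of it
  that starts at \<open>z (n - 1)\<close> or later are far below \<open>1 / sqrt n\<close>. The two estimates then say
  that \<open>z\<close> is an asymptotic $\ell_2$ basis of \<open>Z\<close> (\<open>flat_asymptotic_l2\<close>).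

  The same \<open>Z\<close> is asymptotically symmetric. Its coordinates are uniformly small far out
  (\<open>uniform_tails\<close>), so a bounded sequence in \<open>Z\<close> has a subsequence that converges in the sup
  norm to some \<open>y\<close>, which lies in the whole space since that is boundedly complete. Along an
  iterated limit the differences from these limits \<open>y 1, \<dots>, y m\<close> can be taken almost successive,
  with small coordinates and with norms close to numbers \<open>\<rho> 1, \<dots>, \<rho> m\<close>. Both estimates apply,
  and up to an absolute constant the iterated limit is the norm of \<open>y 1 + \<dots> + y m\<close> plus the
  $\ell_2$-norm of \<open>(\<rho> 1, \<dots>, \<rho> m)\<close>, which does not depend on the order of the limits
  (\<open>iterated_limit_estimates\<close>).
\<close>

section \<open>Restrictions and the norm\<close>

lemma Ti_nrm_nonneg: "x \<in> c00 \<Longrightarrow> 0 \<le> Ti_nrm x"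
  using is_norm_on_c00_Ti_nrm by (auto simp: is_norm_on_c00_def)

lemma Ti_nrm_add_le:
  "x \<in> c00 \<Longrightarrow> y \<in> c00 \<Longrightarrow> Ti_nrm (\<lambda>l. x l + y l) \<le> Ti_nrm x + Ti_nrm y"
  using is_norm_on_c00_Ti_nrm by (auto simp: is_norm_on_c00_def)

lemma c00_sum: "(\<And>i. i \<in> S \<Longrightarrow> h i \<in> c00) \<Longrightarrow> (\<lambda>l. \<Sum>i\<in>S. h i l) \<in> c00"
  by (induction S rule: infinite_finite_induct) (auto simp: c00_zero c00_add)

lemma Ti_nrm_sum_le:
  "(\<And>i. i \<in> S \<Longrightarrow> h i \<in> c00) \<Longrightarrow> Ti_nrm (\<lambda>l. \<Sum>i\<in>S. h i l) \<le> (\<Sum>i\<in>S. Ti_nrm (h i))"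
proof (induction S rule: infinite_finite_induct)
  case (insert i S)
  have "Ti_nrm (\<lambda>l. h i l + (\<Sum>i\<in>S. h i l)) \<le> Ti_nrm (h i) + Ti_nrm (\<lambda>l. \<Sum>i\<in>S. h i l)"
    using insert.prems by (intro Ti_nrm_add_le c00_sum) auto
  then show ?case using insert by fastforce
qed (auto simp: Ti_nrm_zero)

lemma restr_commute: "restr E (restr F x) = restr F (restr E x)"
  by (auto simp: restr_def)

lemma restr_restr: "restr E (restr F x) = restr (E \<inter> F) x"
  by (auto simp: restr_def)

text \<open>
  Induction on the norming functional. A restriction of a norming functional need not be
  norming, so the restriction has to be moved past the sets of the functional to the vector.
\<close>

lemma Ti_nrm_restr_le:
  assumes "x \<in> c00"
  shows "Ti_nrm (restr E x) \<le> Ti_nrm x"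
proof (rule Ti_nrm_le)
  fix f assume "f \<in> norming"
  then show "pairing f (restr E x) \<le> Ti_nrm x" using assms
  proof (induction arbitrary: x rule: norming.induct)
    case (unit s j)
    have "s * restr E x j \<le> \<bar>s\<bar> * \<bar>restr E x j\<bar>" by (metis abs_ge_self abs_mult)
    also have "\<dots> \<le> \<bar>x j\<bar>" using unit(1) by (simp add: restr_def)
    also have "\<dots> \<le> Ti_nrm x" by (rule abs_le_Ti_nrm[OF unit(2)])
    finally show ?case by (simp add: pairing_unit c00_restr unit(2))
  next
    case (step n D f)
    have IH: "pairing (f i) (restr E (restr (D i) x)) \<le> Ti_nrm (restr (D i) x)"
      if "i \<in> {1..n}" for i
      using bspec[OF step.IH that] c00_restr[OF step.prems] by blast
    have "pairing (\<lambda>j. 1 / (2 * sqrt (real n)) * (\<Sum>i=1..n. restr (D i) (f i) j)) (restr E x)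
        = 1 / (2 * sqrt (real n)) * (\<Sum>i=1..n. pairing (f i) (restr E (restr (D i) x)))"
      by (subst pairing_step) (simp_all add: c00_restr step.prems restr_commute)
    also have "\<dots> \<le> 1 / (2 * sqrt (real n)) * (\<Sum>i=1..n. Ti_nrm (restr (D i) x))"
      by (intro mult_left_mono sum_mono IH) simp_all
    also have "\<dots> \<le> Ti_nrm x"
      by (rule Ti_sums_Ti_nrm_le[OF step.prems Ti_sumsI[OF step.hyps]])
    finally show ?case .
  qed
qed

text \<open>
  This is one half of the implicit equation, for a family of successive sets indexed by an
  arbitrary finite set of numbers.
\<close>

lemma sum_Ti_nrm_restr_le:
  fixes M :: "nat set"
  assumes x: "x \<in> c00" and M: "finite M"
    and E: "\<And>i j a b. i \<in> M \<Longrightarrow> j \<in> M \<Longrightarrow> i < j \<Longrightarrow> a \<in> E i \<Longrightarrow> b \<in> E j \<Longrightarrow> a < b"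
  shows "(\<Sum>j\<in>M. Ti_nrm (restr (E j) x)) \<le> 2 * sqrt (card M) * Ti_nrm x"
proof (cases "M = {}")
  case False
  define n where "n = card M"
  have n: "1 \<le> n" using False M by (simp add: n_def Suc_le_eq card_gt_0_iff)
  (* The increasing enumeration of M, starting at index 1 as in the implicit equation. *)
  define h where "h i = sorted_list_of_set M ! (i - 1)" for i
  have len: "length (sorted_list_of_set M) = n" by (simp add: n_def M)
  have h_in: "h i \<in> M" if "1 \<le> i" "i \<le> n" for i
    using nth_mem[of "i - 1" "sorted_list_of_set M"] that len M by (simp add: h_def)
  have h_less: "h i < h j" if "1 \<le> i" "i < j" "j \<le> n" for i j
    using sorted_wrt_nth_less[OF strict_sorted_list_of_set, of "i - 1" "j - 1" M] that len
    by (simp add: h_def)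
  have inj: "inj_on h {1..n}"
    by (rule linorder_inj_onI') (use h_less in fastforce)
  have img: "h ` {1..n} = M"
    using inj h_in M by (intro card_subset_eq) (auto simp: card_image n_def)
  have "successive n (\<lambda>i. E (h i))"
    unfolding successive_def using E h_in h_less by (metis le_trans less_imp_le_nat)
  then have "1 / (2 * sqrt n) * (\<Sum>i=1..n. Ti_nrm (restr (E (h i)) x)) \<le> Ti_nrm x"
    by (rule Ti_sums_Ti_nrm_le[OF x Ti_sumsI[OF n]])
  moreover have "(\<Sum>i=1..n. Ti_nrm (restr (E (h i)) x)) = (\<Sum>j\<in>M. Ti_nrm (restr (E j) x))"
    using sum.reindex[OF inj, of "\<lambda>j. Ti_nrm (restr (E j) x)"] img by simp
  ultimately show ?thesis using n by (simp add: n_def[symmetric] field_simps)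
qed simp

section \<open>The upper $\ell_2$ estimate\<close>

text \<open>
  If the sets \<open>E 1 < \<dots> < E m\<close> meet successive sets \<open>F i\<close>, then two different \<open>F i\<close> share at most
  one \<open>E j\<close>, namely the last one that meets the first of the two. After removing the last
  element from each index set \<open>M i\<close> the rest are disjoint, and at least half of each \<open>M i\<close> is
  left.
\<close>

lemma sum_card_meeting_le:
  fixes M :: "nat \<Rightarrow> nat set"
  assumes "finite S" and M: "\<And>i. i \<in> S \<Longrightarrow> M i \<subseteq> {1..m}" "\<And>i. i \<in> S \<Longrightarrow> 2 \<le> card (M i)"
    and noncross: "\<And>i k j j'. i \<in> S \<Longrightarrow> k \<in> S \<Longrightarrow> i < k \<Longrightarrow> j \<in> M k \<Longrightarrow> j' \<in> M i \<Longrightarrow> j' \<le> j"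
  shows "(\<Sum>i\<in>S. card (M i)) \<le> 2 * m"
proof -
  have fin: "finite (M i)" if "i \<in> S" for i using M(1)[OF that] finite_subset by blast
  (* Only the last element of M i can occur in a later M k. *)
  define M' where "M' i = M i - {Max (M i)}" for i
  have ne: "M i \<noteq> {}" if "i \<in> S" for i using M(2)[OF that] by auto
  have card': "card (M i) \<le> 2 * card (M' i)" if "i \<in> S" for i
    using M(2)[OF that] Max_in[OF fin[OF that] ne[OF that]] fin[OF that] by (simp add: M'_def)
  have less: "M' i \<inter> M' k = {}" if "i \<in> S" "k \<in> S" "i < k" for i k
  proof (rule ccontr)
    assume "M' i \<inter> M' k \<noteq> {}"
    then obtain j where j: "j \<in> M i" "j \<noteq> Max (M i)" "j \<in> M k" by (auto simp: M'_def)
    have "Max (M i) \<le> j" using noncross[OF that j(3) Max_in] fin ne that by blast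
    then show False using j Max_ge[OF fin[OF that(1)] j(1)] by simp
  qed
  have "(\<Sum>i\<in>S. card (M i)) \<le> (\<Sum>i\<in>S. 2 * card (M' i))" by (rule sum_mono[OF card'])
  also have "\<dots> = 2 * card (\<Union>i\<in>S. M' i)"
    unfolding sum_distrib_left[symmetric]
    by (subst card_UN_disjoint) (use assms(1) fin less in \<open>auto simp: M'_def neq_iff Int_commute\<close>)
  also have "card (\<Union>i\<in>S. M' i) \<le> card {1..m}"
    using M(1) by (intro card_mono) (auto simp: M'_def)
  finally show ?thesis by simp
qed

lemma sum_le_sqrt_card_L2_set:
  fixes f :: "'a \<Rightarrow> real"
  shows "(\<Sum>i\<in>A. f i) \<le> sqrt (card A) * L2_set f A"
proof -
  have "(\<Sum>i\<in>A. f i) \<le> (\<Sum>i\<in>A. \<bar>1\<bar> * \<bar>f i\<bar>)" by (intro sum_mono) simp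
  also have "\<dots> \<le> L2_set (\<lambda>_. 1) A * L2_set f A" by (rule L2_set_mult_ineq)
  finally show ?thesis by (simp add: L2_set_def)
qed

text \<open>
  Let \<open>E 1 < \<dots> < E m\<close> be the sets at the root of the functional. Blocks that meet at most one
  \<open>E j\<close> (the set \<open>G\<close>) are handled by the induction hypothesis, and their contribution is at most
  the $\ell_2$-norm of their norms, with constant 1. Blocks that meet several \<open>E j\<close> (the set
  \<open>S\<close>) are handled by the implicit equation for each block separately: block \<open>i\<close> contributes at
  most \<open>2 * sqrt (card (M i))\<close> times its norm, and the cardinalities add up to at most \<open>2 * m\<close>.
  If \<open>A\<close> and \<open>B\<close> are the $\ell_2$-norms over \<open>G\<close> and \<open>S\<close>, the total is at most \<open>A + sqrt 2 * B\<close>.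
  This is at most \<open>sqrt 3\<close> times the $\ell_2$-norm over all blocks, and the induction closes
  because \<open>sqrt 3 \<le> 2\<close>.
\<close>

lemma pairing_le_upper_l2:
  assumes "f \<in> norming" and "x \<in> c00" and "finite (I :: nat set)"
    and "\<And>i j a b. i \<in> I \<Longrightarrow> j \<in> I \<Longrightarrow> i < j \<Longrightarrow> a \<in> F i \<Longrightarrow> b \<in> F j \<Longrightarrow> a < b"
    and "\<And>l. x l \<noteq> 0 \<Longrightarrow> \<exists>i\<in>I. l \<in> F i"
  shows "pairing f x \<le> 2 * L2_set (\<lambda>i. Ti_nrm (restr (F i) x)) I"
  using assms
proof (induction arbitrary: x I rule: norming.induct)
  case (unit s j)
  show ?case
  proof (cases "x j = 0")
    case False
    then obtain i where i: "i \<in> I" "j \<in> F i" using unit.prems(4) by blast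
    have "s * x j \<le> \<bar>s\<bar> * \<bar>x j\<bar>" by (metis abs_ge_self abs_mult)
    also have "\<dots> = \<bar>restr (F i) x j\<bar>" using i unit(1) by (simp add: restr_def)
    also have "\<dots> \<le> Ti_nrm (restr (F i) x)" by (intro abs_le_Ti_nrm c00_restr unit.prems(1))
    also have "\<dots> \<le> L2_set (\<lambda>i. Ti_nrm (restr (F i) x)) I"
      by (intro member_le_L2_set unit.prems(2) i)
    also have "\<dots> \<le> 2 * L2_set (\<lambda>i. Ti_nrm (restr (F i) x)) I" by simp
    finally show ?thesis by (simp add: pairing_unit unit.prems(1))
  qed (simp add: pairing_unit unit.prems(1))
next
  case (step m E g)
  note x = step.prems(1) and I = step.prems(2) and F = step.prems(3) and cover = step.prems(4)
  have Fdisj: "i = k" if "i \<in> I" "k \<in> I" "l \<in> F i" "l \<in> F k" for i k l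
    using F[OF that(1,2) _ that(3,4)] F[OF that(2,1) _ that(4,3)] by (metis less_irrefl neq_iff)
  define \<nu> where "\<nu> i = Ti_nrm (restr (F i) x)" for i
  define T where "T i j = Ti_nrm (restr (E j) (restr (F i) x))" for i j
  have \<nu>0: "0 \<le> \<nu> i" for i unfolding \<nu>_def by (intro Ti_nrm_nonneg c00_restr x)
  have T0: "0 \<le> T i j" for i j unfolding T_def by (intro Ti_nrm_nonneg c00_restr x)
  have T\<nu>: "T i j \<le> \<nu> i" for i j unfolding T_def \<nu>_def by (intro Ti_nrm_restr_le c00_restr x)
  (* The indices of those E j that cut something out of block i. *)
  define M where "M i = {j\<in>{1..m}. T i j \<noteq> 0}" for i
  have finM: "finite (M i)" for i by (simp add: M_def)
  have meet: "\<exists>a. a \<in> E j \<and> a \<in> F i" if "j \<in> M i" for i j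
  proof (rule ccontr)
    assume "\<not> ?thesis"
    then have "restr (E j) (restr (F i) x) = (\<lambda>_. 0)" by (auto simp: restr_def)
    then show False using that by (simp add: M_def T_def Ti_nrm_zero)
  qed
  define S where "S = {i\<in>I. 2 \<le> card (M i)}"
  define G where "G = I - S"
  have fin: "finite S" "finite G" using I by (auto simp: S_def G_def)
  have SI: "S \<subseteq> I" "G \<subseteq> I" by (auto simp: S_def G_def)
  have Esucc: "a < b" if "j < j'" "j \<in> {1..m}" "j' \<in> {1..m}" "a \<in> E j" "b \<in> E j'" for j j' a b
    using step.hyps(2) that unfolding successive_def by auto
  have cards: "(\<Sum>i\<in>S. card (M i)) \<le> 2 * m"
  proof (rule sum_card_meeting_le[OF fin(1)])
    fix i k j j' assume ik: "i \<in> S" "k \<in> S" "i < k" and j: "j \<in> M k" "j' \<in> M i"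
    obtain a b where a: "a \<in> E j'" "a \<in> F i" and b: "b \<in> E j" "b \<in> F k"
      using meet j by metis
    have "a < b" using F[of i k a b] ik a b SI by blast
    then have "\<not> j < j'" using Esucc[of j j' b a] a b j by (auto simp: M_def)
    then show "j' \<le> j" by simp
  qed (auto simp: M_def S_def)
  (* The induction hypothesis is used for the blocks in G, the triangle inequality for those in S. *)
  have split: "pairing (g j) (restr (E j) x) \<le> 2 * L2_set (\<lambda>i. T i j) G + (\<Sum>i\<in>S. T i j)"
    if j: "j \<in> {1..m}" for j
  proof -
    define u where "u = restr (\<Union>i\<in>G. F i) (restr (E j) x)"
    have u: "u \<in> c00" unfolding u_def by (intro c00_restr x)
    have "restr (E j) x l = u l + (\<Sum>i\<in>S. restr (E j) (restr (F i) x) l)" for l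
    proof (cases "x l = 0")
      case False
      then obtain i where i: "i \<in> I" "l \<in> F i" using cover by blast
      have un: "k = i" if "k \<in> I" "l \<in> F k" for k using Fdisj i that by blast
      show ?thesis
      proof (cases "i \<in> S")
        case True
        have "l \<notin> (\<Union>i\<in>G. F i)" using un SI True by (auto simp: G_def)
        moreover have "(\<Sum>k\<in>S. restr (E j) (restr (F k) x) l)
            = (\<Sum>k\<in>{i}. restr (E j) (restr (F k) x) l)"
          using fin SI True un by (intro sum.mono_neutral_right) (auto simp: restr_def)
        ultimately show ?thesis using i by (simp add: u_def restr_def)
      next
        case False
        then have "l \<in> (\<Union>i\<in>G. F i)" using i by (auto simp: G_def)
        moreover have "(\<Sum>k\<in>S. restr (E j) (restr (F k) x) l) = 0"
          using un SI False by (intro sum.neutral) (auto simp: restr_def)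
        ultimately show ?thesis by (simp add: u_def restr_def)
      qed
    next
      case True
      then have "restr (E j) (restr (F i) x) l = 0" for i by (simp add: restr_def)
      then show ?thesis using True by (simp add: u_def restr_def)
    qed
    then have "restr (E j) x = (\<lambda>l. u l + (\<Sum>i\<in>S. restr (E j) (restr (F i) x) l))" by blast
    then have "pairing (g j) (restr (E j) x)
        = pairing (g j) u + pairing (g j) (\<lambda>l. \<Sum>i\<in>S. restr (E j) (restr (F i) x) l)"
      using pairing_add[OF u c00_sum[of S "\<lambda>i. restr (E j) (restr (F i) x)"]]
      by (simp add: c00_restr x)
    also have "pairing (g j) (\<lambda>l. \<Sum>i\<in>S. restr (E j) (restr (F i) x) l) \<le> (\<Sum>i\<in>S. T i j)"
      unfolding T_def using step.IH j
      by (intro order.trans[OF pairing_le_Ti_nrm Ti_nrm_sum_le] c00_restr x) auto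
    also have "pairing (g j) u \<le> 2 * L2_set (\<lambda>i. Ti_nrm (restr (F i) u)) G"
    proof (rule conjunct2[OF bspec[OF step.IH j], rule_format])
      fix i k a b assume "i \<in> G" "k \<in> G" "i < k" "a \<in> F i" "b \<in> F k"
      then show "a < b" using F[of i k a b] by (simp add: G_def)
    next
      fix l assume "u l \<noteq> 0"
      then show "\<exists>i\<in>G. l \<in> F i" by (auto simp: u_def restr_def split: if_splits)
    qed (use u fin(2) in simp_all)
    also have "L2_set (\<lambda>i. Ti_nrm (restr (F i) u)) G = L2_set (\<lambda>i. T i j) G"
    proof (rule L2_set_cong[OF refl])
      fix i assume "i \<in> G"
      then have "restr (F i) u = restr (E j) (restr (F i) x)" by (auto simp: u_def restr_def)
      then show "Ti_nrm (restr (F i) u) = T i j" by (simp add: T_def)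
    qed
    finally show ?thesis by simp
  qed
  have good: "(\<Sum>j=1..m. L2_set (\<lambda>i. T i j) G) \<le> sqrt m * L2_set \<nu> G"
  proof -
    have "(\<Sum>j=1..m. L2_set (\<lambda>i. T i j) G) \<le> sqrt m * L2_set (\<lambda>j. L2_set (\<lambda>i. T i j) G) {1..m}"
      using sum_le_sqrt_card_L2_set[of _ "{1..m}"] by simp
    also have "L2_set (\<lambda>j. L2_set (\<lambda>i. T i j) G) {1..m} = sqrt (\<Sum>i\<in>G. \<Sum>j=1..m. (T i j)\<^sup>2)"
      unfolding L2_set_def by (subst sum.swap) (simp add: sum_nonneg)
    also have "\<dots> \<le> L2_set \<nu> G"
      unfolding L2_set_def
    proof (intro real_sqrt_le_mono sum_mono)
      fix i assume "i \<in> G"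
      then have c: "card (M i) \<le> 1" by (auto simp: G_def S_def)
      have "(\<Sum>j=1..m. (T i j)\<^sup>2) = (\<Sum>j\<in>M i. (T i j)\<^sup>2)"
        by (intro sum.mono_neutral_right) (auto simp: M_def)
      also have "\<dots> \<le> (\<Sum>j\<in>M i. (\<nu> i)\<^sup>2)" by (intro sum_mono power_mono T\<nu> T0)
      also have "\<dots> = card (M i) * (\<nu> i)\<^sup>2" by simp
      also have "\<dots> \<le> 1 * (\<nu> i)\<^sup>2" using c by (intro mult_right_mono) auto
      finally show "(\<Sum>j=1..m. (T i j)\<^sup>2) \<le> (\<nu> i)\<^sup>2" by simp
    qed
    finally show ?thesis by (simp add: mult_left_mono)
  qed
  have bad: "(\<Sum>j=1..m. \<Sum>i\<in>S. T i j) \<le> 2 * sqrt (2 * m) * L2_set \<nu> S"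
  proof -
    have "(\<Sum>j=1..m. \<Sum>i\<in>S. T i j) = (\<Sum>i\<in>S. \<Sum>j=1..m. T i j)" by (rule sum.swap)
    also have "\<dots> \<le> (\<Sum>i\<in>S. 2 * sqrt (card (M i)) * \<nu> i)"
    proof (rule sum_mono)
      fix i
      have "(\<Sum>j=1..m. T i j) = (\<Sum>j\<in>M i. T i j)"
        by (intro sum.mono_neutral_right) (auto simp: M_def)
      also have "\<dots> \<le> 2 * sqrt (card (M i)) * \<nu> i"
        unfolding T_def \<nu>_def
        by (intro sum_Ti_nrm_restr_le c00_restr x finM) (auto simp: M_def intro: Esucc)
      finally show "(\<Sum>j=1..m. T i j) \<le> 2 * sqrt (card (M i)) * \<nu> i" .
    qed
    also have "\<dots> = 2 * (\<Sum>i\<in>S. \<bar>sqrt (card (M i))\<bar> * \<bar>\<nu> i\<bar>)"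
      using \<nu>0 by (simp add: sum_distrib_left mult.assoc)
    also have "\<dots> \<le> 2 * (L2_set (\<lambda>i. sqrt (card (M i))) S * L2_set \<nu> S)"
      by (intro mult_left_mono L2_set_mult_ineq) simp
    also have "L2_set (\<lambda>i. sqrt (card (M i))) S = sqrt (real (\<Sum>i\<in>S. card (M i)))"
      by (simp add: L2_set_def)
    also have "\<dots> \<le> sqrt (real (2 * m))" using cards by (intro real_sqrt_le_mono) linarith
    finally show ?thesis by (simp add: mult_left_mono mult_right_mono)
  qed
  define A where "A = L2_set \<nu> G"
  define B where "B = L2_set \<nu> S"
  define C where "C = L2_set \<nu> I"
  have AB: "A\<^sup>2 + B\<^sup>2 = C\<^sup>2"
    unfolding A_def B_def C_def L2_set_def G_def
    using sum.subset_diff[OF SI(1) I, of "\<lambda>i. (\<nu> i)\<^sup>2"] by (simp add: sum_nonneg)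
  have C0: "0 \<le> C" by (simp add: C_def)
  have sm: "0 < sqrt m" using step.hyps(1) by simp
  have "pairing (\<lambda>j. 1 / (2 * sqrt (real m)) * (\<Sum>i=1..m. restr (E i) (g i) j)) x
      = 1 / (2 * sqrt m) * (\<Sum>j=1..m. pairing (g j) (restr (E j) x))"
    by (rule pairing_step[OF x])
  also have "\<dots> \<le> 1 / (2 * sqrt m) * (\<Sum>j=1..m. 2 * L2_set (\<lambda>i. T i j) G + (\<Sum>i\<in>S. T i j))"
    by (intro mult_left_mono sum_mono split) auto
  also have "\<dots> \<le> 1 / (2 * sqrt m) * (2 * (sqrt m * A) + 2 * sqrt (2 * m) * B)"
    unfolding sum.distrib sum_distrib_left[symmetric] A_def B_def
    by (intro mult_left_mono add_mono good bad) auto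
  also have "\<dots> = A + sqrt 2 * B" using sm by (simp add: field_simps real_sqrt_mult)
  also have "\<dots> \<le> 2 * C"
  proof (rule power2_le_imp_le)
    (* The Cauchy-Schwarz inequality for (A, B) and (1, sqrt 2), by completing the square. *)
    have "(A + sqrt 2 * B)\<^sup>2 \<le> (A + sqrt 2 * B)\<^sup>2 + (sqrt 2 * A - B)\<^sup>2" by simp
    also have "\<dots> = 3 * (A\<^sup>2 + B\<^sup>2)" by (simp add: power2_eq_square algebra_simps)
    also have "\<dots> = 3 * C\<^sup>2" by (simp only: AB)
    also have "\<dots> \<le> (2 * C)\<^sup>2" by (simp add: power_mult_distrib)
    finally show "(A + sqrt 2 * B)\<^sup>2 \<le> (2 * C)\<^sup>2" .
  qed (use C0 in simp)
  finally show ?case unfolding C_def \<nu>_def[abs_def] .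
qed

theorem Ti_nrm_upper_l2:
  assumes "x \<in> c00" "finite (I :: nat set)"
    and "\<And>i j a b. i \<in> I \<Longrightarrow> j \<in> I \<Longrightarrow> i < j \<Longrightarrow> a \<in> F i \<Longrightarrow> b \<in> F j \<Longrightarrow> a < b"
    and "\<And>l. x l \<noteq> 0 \<Longrightarrow> \<exists>i\<in>I. l \<in> F i"
  shows "Ti_nrm x \<le> 2 * L2_set (\<lambda>i. Ti_nrm (restr (F i) x)) I"
proof (rule Ti_nrm_le)
  fix f assume "f \<in> norming"
  then show "pairing f x \<le> 2 * L2_set (\<lambda>i. Ti_nrm (restr (F i) x)) I"
    using assms by (rule pairing_le_upper_l2)
qed

section \<open>The lower $\ell_2$ estimate for vectors with small coordinates\<close>

text \<open>
  Extend the last piece to the right until its norm exceeds \<open>t\<close>. Adding one coordinate changes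
  the norm by at most \<open>t\<close>, so the norm is then at most \<open>2 * t\<close> and a new piece is started.
\<close>

lemma greedy_cutting:
  assumes x: "x \<in> c00" and small: "\<And>l. \<bar>x l\<bar> \<le> t" and ab: "a \<le> b"
  shows "\<exists>k q. q 0 = a \<and> q (Suc k) = b \<and> (\<forall>r\<le>k. q r \<le> q (Suc r)) \<and>
    (\<forall>r<k. t \<le> Ti_nrm (restr {q r..<q (Suc r)} x)) \<and>
    (\<forall>r\<le>k. Ti_nrm (restr {q r..<q (Suc r)} x) \<le> 2 * t) \<and>
    Ti_nrm (restr {q k..<q (Suc k)} x) \<le> t"
  using ab
proof (induction b rule: dec_induct)
  have t: "0 \<le> t" using small[of 0] by linarith
  case base
  show ?case
    by (rule exI[of _ 0], rule exI[of _ "\<lambda>_. a"]) (use t in \<open>simp add: restr_def Ti_nrm_zero\<close>)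
next
  have t: "0 \<le> t" using small[of 0] by linarith
  case (step b)
  then obtain k q where q: "q 0 = a" "q (Suc k) = b" "\<And>r. r \<le> k \<Longrightarrow> q r \<le> q (Suc r)"
    "\<And>r. r < k \<Longrightarrow> t \<le> Ti_nrm (restr {q r..<q (Suc r)} x)"
    "\<And>r. r \<le> k \<Longrightarrow> Ti_nrm (restr {q r..<q (Suc r)} x) \<le> 2 * t"
    "Ti_nrm (restr {q k..<q (Suc k)} x) \<le> t"
    by blast
  have qk: "q k \<le> b" using q(2,3) by force
  define y where "y = restr {q k..<Suc b} x"
  define e where "e = restr {b} x"
  have e: "Ti_nrm e \<le> t"
  proof (rule Ti_nrm_le)
    fix f assume f: "f \<in> norming"
    have "pairing f e = (\<Sum>l\<in>{b}. f l * e l)"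
      by (rule pairing_eq) (auto simp: e_def restr_def)
    also have "\<dots> \<le> \<bar>f b\<bar> * \<bar>e b\<bar>" by (simp add: abs_mult[symmetric])
    also have "\<dots> \<le> 1 * \<bar>e b\<bar>" by (intro mult_right_mono norming_bound[OF f]) simp
    also have "\<dots> \<le> t" using small[of b] by (simp add: e_def restr_def)
    finally show "pairing f e \<le> t" .
  qed
  have "y l = restr {q k..<q (Suc k)} x l + e l" for l
    using qk q(2) by (auto simp: y_def e_def restr_def)
  then have "y = (\<lambda>l. restr {q k..<q (Suc k)} x l + e l)" by blast
  then have y: "Ti_nrm y \<le> 2 * t"
    using Ti_nrm_add_le[OF c00_restr[OF x, of "{q k..<q (Suc k)}"] c00_restr[OF x, of "{b}"]] e q(6)
    by (simp add: e_def)
  show ?case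
  proof (cases "Ti_nrm y \<le> t")
    case True
    show ?thesis
      by (rule exI[of _ k], rule exI[of _ "q(Suc k := Suc b)"])
        (use q qk y True in \<open>auto simp: y_def fun_upd_def\<close>)
  next
    case False
    show ?thesis
      by (rule exI[of _ "Suc k"], rule exI[of _ "q(Suc k := Suc b, Suc (Suc k) := Suc b)"])
        (use q qk y False t in \<open>auto simp: y_def fun_upd_def less_Suc_eq le_Suc_eq restr_def[of "{}"] Ti_nrm_zero\<close>)
  qed
qed

lemma cuts_mono: 
  assumes "\<And>r. r < k \<Longrightarrow> q r \<le> (q (Suc r) :: nat)" "i \<le> j" "j \<le> k"
  shows "q i \<le> q j"
  using assms(2,3,1)
proof (induction j rule: dec_induct)
  case (step n)
  then have "q i \<le> q n" "q n \<le> q (Suc n)" by simp_all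
  then show ?case by simp
qed simp

lemma cuts_cover:
  assumes "q 0 \<le> l" "l < (q k :: nat)"
  shows "\<exists>r<k. q r \<le> l \<and> l < q (Suc r)"
  using assms(2)
proof (induction k)
  case 0
  then show ?case using assms(1) by simp
next
  case (Suc k)
  then show ?case by (cases "l < q k") (auto intro: less_SucI)
qed

lemma Ti_nrm_upper_l2_cuts:
  assumes x: "x \<in> c00" and p: "\<And>i. i < n \<Longrightarrow> p i \<le> p (Suc i)"
  shows "Ti_nrm (restr {p 0..<p n} x) \<le> 2 * L2_set (\<lambda>i. Ti_nrm (restr {p i..<p (Suc i)} x)) {..<n}"
proof -
  have "Ti_nrm (restr {p 0..<p n} x)
      \<le> 2 * L2_set (\<lambda>i. Ti_nrm (restr {p i..<p (Suc i)} (restr {p 0..<p n} x))) {..<n}"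
  proof (rule Ti_nrm_upper_l2)
    fix i j a b assume *: "i \<in> {..<n}" "j \<in> {..<n}" "i < j" "a \<in> {p i..<p (Suc i)}" "b \<in> {p j..<p (Suc j)}"
    then have "p (Suc i) \<le> p j" by (intro cuts_mono[of n p, OF p]) auto
    then show "a < b" using * by simp
  next
    fix l assume "restr {p 0..<p n} x l \<noteq> 0"
    then show "\<exists>i\<in>{..<n}. l \<in> {p i..<p (Suc i)}"
      using cuts_cover[of p l n] by (auto simp: restr_def split: if_splits)
  qed (simp_all add: c00_restr x)
  also have "L2_set (\<lambda>i. Ti_nrm (restr {p i..<p (Suc i)} (restr {p 0..<p n} x))) {..<n}
      = L2_set (\<lambda>i. Ti_nrm (restr {p i..<p (Suc i)} x)) {..<n}"
  proof (rule L2_set_cong[OF refl])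
    fix i assume "i \<in> {..<n}"
    then have "p 0 \<le> p i" "p (Suc i) \<le> p n" by (auto intro!: cuts_mono[of n p, OF p])
    then have "{p i..<p (Suc i)} \<inter> {p 0..<p n} = {p i..<p (Suc i)}" by auto
    then show "Ti_nrm (restr {p i..<p (Suc i)} (restr {p 0..<p n} x)) = Ti_nrm (restr {p i..<p (Suc i)} x)"
      by (simp add: restr_restr)
  qed
  finally show ?thesis .
qed

text \<open>
  Cut each block greedily. If a block yields \<open>k\<close> pieces of norm at least \<open>t\<close>, then together with
  the remainder it consists of \<open>k + 1\<close> pieces of norm at most \<open>2 * t\<close>, and the upper estimate
  bounds the square of its norm by \<open>16 * t\<^sup>2 * (k + 1)\<close>. The functions \<open>l\<close> and \<open>u\<close> list the end
  points of the pieces of all blocks, from left to right.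
\<close>

lemma many_large_pieces:
  assumes x: "x \<in> c00" and small: "\<And>l. \<bar>x l\<bar> \<le> t" and p: "\<And>i. i < n \<Longrightarrow> p i \<le> p (Suc i)"
  shows "\<exists>K l u. (\<forall>r<K. u r \<le> p n \<and> t \<le> Ti_nrm (restr {l r..<u r} x)) \<and>
    (\<forall>s<K. \<forall>r<s. u r \<le> l s) \<and>
    (\<Sum>i<n. (Ti_nrm (restr {p i..<p (Suc i)} x))\<^sup>2) \<le> 16 * t\<^sup>2 * (K + n)"
  using p
proof (induction n)
  case 0
  then show ?case by (intro exI[of _ 0]) simp
next
  case (Suc n)
  have t: "0 \<le> t" using small[of 0] by linarith
  obtain K l u where IH: "\<And>r. r < K \<Longrightarrow> u r \<le> p n" "\<And>r. r < K \<Longrightarrow> t \<le> Ti_nrm (restr {l r..<u r} x)"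
    "\<And>r s. r < s \<Longrightarrow> s < K \<Longrightarrow> u r \<le> l s"
    "(\<Sum>i<n. (Ti_nrm (restr {p i..<p (Suc i)} x))\<^sup>2) \<le> 16 * t\<^sup>2 * (K + n)"
    using Suc.IH[OF Suc.prems[OF less_SucI]] by blast
  have pn: "p n \<le> p (Suc n)" using Suc.prems by simp
  obtain k q where q: "q 0 = p n" "q (Suc k) = p (Suc n)" "\<And>r. r \<le> k \<Longrightarrow> q r \<le> q (Suc r)"
    "\<And>r. r < k \<Longrightarrow> t \<le> Ti_nrm (restr {q r..<q (Suc r)} x)"
    "\<And>r. r \<le> k \<Longrightarrow> Ti_nrm (restr {q r..<q (Suc r)} x) \<le> 2 * t"
    using greedy_cutting[OF x small pn] by blast
  have qm: "q r \<le> q s" if "r \<le> s" "s \<le> Suc k" for r s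
    using cuts_mono[of "Suc k" q r s] q(3) that by auto
  have "Ti_nrm (restr {p n..<p (Suc n)} x) \<le> 2 * L2_set (\<lambda>r. Ti_nrm (restr {q r..<q (Suc r)} x)) {..<Suc k}"
    using Ti_nrm_upper_l2_cuts[OF x, of "Suc k" q] q(1-3) by simp
  also have "\<dots> \<le> 2 * L2_set (\<lambda>r. 2 * t) {..<Suc k}"
    using q(5) by (intro mult_left_mono L2_set_mono Ti_nrm_nonneg c00_restr x) auto
  finally have "(Ti_nrm (restr {p n..<p (Suc n)} x))\<^sup>2 \<le> (2 * L2_set (\<lambda>r. 2 * t) {..<Suc k})\<^sup>2"
    by (intro power_mono Ti_nrm_nonneg c00_restr x)
  also have "\<dots> = 16 * t\<^sup>2 * (k + 1)"
    by (simp add: L2_set_def power_mult_distrib)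
  finally have last: "(Ti_nrm (restr {p n..<p (Suc n)} x))\<^sup>2 \<le> 16 * t\<^sup>2 * (k + 1)" .
  define l' where "l' r = (if r < K then l r else q (r - K))" for r
  define u' where "u' r = (if r < K then u r else q (Suc (r - K)))" for r
  show ?case
  proof (rule exI[of _ "K + k"], rule exI[of _ l'], rule exI[of _ u'], intro conjI allI impI)
    fix r assume r: "r < K + k"
    show "u' r \<le> p (Suc n)" using IH(1)[of r] pn qm[of "Suc (r - K)" "Suc k"] q(2) r
      by (auto simp: u'_def)
    show "t \<le> Ti_nrm (restr {l' r..<u' r} x)" using IH(2)[of r] q(4)[of "r - K"] r
      by (auto simp: u'_def l'_def)
  next
    fix r s assume s: "s < K + k" "r < s"
    consider "s < K" | "r < K" "K \<le> s" | "K \<le> r" by linarith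
    then show "u' r \<le> l' s"
    proof cases
      case 2
      then have "s - K \<le> Suc k" using s by linarith
      then show ?thesis using 2 IH(1)[of r] q(1) qm[of 0 "s - K"] s by (auto simp: u'_def l'_def)
    next
      case 3
      then show ?thesis using qm[of "Suc (r - K)" "s - K"] s by (auto simp: u'_def l'_def)
    qed (use IH(3) s in \<open>auto simp: u'_def l'_def\<close>)
  next
    show "(\<Sum>i<Suc n. (Ti_nrm (restr {p i..<p (Suc i)} x))\<^sup>2) \<le> 16 * t\<^sup>2 * real (K + k + Suc n)"
      using IH(4) last by (simp add: algebra_simps)
  qed
qed

text \<open>
  Compare both sides with the number \<open>K\<close> of pieces: the implicit equation, applied to the
  pieces, gives \<open>t * sqrt K \<le> 2 * Ti_nrm x\<close>.
\<close>

theorem Ti_nrm_lower_l2_cuts: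
  assumes x: "x \<in> c00" and small: "\<And>l. \<bar>x l\<bar> \<le> t" and p: "\<And>i. i < n \<Longrightarrow> p i \<le> p (Suc i)"
  shows "L2_set (\<lambda>i. Ti_nrm (restr {p i..<p (Suc i)} x)) {..<n} \<le> 8 * Ti_nrm x + 4 * t * sqrt n"
proof -
  have t: "0 \<le> t" using small[of 0] by linarith
  obtain K l u where K: "\<And>r. r < K \<Longrightarrow> t \<le> Ti_nrm (restr {l r..<u r} x)"
    "\<And>r s. r < s \<Longrightarrow> s < K \<Longrightarrow> u r \<le> l s"
    "(\<Sum>i<n. (Ti_nrm (restr {p i..<p (Suc i)} x))\<^sup>2) \<le> 16 * t\<^sup>2 * (K + n)"
    using many_large_pieces[of x t n p, OF x small p] by blast
  have "K * t = (\<Sum>r<K. t)" by simp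
  also have "\<dots> \<le> (\<Sum>r<K. Ti_nrm (restr {l r..<u r} x))"
    using K(1) by (intro sum_mono) simp
  also have "\<dots> \<le> 2 * sqrt (card {..<K}) * Ti_nrm x"
  proof (rule sum_Ti_nrm_restr_le[OF x])
    fix i j a b assume "i \<in> {..<K}" "j \<in> {..<K}" "i < j" "a \<in> {l i..<u i}" "b \<in> {l j..<u j}"
    then show "a < b" using K(2)[of i j] by simp
  qed simp
  finally have "sqrt K * sqrt K * t \<le> 2 * sqrt K * Ti_nrm x" by simp
  then have *: "sqrt K * (sqrt K * t) \<le> sqrt K * (2 * Ti_nrm x)" by (simp only: mult_ac)
  have Kt: "sqrt K * t \<le> 2 * Ti_nrm x"
  proof (cases "K = 0")
    case False
    then have "0 < sqrt K" by simp
    then show ?thesis using * by (simp only: mult_le_cancel_left_pos)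
  qed (simp add: Ti_nrm_nonneg x)
  have "L2_set (\<lambda>i. Ti_nrm (restr {p i..<p (Suc i)} x)) {..<n} \<le> sqrt (16 * t\<^sup>2 * (K + n))"
    unfolding L2_set_def using K(3) by (rule real_sqrt_le_mono)
  also have "\<dots> = 4 * t * sqrt (K + n)"
  proof -
    have "16 * t\<^sup>2 * real (K + n) = (4 * t)\<^sup>2 * real (K + n)" by (simp add: power_mult_distrib)
    then show ?thesis using t by (simp add: real_sqrt_mult)
  qed
  also have "\<dots> \<le> 4 * t * (sqrt K + sqrt n)"
    using t sqrt_add_le_add_sqrt[of K n] by (intro mult_left_mono) auto
  also have "\<dots> \<le> 8 * Ti_nrm x + 4 * t * sqrt n" using Kt by (simp add: algebra_simps)
  finally show ?thesis .
qed

section \<open>Coordinates and projections in the completion\<close>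

lemma c00_restr_finite: "finite E \<Longrightarrow> restr E s \<in> c00"
  unfolding c00_def restr_def by (auto elim: finite_subset[rotated])

lemma c00_diff: "x \<in> c00 \<Longrightarrow> y \<in> c00 \<Longrightarrow> (\<lambda>i. x i - y i) \<in> c00"
  using c00_add[of x "\<lambda>i. - 1 * y i"] c00_scale[of y "- 1"] by simp

text \<open>
  The supremum over the norming functionals is itself a solution of the implicit equation; with
  uniqueness this makes norming functionals available for the norm of any completion.
\<close>

lemma is_Ti_norm_Ti_nrm: "is_Ti_norm Ti_nrm"
  unfolding is_Ti_norm_def
proof (intro conjI is_norm_on_c00_Ti_nrm ballI antisym)
  fix x assume x: "x \<in> c00"
  show bdd: "bdd_above (Ti_sums Ti_nrm x)"
    by (rule bdd_aboveI[OF Ti_sums_Ti_nrm_le[OF x]])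
  show "max (SUP i. \<bar>x i\<bar>) (Sup (Ti_sums Ti_nrm x)) \<le> Ti_nrm x"
    by (intro max.boundedI cSUP_least cSup_least Ti_sums_nonempty)
      (auto intro: abs_le_Ti_nrm[OF x] Ti_sums_Ti_nrm_le[OF x])
  show "Ti_nrm x \<le> max (SUP i. \<bar>x i\<bar>) (Sup (Ti_sums Ti_nrm x))"
  proof (rule Ti_nrm_le)
    fix f assume "f \<in> norming"
    then show "pairing f x \<le> max (SUP i. \<bar>x i\<bar>) (Sup (Ti_sums Ti_nrm x))"
    proof cases
      case (unit s j)
      have "pairing f x \<le> \<bar>s * x j\<bar>" by (simp add: unit(1) pairing_unit[OF x])
      also have "\<dots> = \<bar>x j\<bar>" using unit(2) by (simp add: abs_mult)
      also have "\<dots> \<le> (SUP i. \<bar>x i\<bar>)"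
        by (rule cSUP_upper[OF UNIV_I bdd_above_range_c00[OF x]])
      finally show ?thesis by simp
    next
      case (step n E g)
      have "pairing f x \<le> 1 / (2 * sqrt (real n)) * (\<Sum>i=1..n. Ti_nrm (restr (E i) x))"
        unfolding step(1) pairing_step[OF x]
        using step(4) by (intro mult_left_mono sum_mono pairing_le_Ti_nrm) auto
      also have "\<dots> \<le> Sup (Ti_sums Ti_nrm x)"
        by (rule cSup_upper[OF Ti_sumsI[OF step(2,3)] bdd])
      finally show ?thesis by simp
    qed
  qed
qed

lemma Ti_nrm_restr_le_l1:
  assumes E: "finite E"
  shows "Ti_nrm (restr E f) \<le> (\<Sum>l\<in>E. \<bar>f l\<bar>)"
proof -
  have "Ti_nrm (restr E f) \<le> (\<Sum>l | restr E f l \<noteq> 0. \<bar>restr E f l\<bar>)"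
    by (rule Ti_nrm_le[OF pairing_le_l1])
  also have "\<dots> \<le> (\<Sum>l\<in>E. \<bar>restr E f l\<bar>)"
    by (rule sum_mono2) (use E in \<open>auto simp: restr_def split: if_splits\<close>)
  also have "\<dots> = (\<Sum>l\<in>E. \<bar>f l\<bar>)" by (simp add: restr_def)
  finally show ?thesis .
qed

locale Ti_completion =
  fixes J :: "(nat \<Rightarrow> real) \<Rightarrow> 'y::banach"
  assumes completion: "is_Ti_completion J"
begin

lemma norm_J: "x \<in> c00 \<Longrightarrow> norm (J x) = Ti_nrm x"
proof -
  assume x: "x \<in> c00"
  obtain N where N: "is_Ti_norm N" "\<forall>x\<in>c00. norm (J x) = N x"
    using completion by (auto simp: is_Ti_completion_def)
  show ?thesis using N is_Ti_norm_unique[OF N(1) is_Ti_norm_Ti_nrm x] x by simp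
qed

lemma J_scale: "x \<in> c00 \<Longrightarrow> J (\<lambda>i. c * x i) = c *\<^sub>R J x"
  using completion by (auto simp: is_Ti_completion_def)

lemma J_add: "x \<in> c00 \<Longrightarrow> y \<in> c00 \<Longrightarrow> J (\<lambda>i. x i + y i) = J x + J y"
  using completion by (auto simp: is_Ti_completion_def)

lemma J_zero: "J (\<lambda>i. 0) = 0"
  using J_scale[OF c00_zero, of 0] by simp

lemma J_diff: "x \<in> c00 \<Longrightarrow> y \<in> c00 \<Longrightarrow> J (\<lambda>i. x i - y i) = J x - J y"
  using J_add[of x "\<lambda>i. - 1 * y i"] c00_scale[of y "- 1"] J_scale[of y "- 1"] by simp

lemma J_sum: "(\<And>i. i \<in> S \<Longrightarrow> h i \<in> c00) \<Longrightarrow> J (\<lambda>l. \<Sum>i\<in>S. h i l) = (\<Sum>i\<in>S. J (h i))"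
proof (induction S rule: infinite_finite_induct)
  case (insert i S)
  then have "J (\<lambda>l. h i l + (\<Sum>i\<in>S. h i l)) = J (h i) + J (\<lambda>l. \<Sum>i\<in>S. h i l)"
    by (intro J_add c00_sum) auto
  then show ?case using insert by simp
qed (auto simp: J_zero)

lemma abs_diff_le_norm_J:
  assumes "x \<in> c00" "y \<in> c00"
  shows "\<bar>x i - y i\<bar> \<le> norm (J x - J y)"
  using abs_le_Ti_nrm[OF c00_diff[OF assms], of i] norm_J[OF c00_diff[OF assms]] J_diff[OF assms]
  by simp

text \<open>
  An element of the completion is reached only as a limit of images of finitely supported
  vectors; its coordinates are the limits of theirs.
\<close>

definition approx :: "'y \<Rightarrow> nat \<Rightarrow> nat \<Rightarrow> real" where
  "approx y = (SOME s. (\<forall>n. s n \<in> c00) \<and> (\<lambda>n. J (s n)) \<longlonglongrightarrow> y)"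

lemma approx: "approx y n \<in> c00" "(\<lambda>n. J (approx y n)) \<longlonglongrightarrow> y"
proof -
  have "y \<in> closure (J ` c00)" using completion by (simp add: is_Ti_completion_def)
  then obtain u where u: "\<forall>n. u n \<in> J ` c00" "u \<longlonglongrightarrow> y" unfolding closure_sequential by blast
  then obtain s where s: "\<And>n. s n \<in> c00" "\<And>n. u n = J (s n)" unfolding image_iff by metis
  then have "u = (\<lambda>n. J (s n))" by blast
  then have "\<exists>s. (\<forall>n. s n \<in> c00) \<and> (\<lambda>n. J (s n)) \<longlonglongrightarrow> y"
    using s u by blast
  from someI_ex[OF this, folded approx_def]
  show "approx y n \<in> c00" "(\<lambda>n. J (approx y n)) \<longlonglongrightarrow> y" by auto
qed

definition coord :: "'y \<Rightarrow> nat \<Rightarrow> real" where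
  "coord y i = lim (\<lambda>n. approx y n i)"

lemma tendsto_coord:
  assumes s: "\<And>n. s n \<in> c00" and lim: "(\<lambda>n. J (s n)) \<longlonglongrightarrow> y"
  shows "(\<lambda>n. s n i) \<longlonglongrightarrow> coord y i"
proof -
  have "Cauchy (\<lambda>n. approx y n i)"
  proof (rule metric_CauchyI)
    fix e :: real assume "0 < e"
    then obtain M where M: "\<And>m n. m \<ge> M \<Longrightarrow> n \<ge> M \<Longrightarrow> dist (J (approx y m)) (J (approx y n)) < e"
      using metric_CauchyD[OF LIMSEQ_imp_Cauchy[OF approx(2)]] by meson
    have "dist (approx y m i) (approx y n i) < e" if "m \<ge> M" "n \<ge> M" for m n
      using M[OF that] abs_diff_le_norm_J[OF approx(1) approx(1), of y m i y n]
      by (simp add: dist_norm)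
    then show "\<exists>M. \<forall>m\<ge>M. \<forall>n\<ge>M. dist (approx y m i) (approx y n i) < e" by blast
  qed
  then have 1: "(\<lambda>n. approx y n i) \<longlonglongrightarrow> coord y i"
    unfolding coord_def by (simp add: Cauchy_convergent_iff convergent_LIMSEQ_iff)
  have "(\<lambda>n. J (s n) - J (approx y n)) \<longlonglongrightarrow> 0"
    using tendsto_diff[OF lim approx(2)[of y]] by simp
  then have "(\<lambda>n. s n i - approx y n i) \<longlonglongrightarrow> 0"
    by (rule Lim_null_comparison[OF always_eventually tendsto_norm_zero, rotated])
      (use abs_diff_le_norm_J[OF s approx(1)] in simp)
  from tendsto_add[OF this 1] show ?thesis by simp
qed

lemma coord_J: "x \<in> c00 \<Longrightarrow> coord (J x) = x"
  using tendsto_coord[of "\<lambda>_. x" "J x"] by (auto simp: LIMSEQ_const_iff)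

lemma abs_coord_le: "\<bar>coord x i\<bar> \<le> norm x"
proof (rule LIMSEQ_le)
  show "(\<lambda>n. \<bar>approx x n i\<bar>) \<longlonglongrightarrow> \<bar>coord x i\<bar>"
    by (intro tendsto_rabs tendsto_coord approx)
  show "(\<lambda>n. norm (J (approx x n))) \<longlonglongrightarrow> norm x"
    by (intro tendsto_norm approx)
  show "\<exists>N. \<forall>n\<ge>N. \<bar>approx x n i\<bar> \<le> norm (J (approx x n))"
    by (simp add: norm_J approx(1) abs_le_Ti_nrm)
qed

lemma bounded_linear_coord: "bounded_linear (\<lambda>y. coord y i)"
proof (rule bounded_linear_intro[where K = 1])
  fix x y
  show "coord (x + y) i = coord x i + coord y i"
  proof (rule LIMSEQ_unique[OF tendsto_coord])
    show "(\<lambda>n. J (\<lambda>l. approx x n l + approx y n l)) \<longlonglongrightarrow> x + y"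
      using tendsto_add[OF approx(2)[of x] approx(2)[of y]] by (simp add: J_add approx(1))
    show "(\<lambda>n. approx x n i + approx y n i) \<longlonglongrightarrow> coord x i + coord y i"
      by (intro tendsto_add tendsto_coord approx)
  qed (intro c00_add approx)
next
  fix c x
  have "coord (c *\<^sub>R x) i = c * coord x i"
  proof (rule LIMSEQ_unique[OF tendsto_coord])
    show "(\<lambda>n. J (\<lambda>l. c * approx x n l)) \<longlonglongrightarrow> c *\<^sub>R x"
      using tendsto_scaleR[OF tendsto_const[of c] approx(2)[of x]] by (simp add: J_scale approx(1))
    show "(\<lambda>n. c * approx x n i) \<longlonglongrightarrow> c * coord x i"
      by (intro tendsto_mult tendsto_const tendsto_coord approx)
  qed (intro c00_scale approx)
  then show "coord (c *\<^sub>R x) i = c *\<^sub>R coord x i" by simp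
next
  fix x
  show "norm (coord x i) \<le> norm x * 1" using abs_coord_le[of x i] by simp
qed

lemmas coord_add = bounded_linear.linear[OF bounded_linear_coord, THEN linear_add]
lemmas coord_diff = bounded_linear.linear[OF bounded_linear_coord, THEN linear_diff]
lemmas coord_sum = bounded_linear.linear[OF bounded_linear_coord, THEN linear_sum]
lemmas coord_scale = bounded_linear.linear[OF bounded_linear_coord, THEN linear_cmul, simplified]

text \<open>
  The extension of \<open>restr E\<close> to the completion. It is only used for finite \<open>E\<close>, where the
  restricted coordinate sequence lies in \<open>c00\<close>.
\<close>

definition proj :: "nat set \<Rightarrow> 'y \<Rightarrow> 'y" where
  "proj E y = J (restr E (coord y))"

lemma coord_proj: "finite E \<Longrightarrow> coord (proj E y) = restr E (coord y)"
  unfolding proj_def by (rule coord_J[OF c00_restr_finite])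

lemma proj_J: "x \<in> c00 \<Longrightarrow> proj E (J x) = J (restr E x)"
  by (simp add: proj_def coord_J)

lemma proj_proj: "finite F \<Longrightarrow> proj E (proj F y) = proj (E \<inter> F) y"
  unfolding proj_def[of E] proj_def[of "E \<inter> F"] by (simp add: coord_proj restr_restr)

lemma proj_empty: "proj {} y = 0"
  by (simp add: proj_def restr_def J_zero)

lemma proj_eqI: "finite E \<Longrightarrow> (\<And>l. l \<in> E \<Longrightarrow> coord x l = coord y l) \<Longrightarrow> proj E x = proj E y"
  unfolding proj_def by (intro arg_cong[of _ _ J]) (auto simp: restr_def)

lemma linear_proj: "finite E \<Longrightarrow> linear (proj E)"
proof (rule linearI)
  assume E: "finite E"
  fix x y c
  have "restr E (coord (x + y)) = (\<lambda>l. restr E (coord x) l + restr E (coord y) l)"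
    by (auto simp: restr_def coord_add)
  then show "proj E (x + y) = proj E x + proj E y"
    by (simp add: proj_def J_add c00_restr_finite[OF E])
  have "restr E (coord (c *\<^sub>R x)) = (\<lambda>l. c * restr E (coord x) l)"
    by (auto simp: restr_def coord_scale)
  then show "proj E (c *\<^sub>R x) = c *\<^sub>R proj E x"
    by (simp add: proj_def J_scale c00_restr_finite[OF E])
qed

lemma norm_proj_le:
  assumes E: "finite E"
  shows "norm (proj E y) \<le> norm y"
proof -
  have "(\<lambda>n. J (restr E (approx y n)) - proj E y) \<longlonglongrightarrow> 0"
  proof (rule Lim_null_comparison[OF always_eventually, rule_format])
    have "(\<lambda>n. \<Sum>l\<in>E. \<bar>approx y n l - coord y l\<bar>) \<longlonglongrightarrow> (\<Sum>l\<in>E. \<bar>coord y l - coord y l\<bar>)"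
      by (intro tendsto_sum tendsto_rabs tendsto_diff tendsto_const tendsto_coord approx)
    then show "(\<lambda>n. \<Sum>l\<in>E. \<bar>approx y n l - coord y l\<bar>) \<longlonglongrightarrow> 0" by simp
    fix n
    have "(\<lambda>l. restr E (approx y n) l - restr E (coord y) l)
        = restr E (\<lambda>l. approx y n l - coord y l)"
      by (auto simp: restr_def)
    then have "norm (J (restr E (approx y n)) - proj E y) = Ti_nrm (restr E (\<lambda>l. approx y n l - coord y l))"
      unfolding proj_def by (simp add: J_diff[symmetric] norm_J c00_restr_finite[OF E])
    also have "\<dots> \<le> (\<Sum>l\<in>E. \<bar>approx y n l - coord y l\<bar>)" by (rule Ti_nrm_restr_le_l1[OF E])
    finally show "norm (J (restr E (approx y n)) - proj E y) \<le> (\<Sum>l\<in>E. \<bar>approx y n l - coord y l\<bar>)" .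
  qed
  then have "(\<lambda>n. J (restr E (approx y n))) \<longlonglongrightarrow> proj E y"
    by (simp add: LIM_zero_iff)
  from tendsto_norm[OF this] show ?thesis
  proof (rule LIMSEQ_le)
    show "(\<lambda>n. norm (J (approx y n))) \<longlonglongrightarrow> norm y"
      by (intro tendsto_norm approx)
    show "\<exists>N. \<forall>n\<ge>N. norm (J (restr E (approx y n))) \<le> norm (J (approx y n))"
      by (simp add: norm_J c00_restr approx(1) Ti_nrm_restr_le)
  qed
qed

abbreviation Q :: "nat \<Rightarrow> 'y \<Rightarrow> 'y" where "Q k \<equiv> proj {..<k}"

text \<open>
  On the dense image of \<open>c00\<close> the sequence is eventually constant, and the \<open>Q k\<close> are uniformly
  bounded.
\<close>

lemma Q_tendsto: "(\<lambda>k. Q k y) \<longlonglongrightarrow> y"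
proof (rule LIMSEQ_I)
  fix e :: real assume "0 < e"
  then obtain n where n: "norm (J (approx y n) - y) < e / 2"
    using LIMSEQ_D[OF approx(2)[of y], of "e / 2"] by auto
  define x where "x = approx y n"
  have x: "x \<in> c00" by (simp add: x_def approx)
  then obtain K where K: "\<And>l. x l \<noteq> 0 \<Longrightarrow> l < K"
    by (auto simp: c00_def finite_nat_set_iff_bounded)
  have "norm (Q k y - y) < e" if "k \<ge> K" for k
  proof -
    have "restr {..<k} x = x" using K that by (force simp: restr_def)
    then have "Q k y - y = Q k (y - J x) + (J x - y)"
      using x by (simp add: linear_diff[OF linear_proj] proj_J)
    also have "norm \<dots> \<le> norm (y - J x) + norm (J x - y)"
      by (intro norm_triangle_le add_right_mono norm_proj_le) simp
    also have "\<dots> < e" using n by (simp add: x_def norm_minus_commute)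
    finally show ?thesis .
  qed
  then show "\<exists>K. \<forall>k\<ge>K. norm (Q k y - y) < e" by blast
qed

lemma proj_atLeastLessThan: "a \<le> b \<Longrightarrow> proj {a..<b} y = Q b y - Q a y"
proof -
  assume "a \<le> b"
  then have "restr {a..<b} (coord y) = (\<lambda>l. restr {..<b} (coord y) l - restr {..<a} (coord y) l)"
    by (auto simp: restr_def)
  then show ?thesis by (simp add: proj_def J_diff c00_restr_finite)
qed

lemma norm_diff_Q_le: "norm (y - Q k y) \<le> norm y"
proof (rule LIMSEQ_le_const2)
  show "(\<lambda>n. norm (Q n y - Q k y)) \<longlonglongrightarrow> norm (y - Q k y)"
    by (intro tendsto_intros Q_tendsto)
  show "\<exists>N. \<forall>n\<ge>N. norm (Q n y - Q k y) \<le> norm y"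
    by (rule exI[of _ k]) (simp add: proj_atLeastLessThan[symmetric] norm_proj_le)
qed

lemma coord_tail_le: "k \<le> l \<Longrightarrow> \<bar>coord y l\<bar> \<le> norm (y - Q k y)"
  using abs_coord_le[of "y - Q k y" l] by (simp add: coord_diff coord_proj restr_def)

definition block_sequence :: "(nat \<Rightarrow> nat) \<Rightarrow> nat \<Rightarrow> (nat \<Rightarrow> 'y) \<Rightarrow> bool" where
  "block_sequence p n v \<longleftrightarrow> (\<forall>i<n. p i \<le> p (Suc i) \<and> proj {p i..<p (Suc i)} (v i) = v i)"

text \<open>
  Reduces statements on blocks to statements on the restrictions of one vector of \<open>c00\<close>.
\<close>

lemma block_sequence_sum:
  assumes v: "block_sequence p n v"
  shows "\<exists>x. x \<in> c00 \<and> (\<Sum>i<n. v i) = J x \<and> restr {p 0..<p n} x = x \<and>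
    (\<forall>i<n. restr {p i..<p (Suc i)} x = coord (v i)) \<and>
    (\<forall>i<n. Ti_nrm (restr {p i..<p (Suc i)} x) = norm (v i))"
proof -
  have p: "p i \<le> p (Suc i)" if "i < n" for i using v that by (simp add: block_sequence_def)
  have vi: "coord (v i) = restr {p i..<p (Suc i)} (coord (v i))" if "i < n" for i
    using v that coord_proj[of "{p i..<p (Suc i)}" "v i"] by (simp add: block_sequence_def)
  have cv: "coord (v i) \<in> c00" if "i < n" for i
    by (subst vi[OF that]) (simp add: c00_restr_finite)
  have Jv: "J (coord (v i)) = v i" if "i < n" for i
  proof -
    have "J (restr {p i..<p (Suc i)} (coord (v i))) = v i"
      using v that by (simp add: block_sequence_def proj_def)
    then show ?thesis by (simp only: vi[OF that, symmetric])
  qed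
  define x where "x = (\<lambda>l. \<Sum>i<n. coord (v i) l)"
  have x: "x \<in> c00" unfolding x_def by (rule c00_sum) (simp add: cv)
  have zero: "coord (v i) l = 0" if "i < n" "l \<notin> {p i..<p (Suc i)}" for i l
    using fun_cong[OF vi[OF that(1)], of l] that(2) by (simp only: restr_def if_False)
  have disj: "l \<notin> {p k..<p (Suc k)}" if "i < n" "k < n" "k \<noteq> i" "l \<in> {p i..<p (Suc i)}" for i k l
  proof -
    have "p (Suc i) \<le> p k \<or> p (Suc k) \<le> p i"
      using that cuts_mono[of n p "Suc i" k] cuts_mono[of n p "Suc k" i] p by force
    then show ?thesis using that(4) by auto
  qed
  have rx: "restr {p i..<p (Suc i)} x = coord (v i)" if i: "i < n" for i
  proof
    fix l
    show "restr {p i..<p (Suc i)} x l = coord (v i) l"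
    proof (cases "l \<in> {p i..<p (Suc i)}")
      case True
      have "x l = (\<Sum>k\<in>{i}. coord (v k) l)"
        unfolding x_def using i disj[OF i _ _ True] zero by (intro sum.mono_neutral_right) auto
      then show ?thesis using True by (simp add: restr_def)
    next
      case False
      then show ?thesis using zero[OF i False] by (simp only: restr_def if_False)
    qed
  qed
  show ?thesis
  proof (intro exI[of _ x] conjI allI impI rx x)
    show "(\<Sum>i<n. v i) = J x" unfolding x_def by (subst J_sum) (auto simp: cv Jv)
    have "x l = 0" if l: "l \<notin> {p 0..<p n}" for l
      unfolding x_def
    proof (intro sum.neutral ballI)
      fix i assume "i \<in> {..<n}"
      then have "p 0 \<le> p i" "p (Suc i) \<le> p n" "i < n" by (auto intro!: cuts_mono[of n p, OF p])
      then show "coord (v i) l = 0" using l by (intro zero) auto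
    qed
    then show "restr {p 0..<p n} x = x" by (auto simp: restr_def fun_eq_iff)
    show "Ti_nrm (restr {p i..<p (Suc i)} x) = norm (v i)" if "i < n" for i
      using norm_J[OF cv[OF that]] by (simp add: rx[OF that] Jv[OF that])
  qed
qed

lemma block_upper_l2:
  assumes v: "block_sequence p n v"
  shows "norm (\<Sum>i<n. v i) \<le> 2 * L2_set (\<lambda>i. norm (v i)) {..<n}"
proof -
  obtain x where x: "x \<in> c00" "(\<Sum>i<n. v i) = J x" "restr {p 0..<p n} x = x"
    "\<forall>i<n. restr {p i..<p (Suc i)} x = coord (v i)"
    "\<forall>i<n. Ti_nrm (restr {p i..<p (Suc i)} x) = norm (v i)"
    using block_sequence_sum[OF v] by (elim exE conjE)
  have "Ti_nrm (restr {p 0..<p n} x) \<le> 2 * L2_set (\<lambda>i. Ti_nrm (restr {p i..<p (Suc i)} x)) {..<n}"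
    using v by (intro Ti_nrm_upper_l2_cuts x) (simp add: block_sequence_def)
  then show ?thesis by (simp add: x(1-3,5) norm_J cong: L2_set_cong_simp)
qed

lemma block_coord_le:
  assumes v: "block_sequence p n v" and small: "\<And>i l. i < n \<Longrightarrow> \<bar>coord (v i) l\<bar> \<le> t" and t: "0 \<le> t"
  shows "\<bar>coord (\<Sum>i<n. v i) l\<bar> \<le> t"
proof -
  obtain x where x: "x \<in> c00" "(\<Sum>i<n. v i) = J x" "restr {p 0..<p n} x = x"
    "\<forall>i<n. restr {p i..<p (Suc i)} x = coord (v i)"
    "\<forall>i<n. Ti_nrm (restr {p i..<p (Suc i)} x) = norm (v i)"
    using block_sequence_sum[OF v] by (elim exE conjE)
  have "\<bar>x l\<bar> \<le> t"
  proof (cases "l \<in> {p 0..<p n}")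
    case True
    then obtain i where i: "i < n" "p i \<le> l" "l < p (Suc i)" using cuts_cover[of p l n] by auto
    then have "x l = coord (v i) l"
      using fun_cong[OF x(4)[rule_format, OF i(1)], of l] by (simp add: restr_def)
    then show ?thesis using small[OF i(1)] by simp
  next
    case False
    then have "x l = 0" using fun_cong[OF x(3), of l] by (auto simp: restr_def)
    then show ?thesis using t by simp
  qed
  then show ?thesis by (simp add: x(2) coord_J[OF x(1)])
qed

lemma block_lower_l2:
  assumes v: "block_sequence p n v" and small: "\<And>i l. i < n \<Longrightarrow> \<bar>coord (v i) l\<bar> \<le> t" and t: "0 \<le> t"
  shows "L2_set (\<lambda>i. norm (v i)) {..<n} \<le> 8 * norm (\<Sum>i<n. v i) + 4 * t * sqrt n"
proof -
  obtain x where x: "x \<in> c00" "(\<Sum>i<n. v i) = J x" "restr {p 0..<p n} x = x"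
    "\<forall>i<n. restr {p i..<p (Suc i)} x = coord (v i)"
    "\<forall>i<n. Ti_nrm (restr {p i..<p (Suc i)} x) = norm (v i)"
    using block_sequence_sum[OF v] by (elim exE conjE)
  have "\<bar>x l\<bar> \<le> t" for l
    using block_coord_le[OF v small t, of l] by (simp add: x(2) coord_J[OF x(1)])
  from Ti_nrm_lower_l2_cuts[OF x(1) this, of n p] v
  have "L2_set (\<lambda>i. Ti_nrm (restr {p i..<p (Suc i)} x)) {..<n} \<le> 8 * Ti_nrm x + 4 * t * sqrt n"
    by (simp add: block_sequence_def)
  then show ?thesis by (simp add: x(1-3,5) norm_J cong: L2_set_cong_simp)
qed

lemma block_sum_norm_le:
  assumes v: "block_sequence p n v"
  shows "(\<Sum>i<n. norm (v i)) \<le> 2 * sqrt n * norm (\<Sum>i<n. v i)"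
proof -
  obtain x where x: "x \<in> c00" "(\<Sum>i<n. v i) = J x" "restr {p 0..<p n} x = x"
    "\<forall>i<n. restr {p i..<p (Suc i)} x = coord (v i)"
    "\<forall>i<n. Ti_nrm (restr {p i..<p (Suc i)} x) = norm (v i)"
    using block_sequence_sum[OF v] by (elim exE conjE)
  have p: "p i \<le> p (Suc i)" if "i < n" for i using v that by (simp add: block_sequence_def)
  have "(\<Sum>i\<in>{..<n}. Ti_nrm (restr {p i..<p (Suc i)} x)) \<le> 2 * sqrt (card {..<n}) * Ti_nrm x"
  proof (rule sum_Ti_nrm_restr_le[where E = "\<lambda>i. {p i..<p (Suc i)}", OF x(1)])
    fix i j a b assume *: "i \<in> {..<n}" "j \<in> {..<n}" "i < j" "a \<in> {p i..<p (Suc i)}" "b \<in> {p j..<p (Suc j)}"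
    then have "p (Suc i) \<le> p j" by (intro cuts_mono[of n p, OF p]) auto
    then show "a < b" using * by simp
  qed simp
  then show ?thesis by (simp add: x(1-3,5) norm_J)
qed

text \<open>
  If the initial segments of \<open>s\<close> were not Cauchy, there would be infinitely many successive
  intervals on which \<open>s\<close> has norm at least \<open>e\<close>. By the implicit equation \<open>N\<close> of them give norm
  at least \<open>e * sqrt N / 2\<close>, which is unbounded.
\<close>

lemma boundedly_complete:
  assumes bound: "\<And>k. Ti_nrm (restr {..<k} s) \<le> B"
  obtains y where "coord y = s"
proof -
  define D where "D k = J (restr {..<k} s)" for k
  have diff: "norm (D n - D m) = Ti_nrm (restr {m..<n} s)" if "m \<le> n" for m n
  proof -
    have "restr {m..<n} s = (\<lambda>l. restr {..<n} s l - restr {..<m} s l)"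
      using that by (auto simp: restr_def)
    then have "D n - D m = J (restr {m..<n} s)" by (simp add: D_def J_diff c00_restr_finite)
    then show ?thesis by (simp add: norm_J c00_restr_finite)
  qed
  have "Cauchy D"
  proof (rule ccontr)
    assume "\<not> Cauchy D"
    then obtain e where e: "0 < e" "\<And>M. \<exists>m\<ge>M. \<exists>n\<ge>M. e \<le> norm (D m - D n)"
      unfolding Cauchy_iff by (meson not_less)
    have "\<exists>m n. M \<le> m \<and> m \<le> n \<and> e \<le> Ti_nrm (restr {m..<n} s)" for M
    proof -
      obtain m n where mn: "M \<le> m" "M \<le> n" "e \<le> norm (D m - D n)" using e(2) by blast
      show ?thesis
      proof (cases "m \<le> n")
        case True
        then show ?thesis using mn diff[OF True] by (auto simp: norm_minus_commute)
      next
        case False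
        then show ?thesis using mn diff[of n m] by - (rule exI[of _ n], rule exI[of _ m], simp)
      qed
    qed
    then obtain f g where fg: "\<And>M. M \<le> f M" "\<And>M. f M \<le> g M"
      "\<And>M. e \<le> Ti_nrm (restr {f M..<g M} s)" by metis
    (* Iterating g yields successive intervals {f (c r)..<g (c r)}. *)
  define c where "c = rec_nat 0 (\<lambda>_. g)"
    have c: "c (Suc r) = g (c r)" for r by (simp add: c_def)
    have cm: "mono c"
      using order.trans[OF fg(1,2)] by (intro incseq_SucI) (simp add: c)
    have B: "N * e \<le> 2 * sqrt N * B" for N :: nat
    proof -
      have "N * e = (\<Sum>r<N. e)" by simp
      also have "\<dots> \<le> (\<Sum>r<N. Ti_nrm (restr {f (c r)..<g (c r)} (restr {..<c N} s)))"
      proof (rule sum_mono)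
        fix r assume "r \<in> {..<N}"
        then have "g (c r) \<le> c N" using monoD[OF cm, of "Suc r" N] by (simp add: c)
        then have "{f (c r)..<g (c r)} \<inter> {..<c N} = {f (c r)..<g (c r)}" by auto
        then show "e \<le> Ti_nrm (restr {f (c r)..<g (c r)} (restr {..<c N} s))"
          using fg(3) by (simp add: restr_restr)
      qed
      also have "\<dots> \<le> 2 * sqrt (card {..<N}) * Ti_nrm (restr {..<c N} s)"
      proof (rule sum_Ti_nrm_restr_le[OF c00_restr_finite])
        fix i j a b assume *: "i < j" "a \<in> {f (c i)..<g (c i)}" "b \<in> {f (c j)..<g (c j)}"
        have "g (c i) \<le> c j" using monoD[OF cm, of "Suc i" j] *(1) by (simp add: c)
        also have "\<dots> \<le> f (c j)" by (rule fg)
        finally show "a < b" using * by simp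
      qed simp_all
      also have "\<dots> \<le> 2 * sqrt N * B" using bound by (simp add: mult_left_mono)
      finally show ?thesis .
    qed
    obtain N :: nat where N: "(2 * B / e)\<^sup>2 < N" using reals_Archimedean2 by blast
    have "0 < real N" using zero_le_power2 N by (rule order.strict_trans1)
    then have N0: "0 < sqrt N" by simp
    have "sqrt N * (sqrt N * e) = N * e" by (simp add: mult.assoc[symmetric])
    also have "\<dots> \<le> sqrt N * (2 * B)" using B[of N] by (simp add: mult_ac)
    finally have "sqrt N * e \<le> 2 * B" using N0 by (simp only: mult_le_cancel_left_pos)
    then have "sqrt N \<le> 2 * B / e" using e(1) by (simp add: pos_le_divide_eq)
    then have "(sqrt N)\<^sup>2 \<le> (2 * B / e)\<^sup>2" by (intro power_mono) auto
    then show False using N by simp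
  qed
  then obtain y where y: "D \<longlonglongrightarrow> y" by (auto simp: Cauchy_convergent_iff convergent_def)
  have "coord y i = s i" for i
  proof (rule LIMSEQ_unique)
    show "(\<lambda>k. restr {..<k} s i) \<longlonglongrightarrow> coord y i"
      using y by (intro tendsto_coord) (simp_all add: c00_restr_finite D_def[abs_def])
    show "(\<lambda>k. restr {..<k} s i) \<longlonglongrightarrow> s i"
      by (rule tendsto_eventually)
        (use eventually_gt_at_top[of i] in eventually_elim, simp add: restr_def)
  qed
  then show thesis using that by blast
qed

end

section \<open>Bases of closed spans\<close>

lemma sum_half_powers_le: "(\<Sum>j\<in>{s..<e}. (1/2::real) ^ j) \<le> 2 * (1/2) ^ s"
proof (cases "s \<le> e")
  case True
  then have "(\<Sum>j\<in>{s..<e}. (1/2::real) ^ j) = 2 * (1/2) ^ s - 2 * (1/2) ^ e"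
    by (induction e rule: dec_induct) simp_all
  then show ?thesis by simp
qed simp

lemma in_span_range_sum:
  fixes z :: "nat \<Rightarrow> 'a::real_vector"
  assumes "x \<in> span (range z)"
  shows "\<exists>a. \<forall>\<^sub>F n in sequentially. x = (\<Sum>j<n. a j *\<^sub>R z j)"
proof -
  define S where "S = {x. \<exists>a. \<forall>\<^sub>F n in sequentially. x = (\<Sum>j<n. a j *\<^sub>R z j)}"
  have "subspace S"
  proof (rule subspaceI)
    show "0 \<in> S" unfolding S_def by (auto intro!: exI[of _ "\<lambda>_. 0"])
  next
    fix x y assume "x \<in> S" "y \<in> S"
    then obtain a b where ab: "\<forall>\<^sub>F n in sequentially. x = (\<Sum>j<n. a j *\<^sub>R z j)"
      "\<forall>\<^sub>F n in sequentially. y = (\<Sum>j<n. b j *\<^sub>R z j)" unfolding S_def by blast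
    have "\<forall>\<^sub>F n in sequentially. x + y = (\<Sum>j<n. (a j + b j) *\<^sub>R z j)"
      using ab by eventually_elim (simp add: scaleR_add_left sum.distrib)
    then show "x + y \<in> S" unfolding S_def mem_Collect_eq by (rule exI[of _ "\<lambda>j. a j + b j"])
  next
    fix c x assume "x \<in> S"
    then obtain a where a: "\<forall>\<^sub>F n in sequentially. x = (\<Sum>j<n. a j *\<^sub>R z j)" unfolding S_def by blast
    have "\<forall>\<^sub>F n in sequentially. c *\<^sub>R x = (\<Sum>j<n. (c * a j) *\<^sub>R z j)"
      using a by eventually_elim (simp add: scaleR_sum_right)
    then show "c *\<^sub>R x \<in> S" unfolding S_def mem_Collect_eq by (rule exI[of _ "\<lambda>j. c * a j"])
  qed
  moreover have "z i \<in> S" for i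
  proof -
    have "\<forall>\<^sub>F n in sequentially. z i = (\<Sum>j<n. (if j = i then 1 else 0) *\<^sub>R z j)"
      using eventually_gt_at_top[of i]
    proof eventually_elim
      case (elim n)
      have "(\<Sum>j<n. (if j = i then 1 else 0) *\<^sub>R z j) = (\<Sum>j\<in>{i}. (if j = i then 1 else 0) *\<^sub>R z j)"
        using elim by (intro sum.mono_neutral_right) auto
      then show ?case by simp
    qed
    then show ?thesis
      unfolding S_def mem_Collect_eq by (rule exI[of _ "\<lambda>j. if j = i then 1 else 0"])
  qed
  ultimately have "span (range z) \<subseteq> S" by (intro span_minimal) auto
  then show ?thesis using assms unfolding S_def by blast
qed

lemma subspace_closure:
  fixes S :: "'a::real_normed_vector set"
  assumes S: "subspace S"
  shows "subspace (closure S)"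
proof (rule subspaceI)
  show "0 \<in> closure S" by (rule subsetD[OF closure_subset subspace_0[OF S]])
next
  fix x y assume "x \<in> closure S" "y \<in> closure S"
  then obtain f g where fg: "\<forall>n. f n \<in> S" "f \<longlonglongrightarrow> x" "\<forall>n. g n \<in> S" "g \<longlonglongrightarrow> y"
    unfolding closure_sequential by blast
  show "x + y \<in> closure S"
    unfolding closure_sequential
    by (rule exI[of _ "\<lambda>n. f n + g n"]) (use fg in \<open>simp add: subspace_add[OF S] tendsto_add\<close>)
next
  fix c x assume "x \<in> closure S"
  then obtain f where f: "\<forall>n. f n \<in> S" "f \<longlonglongrightarrow> x" unfolding closure_sequential by blast
  show "c *\<^sub>R x \<in> closure S"
    unfolding closure_sequential
    by (rule exI[of _ "\<lambda>n. c *\<^sub>R f n"]) (use f in \<open>simp add: subspace_scale[OF S] tendsto_scaleR\<close>)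
qed

text \<open>
  Grunblum's criterion: uniformly bounded partial sum operators make a sequence a basis of its
  closed span.
\<close>

context
  fixes z :: "nat \<Rightarrow> 'a::real_normed_vector" and K :: real
  assumes nonzero: "\<And>j. z j \<noteq> 0"
    and basis_const: "\<And>a m n. m \<le> n \<Longrightarrow> norm (\<Sum>j<m. a j *\<^sub>R z j) \<le> K * norm (\<Sum>j<n. a j *\<^sub>R z j)"
begin

lemma basic_unique:
  assumes "(\<lambda>j. a j *\<^sub>R z j) sums 0"
  shows "a j = 0"
proof -
  have "norm (\<Sum>i<m. a i *\<^sub>R z i) \<le> 0" for m
  proof (rule LIMSEQ_le_const)
    have "(\<lambda>n. K * norm (\<Sum>i<n. a i *\<^sub>R z i)) \<longlonglongrightarrow> K * norm (0::'a)"
      using assms unfolding sums_def by (intro tendsto_mult tendsto_const tendsto_norm)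
    then show "(\<lambda>n. K * norm (\<Sum>i<n. a i *\<^sub>R z i)) \<longlonglongrightarrow> 0" by simp
    show "\<exists>N. \<forall>n\<ge>N. norm (\<Sum>i<m. a i *\<^sub>R z i) \<le> K * norm (\<Sum>i<n. a i *\<^sub>R z i)"
      using basis_const by blast
  qed
  from this[of j] this[of "Suc j"] show ?thesis using nonzero[of j] by (simp add: mult_le_0_iff)
qed

lemma basic_infinite_dim: "infinite_dim_subspace (closure (span (range z)))"
  unfolding infinite_dim_subspace_def
proof (intro conjI notI)
  show "subspace (closure (span (range z)))" by (rule subspace_closure[OF subspace_span])
  have inj: "inj z"
  proof (rule injI)
    fix i k assume eq: "z i = z k"
    show "i = k"
    proof (rule ccontr)
      assume ne: "i \<noteq> k"
      define a :: "nat \<Rightarrow> real" where "a j = (if j = i then 1 else if j = k then - 1 else 0)" for j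
      have "(\<lambda>j. a j *\<^sub>R z j) sums (\<Sum>j\<in>{i, k}. a j *\<^sub>R z j)"
        by (rule sums_finite) (auto simp: a_def)
      then have "(\<lambda>j. a j *\<^sub>R z j) sums 0" using ne eq by (simp add: a_def)
      from basic_unique[OF this, of i] show False by (simp add: a_def)
    qed
  qed
  have indep: "independent (range z)"
    unfolding independent_explicit_module
  proof (intro allI impI)
    fix t u v assume t: "finite t" "t \<subseteq> range z" "(\<Sum>v\<in>t. u v *\<^sub>R v) = 0" "v \<in> t"
    define a where "a j = (if z j \<in> t then u (z j) else 0)" for j
    define T where "T = z -` t"
    have T: "finite T" unfolding T_def by (rule finite_vimageI[OF t(1) inj])
    have "(\<lambda>j. a j *\<^sub>R z j) sums (\<Sum>j\<in>T. a j *\<^sub>R z j)"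
      by (rule sums_finite[OF T]) (auto simp: a_def T_def)
    also have "(\<Sum>j\<in>T. a j *\<^sub>R z j) = (\<Sum>v\<in>z ` T. u v *\<^sub>R v)"
      by (subst sum.reindex[OF inj_on_subset[OF inj]]) (auto simp: a_def T_def)
    also have "z ` T = t" using t(2) by (auto simp: T_def)
    finally have "(\<lambda>j. a j *\<^sub>R z j) sums 0" using t(3) by simp
    moreover obtain j where "v = z j" using t(2,4) by blast
    ultimately show "u v = 0" using basic_unique[of a j] t(4) by (simp add: a_def)
  qed
  assume "\<exists>B. finite B \<and> span B = closure (span (range z))"
  then obtain B where B: "finite B" "span B = closure (span (range z))" by blast
  have "range z \<subseteq> span B"
    unfolding B(2) by (rule order.trans[OF span_superset closure_subset])
  from independent_span_bound[OF B(1) indep this] show False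
    using range_inj_infinite[OF inj] by blast
qed simp

lemma basic_basis_of: "basis_of z (closure (span (range z)))"
  unfolding basis_of_def
proof (intro conjI allI ballI)
  show "z i \<in> closure (span (range z))" for i
    by (intro subsetD[OF closure_subset] span_base rangeI)
next
  fix x assume "x \<in> closure (span (range z))"
  then obtain X where X: "\<And>n. X n \<in> span (range z)" "X \<longlonglongrightarrow> x" unfolding closure_sequential by blast
  obtain a where a: "\<And>n. \<forall>\<^sub>F m in sequentially. X n = (\<Sum>j<m. a n j *\<^sub>R z j)"
    using in_span_range_sum[OF X(1)] by metis
  (* Partial sums of the expansions of X n, and hence the coefficients, are Cauchy in n. *)
  have partial: "norm (\<Sum>j<m. (a k j - a n j) *\<^sub>R z j) \<le> K * norm (X k - X n)" for m k n
  proof -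
    have "\<forall>\<^sub>F N in sequentially. norm (\<Sum>j<m. (a k j - a n j) *\<^sub>R z j) \<le> K * norm (X k - X n)"
      using a[of k] a[of n] eventually_ge_at_top[of m]
    proof eventually_elim
      case (elim N)
      have "X k - X n = (\<Sum>j<N. (a k j - a n j) *\<^sub>R z j)"
        by (subst elim(1), subst elim(2)) (simp add: scaleR_diff_left sum_subtractf)
      then show ?case using basis_const[OF elim(3), of "\<lambda>j. a k j - a n j"] by simp
    qed
    then show ?thesis by simp
  qed
  have "K \<ge> 0" using basis_const[of 1 1 "\<lambda>_. 1"] nonzero[of 0] by (simp add: mult_le_cancel_right1 order.trans[OF zero_le_one])
  have "convergent (\<lambda>n. a n j)" for j
    unfolding Cauchy_convergent_iff[symmetric]
  proof (rule metric_CauchyI)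
    fix e :: real assume e: "0 < e"
    define e' where "e' = e * norm (z j) / (2 * K + 1)"
    have "0 < e'" using e nonzero[of j] \<open>K \<ge> 0\<close> by (simp add: e'_def)
    then obtain M where M: "\<And>m n. m \<ge> M \<Longrightarrow> n \<ge> M \<Longrightarrow> dist (X m) (X n) < e'"
      using metric_CauchyD[OF LIMSEQ_imp_Cauchy[OF X(2)]] by meson
    have "dist (a m j) (a n j) < e" if "m \<ge> M" "n \<ge> M" for m n
    proof -
      have "(a m j - a n j) *\<^sub>R z j
          = (\<Sum>i<Suc j. (a m i - a n i) *\<^sub>R z i) - (\<Sum>i<j. (a m i - a n i) *\<^sub>R z i)" by simp
      then have "\<bar>a m j - a n j\<bar> * norm (z j)
          \<le> norm (\<Sum>i<Suc j. (a m i - a n i) *\<^sub>R z i) + norm (\<Sum>i<j. (a m i - a n i) *\<^sub>R z i)"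
        by (simp only: norm_scaleR[symmetric] norm_triangle_ineq4)
      also have "\<dots> \<le> K * norm (X m - X n) + K * norm (X m - X n)" by (intro add_mono partial)
      also have "\<dots> = 2 * K * norm (X m - X n)" by simp
      also have "\<dots> \<le> 2 * K * e'"
        using M[OF that] \<open>K \<ge> 0\<close> by (intro mult_left_mono) (auto simp: dist_norm)
      also have "\<dots> < (2 * K + 1) * e'" using \<open>0 < e'\<close> by simp
      also have "\<dots> = e * norm (z j)" using \<open>K \<ge> 0\<close> by (simp add: e'_def)
      finally show ?thesis using nonzero[of j] by (simp add: dist_real_def)
    qed
    then show "\<exists>M. \<forall>m\<ge>M. \<forall>n\<ge>M. dist (a m j) (a n j) < e" by blast
  qed
  then obtain A where A: "\<And>j. (\<lambda>n. a n j) \<longlonglongrightarrow> A j" unfolding convergent_def by metis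
  have partial': "norm ((\<Sum>j<m. A j *\<^sub>R z j) - (\<Sum>j<m. a n j *\<^sub>R z j)) \<le> K * norm (x - X n)" for m n
  proof (rule LIMSEQ_le)
    show "(\<lambda>k. norm (\<Sum>j<m. (a k j - a n j) *\<^sub>R z j))
        \<longlonglongrightarrow> norm ((\<Sum>j<m. A j *\<^sub>R z j) - (\<Sum>j<m. a n j *\<^sub>R z j))"
      unfolding sum_subtractf[symmetric] scaleR_diff_left[symmetric]
      by (intro tendsto_intros A)
    show "(\<lambda>k. K * norm (X k - X n)) \<longlonglongrightarrow> K * norm (x - X n)"
      by (intro tendsto_intros X)
  qed (use partial in blast)
  have "(\<lambda>j. A j *\<^sub>R z j) sums x"
    unfolding sums_def
  proof (rule LIMSEQ_I)
    fix e :: real assume e: "0 < e"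
    have "0 < e / (K + 1)" using e \<open>K \<ge> 0\<close> by simp
    then obtain n where n: "norm (X n - x) < e / (K + 1)" using LIMSEQ_D[OF X(2)] by blast
    have "\<forall>\<^sub>F m in sequentially. norm ((\<Sum>j<m. A j *\<^sub>R z j) - x) < e"
      using a[of n]
    proof eventually_elim
      case (elim m)
      have "(\<Sum>j<m. A j *\<^sub>R z j) - x = ((\<Sum>j<m. A j *\<^sub>R z j) - (\<Sum>j<m. a n j *\<^sub>R z j)) + (X n - x)"
        using elim by simp
      also have "norm \<dots> \<le> K * norm (x - X n) + norm (X n - x)"
        by (rule norm_triangle_le[OF add_right_mono[OF partial']])
      also have "\<dots> = (K + 1) * norm (X n - x)" by (simp add: norm_minus_commute algebra_simps)
      also have "\<dots> < (K + 1) * (e / (K + 1))"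
        using n \<open>K \<ge> 0\<close> by (intro mult_strict_left_mono) auto
      also have "\<dots> = e" using \<open>K \<ge> 0\<close> by simp
      finally show ?case .
    qed
    then show "\<exists>no. \<forall>n\<ge>no. norm ((\<Sum>j<n. A j *\<^sub>R z j) - x) < e"
      by (simp add: eventually_sequentially)
  qed
  show "\<exists>!a. (\<lambda>i. a i *\<^sub>R z i) sums x"
  proof (rule ex1I)
    show "(\<lambda>j. A j *\<^sub>R z j) sums x" by fact
    fix b assume "(\<lambda>i. b i *\<^sub>R z i) sums x"
    from sums_diff[OF this \<open>(\<lambda>j. A j *\<^sub>R z j) sums x\<close>]
    have "(\<lambda>j. (b j - A j) *\<^sub>R z j) sums 0" by (simp add: scaleR_diff_left)
    from basic_unique[OF this] show "b = A" by auto
  qed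
qed

end

context Ti_completion begin

section \<open>Almost successive sequences\<close>

lemma Q_zero_mono: "Q k z = 0 \<Longrightarrow> m \<le> k \<Longrightarrow> Q m z = 0"
  using proj_proj[of "{..<k}" "{..<m}" z] linear_0[OF linear_proj[of "{..<m}"]]
  by (simp add: Int_absorb2 lessThan_subset_iff[THEN iffD2])

lemma norm_diff_Q_mono: "k \<le> m \<Longrightarrow> norm (z - Q m z) \<le> norm (z - Q k z)"
proof -
  assume "k \<le> m"
  then have "Q m (Q k z) = Q k z" by (subst proj_proj) (auto simp: Int_absorb1)
  then have "z - Q m z = (z - Q k z) - Q m (z - Q k z)" by (simp add: linear_diff[OF linear_proj])
  then show ?thesis by (metis norm_diff_Q_le)
qed

text \<open>
  Otherwise \<open>Q k\<close>, whose range is spanned by \<open>k\<close> vectors, would be injective on \<open>X\<close>.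
\<close>

lemma exists_in_kernel:
  assumes X: "infinite_dim_subspace X"
  shows "\<exists>w\<in>X. norm w = 1 \<and> Q k w = 0"
proof -
  have sX: "subspace X" using X by (simp add: infinite_dim_subspace_def)
  define u where "u i = J (\<lambda>l. if l = i then 1 else 0)" for i
  have Q_span: "Q k y \<in> span (u ` {..<k})" for y
  proof -
    have c: "(\<lambda>l. if l = i then 1 else 0) \<in> c00" for i :: nat by (simp add: c00_def)
    have "restr {..<k} (coord y) = (\<lambda>l. \<Sum>i<k. coord y i * (if l = i then 1 else 0))"
      by (auto simp: restr_def if_distrib[of "(*) _"] cong: if_cong)
    then have "Q k y = (\<Sum>i<k. coord y i *\<^sub>R u i)"
      by (simp only: proj_def J_sum c00_scale c J_scale u_def)
    also have "\<dots> \<in> span (u ` {..<k})" by (intro span_sum span_scale span_base imageI)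
    finally show ?thesis .
  qed
  have "\<exists>w\<in>X. w \<noteq> 0 \<and> Q k w = 0"
  proof (rule ccontr)
    assume "\<not> ?thesis"
    then have ker: "w = 0" if "w \<in> X" "Q k w = 0" for w using that by blast
    obtain B where B: "B \<subseteq> X" "independent B" "X \<subseteq> span B" "card B = dim X"
      by (rule basis_exists[of X])
    have spB: "span B = X" using B sX by (simp add: span_minimal subset_antisym)
    have inj: "inj_on (Q k) (span B)"
      using linear_injective_on_subspace_0[OF linear_proj[OF finite_lessThan] sX] ker spB by simp
    have "finite (Q k ` B)"
      using independent_span_bound[of "u ` {..<k}" "Q k ` B"]
        linear_independent_injective_image[OF linear_proj[of "{..<k}"] B(2) inj] Q_span by auto
    then have "finite B" using inj_on_subset[OF inj span_superset] by (simp add: finite_image_iff)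
    then show False using spB X by (auto simp: infinite_dim_subspace_def)
  qed
  then obtain w where w: "w \<in> X" "w \<noteq> 0" "Q k w = 0" by blast
  then show ?thesis
    by (intro bexI[of _ "w /\<^sub>R norm w"]) (simp_all add: linear_cmul[OF linear_proj] subspace_scale[OF sX])
qed

text \<open>
  The error allowed for the \<open>j\<close>-th vector of a sequence. The sum of all errors is \<open>1 / 100\<close>; the
  factor \<open>1 / 200\<close> is small enough for all perturbation arguments below, and the geometric decay
  beats \<open>sqrt n\<close>.
\<close>

definition \<delta> :: "nat \<Rightarrow> real" where "\<delta> j = (1/2) ^ j / 200"

lemma delta_pos: "0 < \<delta> j" by (simp add: \<delta>_def)

lemma delta_le: "i \<le> j \<Longrightarrow> \<delta> j \<le> \<delta> i"
  by (simp add: \<delta>_def power_decreasing)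

lemma sum_delta_le: "(\<Sum>j\<in>{s..<e}. \<delta> j) \<le> 2 * \<delta> s"
  using sum_half_powers_le[of s e] by (simp add: \<delta>_def sum_divide_distrib[symmetric])

text \<open>
  The vectors of a subspace cannot be expected to have finite support. On the left, support
  conditions can be met exactly, since they hold on a subspace of finite codimension; on the
  right only a small tail can be achieved.
\<close>

definition almost_block :: "(nat \<Rightarrow> nat) \<Rightarrow> (nat \<Rightarrow> 'y) \<Rightarrow> bool" where
  "almost_block \<kappa> z \<longleftrightarrow> (\<forall>j. \<kappa> j \<le> \<kappa> (Suc j) \<and> norm (z j) = 1 \<and> Q (\<kappa> j) (z j) = 0 \<and>
     norm (z j - Q (\<kappa> (Suc j)) (z j)) \<le> \<delta> j)"

text \<open>
  The property \<open>G\<close> depends on the position in the sequence, so that the vectors can be required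
  to be flatter and flatter.
\<close>

lemma exists_almost_block:
  assumes "\<And>k j. \<exists>z\<in>X. norm z = 1 \<and> Q k z = 0 \<and> G j z"
  obtains \<kappa> z where "almost_block \<kappa> z" "\<And>j. z j \<in> X" "\<And>j. G j (z j)"
proof -
  have "\<exists>z k'. z \<in> X \<and> norm z = 1 \<and> Q k z = 0 \<and> G j z \<and> k \<le> k' \<and> norm (z - Q k' z) \<le> \<delta> j" for k j
  proof -
    obtain z where z: "z \<in> X" "norm z = 1" "Q k z = 0" "G j z" using assms by blast
    obtain N where N: "\<And>n. n \<ge> N \<Longrightarrow> norm (Q n z - z) < \<delta> j"
      using LIMSEQ_D[OF Q_tendsto delta_pos] by blast
    have "norm (z - Q (max k N) z) \<le> \<delta> j"
      using N[of "max k N"] by (simp add: norm_minus_commute less_imp_le)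
    then show ?thesis using z by (intro exI[of _ z] exI[of _ "max k N"]) simp
  qed
  then obtain f g where fg: "\<And>k j. f k j \<in> X" "\<And>k j. norm (f k j) = 1" "\<And>k j. Q k (f k j) = 0"
    "\<And>k j. G j (f k j)" "\<And>k j. k \<le> g k j" "\<And>k j. norm (f k j - Q (g k j) (f k j)) \<le> \<delta> j" by metis
  define \<kappa> where "\<kappa> = rec_nat 0 (\<lambda>j k. g k j)"
  have \<kappa>: "\<kappa> (Suc j) = g (\<kappa> j) j" for j by (simp add: \<kappa>_def)
  show thesis
    by (rule that[of \<kappa> "\<lambda>j. f (\<kappa> j) j"]) (auto simp: almost_block_def \<kappa> fg)
qed

context
  fixes \<kappa> z
  assumes ab: "almost_block \<kappa> z"
begin

lemma almost_block_cuts_mono: "i \<le> j \<Longrightarrow> \<kappa> i \<le> \<kappa> j"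
  by (erule lift_Suc_mono_le[of \<kappa>, rotated]) (use ab in \<open>simp add: almost_block_def\<close>)

lemma almost_block_norm: "norm (z j) = 1" using ab by (simp add: almost_block_def)

lemma almost_block_Q_zero: "m \<le> \<kappa> j \<Longrightarrow> Q m (z j) = 0"
  using ab Q_zero_mono[of "\<kappa> j" "z j" m] by (simp add: almost_block_def)

lemma almost_block_tail: "j < m \<Longrightarrow> norm (z j - Q (\<kappa> m) (z j)) \<le> \<delta> j"
  using ab norm_diff_Q_mono[OF almost_block_cuts_mono[of "Suc j" m], of "z j"]
  by (auto simp: almost_block_def intro: order.trans)

text \<open>
  For a coefficient \<open>a k\<close> of largest absolute value, the projection onto the \<open>k\<close>-th interval
  nearly fixes \<open>a k *\<^sub>R z k\<close> and nearly kills every other summand; the total error is a small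
  multiple of \<open>\<bar>a k\<bar>\<close>.
\<close>

lemma almost_block_coeff_le:
  assumes i: "i \<in> {s..<e}"
  shows "\<bar>a i\<bar> \<le> 2 * norm (\<Sum>j\<in>{s..<e}. a j *\<^sub>R z j)"
proof -
  define x where "x = (\<Sum>j\<in>{s..<e}. a j *\<^sub>R z j)"
  define M where "M = Max ((\<lambda>j. \<bar>a j\<bar>) ` {s..<e})"
  have fin: "finite ((\<lambda>j. \<bar>a j\<bar>) ` {s..<e})" by simp
  have le: "\<bar>a j\<bar> \<le> M" if "j \<in> {s..<e}" for j unfolding M_def using that by (intro Max_ge) auto
  obtain k where k: "k \<in> {s..<e}" "M = \<bar>a k\<bar>"
    using Max_in[OF fin] i unfolding M_def by fastforce
  (* The projection onto I isolates the k-th summand up to the errors \<delta>. *)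
  define I where "I = {\<kappa> k..<\<kappa> (Suc k)}"
  have pI: "proj I y = Q (\<kappa> (Suc k)) y - Q (\<kappa> k) y" for y
    unfolding I_def by (rule proj_atLeastLessThan[OF almost_block_cuts_mono]) simp
  have near: "norm (proj I (z j) - (if j = k then z j else 0)) \<le> \<delta> j" for j
  proof -
    consider "j < k" | "j = k" | "k < j" by linarith
    then show ?thesis
    proof cases
      case 1
      have "proj I (Q (\<kappa> k) (z j)) = 0"
        by (subst proj_proj) (auto simp: I_def ivl_disj_int_one proj_empty Int_commute)
      then have "proj I (z j) = proj I (z j - Q (\<kappa> k) (z j))"
        by (simp add: linear_diff[OF linear_proj] I_def)
      then have "norm (proj I (z j)) \<le> norm (z j - Q (\<kappa> k) (z j))"
        using norm_proj_le[of I] by (simp add: I_def)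
      then show ?thesis using 1 almost_block_tail[of j k] by simp
    next
      case 2
      then show ?thesis
        using almost_block_tail[of k "Suc k"] almost_block_Q_zero[of "\<kappa> k" k] by (simp add: pI norm_minus_commute)
    next
      case 3
      then have "\<kappa> (Suc k) \<le> \<kappa> j" "\<kappa> k \<le> \<kappa> j" by (intro almost_block_cuts_mono; simp)+
      then show ?thesis using 3 delta_pos[of j] by (simp add: pI almost_block_Q_zero)
    qed
  qed
  have "proj I x - a k *\<^sub>R z k = (\<Sum>j\<in>{s..<e}. a j *\<^sub>R (proj I (z j) - (if j = k then z j else 0)))"
    using k(1)
    by (simp add: x_def linear_sum[OF linear_proj] linear_cmul[OF linear_proj] I_def
        scaleR_diff_right sum_subtractf if_distrib[of "scaleR _"] cong: if_cong)
  then have "norm (proj I x - a k *\<^sub>R z k)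
      \<le> (\<Sum>j\<in>{s..<e}. norm (a j *\<^sub>R (proj I (z j) - (if j = k then z j else 0))))"
    by (simp only: norm_sum)
  also have "\<dots> \<le> (\<Sum>j\<in>{s..<e}. M * \<delta> j)"
    unfolding norm_scaleR by (intro sum_mono mult_mono le near) (use k in auto)
  also have "\<dots> \<le> M * (2 * \<delta> s)"
    unfolding sum_distrib_left[symmetric] using k by (intro mult_left_mono sum_delta_le) auto
  also have "\<dots> \<le> M * (1 / 2)"
    using delta_le[of 0 s] k by (intro mult_left_mono) (auto simp: \<delta>_def)
  finally have "norm (proj I x - a k *\<^sub>R z k) \<le> M / 2" by simp
  moreover have "norm (a k *\<^sub>R z k) \<le> norm (proj I x) + norm (proj I x - a k *\<^sub>R z k)"
    by (metis norm_triangle_sub norm_minus_commute)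
  ultimately have "M \<le> 2 * norm (proj I x)" using k(2) by (simp add: almost_block_norm)
  also have "\<dots> \<le> 2 * norm x" by (simp add: norm_proj_le I_def)
  finally show ?thesis using le[OF i] by (simp add: x_def)
qed

lemma almost_block_tail_le:
  assumes "e \<le> m"
  shows "norm ((\<Sum>j\<in>{s..<e}. a j *\<^sub>R z j) - Q (\<kappa> m) (\<Sum>j\<in>{s..<e}. a j *\<^sub>R z j))
    \<le> 4 * \<delta> s * norm (\<Sum>j\<in>{s..<e}. a j *\<^sub>R z j)"
proof -
  define x where "x = (\<Sum>j\<in>{s..<e}. a j *\<^sub>R z j)"
  have "x - Q (\<kappa> m) x = (\<Sum>j\<in>{s..<e}. a j *\<^sub>R (z j - Q (\<kappa> m) (z j)))"
    by (simp add: x_def linear_sum[OF linear_proj] linear_cmul[OF linear_proj]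
        scaleR_diff_right sum_subtractf)
  then have "norm (x - Q (\<kappa> m) x) \<le> (\<Sum>j\<in>{s..<e}. norm (a j *\<^sub>R (z j - Q (\<kappa> m) (z j))))"
    by (simp only: norm_sum)
  also have "\<dots> \<le> (\<Sum>j\<in>{s..<e}. 2 * norm x * \<delta> j)"
    unfolding norm_scaleR x_def
    by (intro sum_mono mult_mono almost_block_coeff_le almost_block_tail) (use assms in auto)
  also have "\<dots> \<le> 2 * norm x * (2 * \<delta> s)"
    unfolding sum_distrib_left[symmetric] by (intro mult_left_mono sum_delta_le) auto
  finally show ?thesis by (simp add: x_def mult_ac)
qed

text \<open>
  The projection \<open>Q (\<kappa> m)\<close> kills the summands from \<open>m\<close> on and almost fixes the earlier ones.
\<close>

lemma almost_block_basis_const: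
  assumes "m \<le> n"
  shows "norm (\<Sum>j<m. a j *\<^sub>R z j) \<le> 2 * norm (\<Sum>j<n. a j *\<^sub>R z j)"
proof -
  define S where "S n = (\<Sum>j\<in>{0..<n}. a j *\<^sub>R z j)" for n
  have "S n = S m + (\<Sum>j\<in>{m..<n}. a j *\<^sub>R z j)"
    unfolding S_def using assms by (simp add: sum.atLeastLessThan_concat)
  moreover have "Q (\<kappa> m) (\<Sum>j\<in>{m..<n}. a j *\<^sub>R z j) = 0"
    by (simp add: linear_sum[OF linear_proj] linear_cmul[OF linear_proj] almost_block_Q_zero almost_block_cuts_mono)
  ultimately have "Q (\<kappa> m) (S m) = Q (\<kappa> m) (S n)" by (simp add: linear_add[OF linear_proj])
  then have "norm (Q (\<kappa> m) (S m)) \<le> norm (S n)" by (simp add: norm_proj_le)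
  moreover have "norm (S m - Q (\<kappa> m) (S m)) \<le> 4 * \<delta> 0 * norm (S m)"
    unfolding S_def by (rule almost_block_tail_le) simp
  then have "norm (S m - Q (\<kappa> m) (S m)) \<le> norm (S m) / 50" by (simp add: \<delta>_def)
  moreover have "norm (S m) \<le> norm (Q (\<kappa> m) (S m)) + norm (S m - Q (\<kappa> m) (S m))"
    by (rule norm_triangle_sub)
  ultimately have "norm (S m) \<le> 2 * norm (S n)" using norm_ge_zero[of "S m"] by linarith
  then show ?thesis by (simp add: S_def atLeast0LessThan)
qed

end

text \<open>
  Take \<open>N\<close> almost successive unit vectors. Their sum has norm of order \<open>sqrt N\<close> and coordinates
  at most \<open>2\<close>.
\<close>

lemma exists_small_coord:
  assumes X: "infinite_dim_subspace X" and \<epsilon>: "0 < \<epsilon>"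
  shows "\<exists>z\<in>X. norm z = 1 \<and> Q k z = 0 \<and> (\<forall>l. \<bar>coord z l\<bar> \<le> \<epsilon>)"
proof -
  have sX: "subspace X" using X by (simp add: infinite_dim_subspace_def)
  have "\<exists>w\<in>X. norm w = 1 \<and> Q k' w = 0 \<and> Q k w = 0" for k'
    using exists_in_kernel[OF X, of "max k k'"] Q_zero_mono[of "max k k'"] by fastforce
  then obtain \<kappa> w where ab: "almost_block \<kappa> w" and w: "\<And>j. w j \<in> X" "\<And>j. Q k (w j) = 0"
    using exists_almost_block[where X = X and G = "\<lambda>_ w. Q k w = 0"] by metis
  define c where "c = 2 / \<epsilon>"
  have c: "0 < c" using \<epsilon> by (simp add: c_def)
  (* The sum W of N vectors has norm at least sqrt N / 4 - 1, which has to exceed 2 / \<epsilon>. *)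
  obtain N :: nat where N: "(4 * (1 + c))\<^sup>2 < N" using reals_Archimedean2 by blast
  have sN: "4 * (1 + c) \<le> sqrt N"
    by (rule real_le_rsqrt) (use N in simp)
  define v where "v j = Q (\<kappa> (Suc j)) (w j)" for j
  define W where "W = (\<Sum>j<N. w j)"
  define V where "V = (\<Sum>j<N. v j)"
  have wv: "norm (w j - v j) \<le> \<delta> j" for j unfolding v_def by (rule almost_block_tail[OF ab]) simp
  have "proj {\<kappa> j..<\<kappa> (Suc j)} (v j) = v j" for j
  proof -
    have "proj {\<kappa> j..<\<kappa> (Suc j)} (v j) = proj {\<kappa> j..<\<kappa> (Suc j)} (w j)"
      unfolding v_def by (rule proj_eqI) (auto simp: coord_proj restr_def)
    also have "\<dots> = v j"
      using almost_block_cuts_mono[OF ab, of j "Suc j"] almost_block_Q_zero[OF ab, of "\<kappa> j" j]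
      by (simp add: proj_atLeastLessThan v_def)
    finally show ?thesis .
  qed
  then have blk: "block_sequence \<kappa> N v"
    using almost_block_cuts_mono[OF ab] by (simp add: block_sequence_def)
  have "norm (W - V) \<le> (\<Sum>j<N. norm (w j - v j))"
    unfolding W_def V_def sum_subtractf[symmetric] by (rule norm_sum)
  also have "\<dots> \<le> (\<Sum>j\<in>{0..<N}. \<delta> j)"
    unfolding atLeast0LessThan by (intro sum_mono wv)
  also have "\<dots> \<le> 2 * \<delta> 0" by (rule sum_delta_le)
  finally have WV: "norm (W - V) \<le> 1 / 100" by (simp add: \<delta>_def)
  have "1 / 2 \<le> norm (v j)" for j
  proof -
    have "1 \<le> norm (v j) + norm (w j - v j)"
      using norm_triangle_sub[of "w j" "v j"] almost_block_norm[OF ab, of j] by simp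
    moreover have "\<delta> j \<le> 1 / 2" using delta_le[of 0 j] by (simp add: \<delta>_def)
    ultimately show ?thesis using wv[of j] by linarith
  qed
  then have "(\<Sum>j<N. 1 / 2) \<le> (\<Sum>j<N. norm (v j))" by (intro sum_mono) simp
  also have "\<dots> \<le> 2 * sqrt N * norm V" unfolding V_def by (rule block_sum_norm_le[OF blk])
  finally have "N \<le> 4 * sqrt N * norm V" by simp
  then have "sqrt N * sqrt N \<le> sqrt N * (4 * norm V)" by (simp add: mult_ac)
  moreover have "0 < 4 * (1 + c)" using c by simp
  then have "0 < sqrt N" using sN by (rule order.strict_trans2)
  ultimately have V: "sqrt N \<le> 4 * norm V" by (simp only: mult_le_cancel_left_pos)
  have "norm V \<le> norm W + norm (W - V)" by (metis norm_triangle_sub norm_minus_commute)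
  moreover have "4 * (1 + c) \<le> 4 * norm V" using sN V by (rule order.trans)
  then have "1 + c \<le> norm V" by simp
  ultimately have "1 + c \<le> norm W + norm (W - V)" by (rule order.trans[rotated])
  then have W: "c \<le> norm W" using WV by linarith
  then have W0: "0 < norm W" using c by linarith
  have "\<bar>coord V l\<bar> \<le> 1" for l
    unfolding V_def
  proof (rule block_coord_le[OF blk])
    fix i l
    have "\<bar>coord (v i) l\<bar> \<le> norm (v i)" by (rule abs_coord_le)
    also have "\<dots> \<le> norm (w i)" by (simp add: v_def norm_proj_le)
    finally show "\<bar>coord (v i) l\<bar> \<le> 1" by (simp add: almost_block_norm[OF ab])
  qed simp
  then have cV: "\<bar>coord V l\<bar> \<le> 1" for l .
  have cW: "\<bar>coord W l\<bar> \<le> 2" for l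
    using abs_coord_le[of "W - V" l] WV cV[of l] unfolding coord_diff by linarith
  define z where "z = W /\<^sub>R norm W"
  have "W \<in> X" unfolding W_def by (intro subspace_sum[OF sX] w)
  then have "z \<in> X" by (simp add: z_def subspace_scale[OF sX])
  moreover have "norm z = 1" using W0 by (simp add: z_def)
  moreover have "Q k z = 0"
    by (simp add: z_def W_def linear_cmul[OF linear_proj] linear_sum[OF linear_proj] w)
  moreover have "\<bar>coord z l\<bar> \<le> \<epsilon>" for l
  proof -
    have "\<bar>coord z l\<bar> = \<bar>coord W l\<bar> / norm W" by (simp add: z_def coord_scale abs_mult divide_inverse mult.commute)
    also have "\<dots> \<le> 2 / norm W" using cW W0 by (intro divide_right_mono) auto
    also have "\<dots> \<le> \<epsilon>" using W W0 \<epsilon> by (simp add: c_def field_simps)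
    finally show ?thesis .
  qed
  ultimately show ?thesis by blast
qed

end

section \<open>Flat sequences are asymptotic $\ell_2$ bases\<close>

lemma sqrt_nat_le: "sqrt (real n) \<le> real n"
proof (rule real_le_lsqrt)
  have "n \<le> n\<^sup>2" by (simp add: power2_eq_square)
  then have "real n \<le> real (n\<^sup>2)" by (rule of_nat_mono)
  then show "real n \<le> (real n)\<^sup>2" by simp
qed simp

lemma sum_abs_mult_le_L2_set_mult_sum:
  assumes "finite A"
  shows "(\<Sum>i\<in>A. \<bar>b i\<bar> * c i) \<le> L2_set b A * (\<Sum>i\<in>A. \<bar>c i\<bar>)"
  unfolding sum_distrib_left
proof (rule sum_mono)
  fix i assume "i \<in> A"
  then have "\<bar>b i\<bar> \<le> L2_set b A"
    using member_le_L2_set[OF assms, of i "\<lambda>i. \<bar>b i\<bar>"] by (simp add: L2_set_def)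
  then have "\<bar>b i\<bar> * \<bar>c i\<bar> \<le> L2_set b A * \<bar>c i\<bar>" by (intro mult_right_mono) auto
  then show "\<bar>b i\<bar> * c i \<le> L2_set b A * \<bar>c i\<bar>"
    by (smt (verit) abs_ge_self mult_left_mono abs_ge_zero)
qed

context Ti_completion begin

context
  fixes \<kappa> z
  assumes ab: "almost_block \<kappa> z" and flat: "\<And>j l. \<bar>coord (z j) l\<bar> \<le> \<delta> j"
begin

text \<open>
  The blocks \<open>w i\<close> are replaced by truly successive vectors \<open>v i\<close> at a total cost of at most
  \<open>\<beta> / 25\<close>. Here \<open>\<beta>\<close> is the $\ell_2$-norm of the coefficients. The coordinates of \<open>b i *\<^sub>R v i\<close>
  are at most \<open>4 * \<delta> (n - 1) * \<beta>\<close>, so the error term of the lower estimate is at most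
  \<open>16 * \<beta> / 200\<close>.
\<close>

lemma flat_block_l2:
  assumes n: "1 \<le> n" and w: "normalized_block_basis z (n - 1) n w"
  shows "L2_set b {..<n} \<le> 16 * norm (\<Sum>i<n. b i *\<^sub>R w i)"
    and "norm (\<Sum>i<n. b i *\<^sub>R w i) \<le> 3 * L2_set b {..<n}"
proof -
  obtain p a where p0: "n - 1 \<le> p 0" and p: "\<And>i. i < n \<Longrightarrow> p i < p (Suc i)"
    and wi: "\<And>i. i < n \<Longrightarrow> w i = (\<Sum>j\<in>{p i..<p (Suc i)}. a j *\<^sub>R z j)"
    and w1: "\<And>i. i < n \<Longrightarrow> norm (w i) = 1"
    using w unfolding normalized_block_basis_def by blast
  have pge: "n - 1 + i \<le> p i" if "i \<le> n" for i
    using that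
  proof (induction i)
    case (Suc i)
    then show ?case using p[of i] by simp
  qed (use p0 in simp)
  define v where "v i = Q (\<kappa> (p (Suc i))) (w i)" for i
  define \<beta> where "\<beta> = L2_set b {..<n}"
  have \<beta>0: "0 \<le> \<beta>" by (simp add: \<beta>_def)
  have wv: "norm (w i - v i) \<le> 4 * \<delta> i" if i: "i < n" for i
  proof -
    have "norm (w i - v i) \<le> 4 * \<delta> (p i) * norm (w i)"
      unfolding v_def wi[OF i] by (rule almost_block_tail_le[OF ab]) simp
    also have "\<dots> \<le> 4 * \<delta> i" using delta_le[of i "p i"] pge[of i] i by (simp add: w1)
    finally show ?thesis .
  qed
  have projv: "proj {\<kappa> (p i)..<\<kappa> (p (Suc i))} (v i) = v i" if i: "i < n" for i
  proof -
    have "Q (\<kappa> (p i)) (w i) = 0"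
      unfolding wi[OF i]
      by (simp add: linear_sum[OF linear_proj] linear_cmul[OF linear_proj] almost_block_Q_zero[OF ab] almost_block_cuts_mono[OF ab])
    moreover have "proj {\<kappa> (p i)..<\<kappa> (p (Suc i))} (v i) = proj {\<kappa> (p i)..<\<kappa> (p (Suc i))} (w i)"
      unfolding v_def by (rule proj_eqI) (auto simp: coord_proj restr_def)
    ultimately show ?thesis
      using almost_block_cuts_mono[OF ab, of "p i" "p (Suc i)"] p[OF i]
      by (simp add: proj_atLeastLessThan v_def)
  qed
  have blk: "block_sequence (\<lambda>i. \<kappa> (p i)) n (\<lambda>i. b i *\<^sub>R v i)"
    unfolding block_sequence_def
    using projv p almost_block_cuts_mono[OF ab] by (simp add: linear_cmul[OF linear_proj] less_imp_le)
  have v_le: "norm (v i) \<le> 1" if "i < n" for i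
    using norm_proj_le[of "{..<\<kappa> (p (Suc i))}" "w i"] w1[OF that] by (simp add: v_def)
  have v_ge: "49 / 50 \<le> norm (v i)" if "i < n" for i
  proof -
    have "norm (w i) \<le> norm (v i) + norm (w i - v i)" by (rule norm_triangle_sub)
    moreover have "4 * \<delta> i \<le> 1 / 50" using delta_le[of 0 i] by (simp add: \<delta>_def)
    ultimately show ?thesis using wv[OF that] w1[OF that] by linarith
  qed
  define W where "W = (\<Sum>i<n. b i *\<^sub>R w i)"
  define V where "V = (\<Sum>i<n. b i *\<^sub>R v i)"
  have "norm (W - V) \<le> (\<Sum>i<n. norm (b i *\<^sub>R (w i - v i)))"
    unfolding W_def V_def sum_subtractf[symmetric] scaleR_diff_right[symmetric] by (rule norm_sum)
  also have "\<dots> \<le> (\<Sum>i<n. \<bar>b i\<bar> * (4 * \<delta> i))"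
    unfolding norm_scaleR using wv by (intro sum_mono mult_left_mono) auto
  also have "\<dots> \<le> \<beta> * (\<Sum>i<n. \<bar>4 * \<delta> i\<bar>)" unfolding \<beta>_def by (rule sum_abs_mult_le_L2_set_mult_sum) simp
  also have "(\<Sum>i<n. \<bar>4 * \<delta> i\<bar>) = 4 * (\<Sum>i\<in>{0..<n}. \<delta> i)"
    using delta_pos by (simp add: sum_distrib_left atLeast0LessThan abs_of_pos)
  also have "\<beta> * (4 * (\<Sum>i\<in>{0..<n}. \<delta> i)) \<le> \<beta> * (4 * (2 * \<delta> 0))"
    by (intro mult_left_mono sum_delta_le \<beta>0) simp
  finally have WV: "norm (W - V) \<le> \<beta> / 25" by (simp add: \<delta>_def)
  have "norm V \<le> 2 * L2_set (\<lambda>i. norm (b i *\<^sub>R v i)) {..<n}"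
    unfolding V_def by (rule block_upper_l2[OF blk])
  also have "\<dots> \<le> 2 * L2_set (\<lambda>i. \<bar>b i\<bar>) {..<n}"
    using v_le by (intro mult_left_mono L2_set_mono) (auto intro: mult_left_le)
  finally have "norm V \<le> 2 * \<beta>" by (simp add: \<beta>_def L2_set_def)
  moreover have "norm W \<le> norm V + norm (W - V)" by (rule norm_triangle_sub)
  ultimately have "norm W \<le> 3 * \<beta>" using WV \<beta>0 by linarith
  then show "norm (\<Sum>i<n. b i *\<^sub>R w i) \<le> 3 * L2_set b {..<n}" by (simp add: W_def \<beta>_def)
  have small: "\<bar>coord (b i *\<^sub>R v i) l\<bar> \<le> \<beta> * (4 * \<delta> (n - 1))" if i: "i < n" for i l
  proof -
    have "\<bar>coord (w i) l\<bar> \<le> (\<Sum>j\<in>{p i..<p (Suc i)}. \<bar>a j\<bar> * \<bar>coord (z j) l\<bar>)"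
      unfolding wi[OF i] by (simp add: coord_sum coord_scale abs_mult[symmetric])
    also have "\<dots> \<le> (\<Sum>j\<in>{p i..<p (Suc i)}. 2 * \<delta> j)"
    proof (intro sum_mono mult_mono flat)
      fix j assume "j \<in> {p i..<p (Suc i)}"
      from almost_block_coeff_le[OF ab this, of a] show "\<bar>a j\<bar> \<le> 2" using wi[OF i] w1[OF i] by simp
    qed auto
    also have "\<dots> \<le> 2 * (2 * \<delta> (p i))"
      unfolding sum_distrib_left[symmetric] by (intro mult_left_mono sum_delta_le) simp
    also have "\<dots> \<le> 4 * \<delta> (n - 1)" using delta_le[of "n - 1" "p i"] pge[of i] i by simp
    finally have "\<bar>coord (w i) l\<bar> \<le> 4 * \<delta> (n - 1)" .
    moreover have "\<bar>coord (v i) l\<bar> \<le> \<bar>coord (w i) l\<bar>" by (simp add: v_def coord_proj restr_def)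
    moreover have "\<bar>b i\<bar> \<le> \<beta>"
      using member_le_L2_set[of "{..<n}" i "\<lambda>i. \<bar>b i\<bar>"] i by (simp add: L2_set_def \<beta>_def)
    ultimately show ?thesis
      by (simp add: coord_scale abs_mult mult_mono \<beta>0)
  qed
  have sq: "sqrt n * \<delta> (n - 1) \<le> 1 / 200"
  proof -
    have "n \<le> 2 ^ (n - 1)" using n by (induction n rule: dec_induct) (auto simp: power_eq_if)
    then have "real n \<le> real (2 ^ (n - 1))" by (rule of_nat_mono)
    with sqrt_nat_le have "sqrt n \<le> real (2 ^ (n - 1))" by (rule order.trans)
    then have "sqrt n \<le> 2 ^ (n - 1)" by (simp only: of_nat_power of_nat_numeral)
    then have "sqrt n * (1/2) ^ (n - 1) \<le> 2 ^ (n - 1) * (1/2) ^ (n - 1)"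
      by (intro mult_right_mono) auto
    then show ?thesis by (simp add: \<delta>_def power_mult_distrib[symmetric])
  qed
  have "49 / 50 * \<beta> = 49 / 50 * L2_set (\<lambda>i. \<bar>b i\<bar>) {..<n}" by (simp add: \<beta>_def L2_set_def)
  also have "\<dots> = L2_set (\<lambda>i. 49 / 50 * \<bar>b i\<bar>) {..<n}" by (rule L2_set_right_distrib) simp
  also have "\<dots> \<le> L2_set (\<lambda>i. norm (b i *\<^sub>R v i)) {..<n}"
  proof (rule L2_set_mono)
    fix i assume "i \<in> {..<n}"
    then have "49 / 50 * \<bar>b i\<bar> \<le> norm (v i) * \<bar>b i\<bar>" by (intro mult_right_mono v_ge) auto
    then show "49 / 50 * \<bar>b i\<bar> \<le> norm (b i *\<^sub>R v i)" by (simp add: mult.commute)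
  qed simp
  also have "\<dots> \<le> 8 * norm V + 4 * (\<beta> * (4 * \<delta> (n - 1))) * sqrt n"
    unfolding V_def using \<beta>0 delta_pos[of "n - 1"] by (intro block_lower_l2[OF blk small]) auto
  also have "4 * (\<beta> * (4 * \<delta> (n - 1))) * sqrt n = 16 * \<beta> * (sqrt n * \<delta> (n - 1))" by simp
  also have "\<dots> \<le> 16 * \<beta> * (1 / 200)" using \<beta>0 by (intro mult_left_mono sq) auto
  finally have "49 / 50 * \<beta> \<le> 8 * norm V + 16 * \<beta> * (1 / 200)" by simp
  moreover have "norm V \<le> norm W + norm (W - V)" by (metis norm_triangle_sub norm_minus_commute)
  ultimately have "\<beta> \<le> 16 * norm W" using WV norm_ge_zero[of W] by linarith
  then show "L2_set b {..<n} \<le> 16 * norm (\<Sum>i<n. b i *\<^sub>R w i)" by (simp add: W_def \<beta>_def)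
qed

lemma flat_asymptotic_l2: "asymptotic_l2_basis_of z (closure (span (range z)))"
  unfolding asymptotic_l2_basis_of_def
proof (intro conjI exI[of _ 48] allI impI)
  have "z j \<noteq> 0" for j using almost_block_norm[OF ab, of j] by auto
  then show "basis_of z (closure (span (range z)))"
    using almost_block_basis_const[OF ab] by (rule basic_basis_of)
  fix n w assume "1 \<le> n" "normalized_block_basis z (n - 1) n w"
  note l2 = flat_block_l2[OF this]
  have "inverse 16 * L2_set a {..<n} \<le> norm (\<Sum>i<n. a i *\<^sub>R w i) \<and>
      norm (\<Sum>i<n. a i *\<^sub>R w i) \<le> 3 * L2_set a {..<n}" for a
    using l2[of a] by simp
  then show "equivalent_to_l2_basis 48 n w"
    unfolding equivalent_to_l2_basis_def by (intro exI[of _ 16] exI[of _ 3]) simp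
qed

text \<open>
  Far out in the sequence the vectors have small coordinates everywhere, and the coordinates of
  the finitely many remaining ones tend to \<open>0\<close>.
\<close>

lemma flat_uniform_tails:
  assumes \<epsilon>: "0 < \<epsilon>"
  shows "\<exists>K. \<forall>x\<in>closure (span (range z)). \<forall>l\<ge>K. \<bar>coord x l\<bar> \<le> \<epsilon> * norm x"
proof -
  have "\<delta> \<longlonglongrightarrow> 0"
    unfolding \<delta>_def[abs_def] by (intro tendsto_divide_zero LIMSEQ_power_zero) simp
  then have "\<forall>\<^sub>F n in sequentially. \<delta> n < \<epsilon> / 8"
    by (rule order_tendstoD(2)) (use \<epsilon> in simp)
  then obtain N where N: "\<delta> N < \<epsilon> / 8" by (auto simp: eventually_sequentially)
  define \<eta> where "\<eta> = \<epsilon> / (4 * (real N + 1))"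
  have \<eta>: "0 < \<eta>" using \<epsilon> by (simp add: \<eta>_def)
  have "\<exists>K. \<forall>l\<ge>K. \<bar>coord (z j) l\<bar> \<le> \<eta>" for j
  proof -
    obtain K where "norm (Q K (z j) - z j) < \<eta>" using LIMSEQ_D[OF Q_tendsto \<eta>] by blast
    then show ?thesis
      using coord_tail_le[of K _ "z j"] by (intro exI[of _ K]) (force simp: norm_minus_commute)
  qed
  then obtain k where k: "\<And>j l. k j \<le> l \<Longrightarrow> \<bar>coord (z j) l\<bar> \<le> \<eta>" by metis
  define K where "K = Max (k ` {..N})"
  have kK: "k j \<le> K" if "j < N" for j unfolding K_def using that by (intro Max_ge) auto
  have bound: "\<bar>coord x l\<bar> \<le> \<epsilon> * norm x" if x: "x \<in> span (range z)" and l: "K \<le> l" for x l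
  proof -
    obtain a where "\<forall>\<^sub>F n in sequentially. x = (\<Sum>j<n. a j *\<^sub>R z j)"
      using in_span_range_sum[OF x] by blast
    then obtain n where n: "N \<le> n" "x = (\<Sum>j\<in>{0..<n}. a j *\<^sub>R z j)"
      unfolding eventually_sequentially atLeast0LessThan by (metis nle_le)
    have "\<bar>coord x l\<bar> \<le> (\<Sum>j\<in>{0..<n}. \<bar>a j\<bar> * \<bar>coord (z j) l\<bar>)"
      unfolding n(2) by (simp add: coord_sum coord_scale abs_mult[symmetric])
    also have "\<dots> \<le> (\<Sum>j\<in>{0..<n}. 2 * norm x * \<bar>coord (z j) l\<bar>)"
      unfolding n(2) by (intro sum_mono mult_right_mono almost_block_coeff_le[OF ab]) auto
    also have "\<dots> = 2 * norm x * ((\<Sum>j\<in>{0..<N}. \<bar>coord (z j) l\<bar>) + (\<Sum>j\<in>{N..<n}. \<bar>coord (z j) l\<bar>))"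
      using n(1) by (simp add: sum_distrib_left[symmetric] sum.atLeastLessThan_concat)
    also have "\<dots> \<le> 2 * norm x * ((\<Sum>j\<in>{0..<N}. \<eta>) + (\<Sum>j\<in>{N..<n}. \<delta> j))"
    proof (intro mult_left_mono add_mono sum_mono flat)
      fix j assume "j \<in> {0..<N}"
      then show "\<bar>coord (z j) l\<bar> \<le> \<eta>" using k[of j l] kK[of j] l by simp
    qed simp
    also have "\<dots> \<le> 2 * norm x * (\<epsilon> / 4 + \<epsilon> / 4)"
    proof (intro mult_left_mono add_mono)
      have "(\<Sum>j\<in>{0..<N}. \<eta>) = N * \<eta>" by simp
      also have "\<dots> \<le> (real N + 1) * \<eta>" using \<eta> by simp
      also have "\<dots> = \<epsilon> / 4"
      proof -
        have "q * (\<epsilon> / (4 * q)) = \<epsilon> / 4" if "0 < q" for q :: real using that by simp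
        note this[of "real N + 1"]
        then show ?thesis unfolding \<eta>_def by linarith
      qed
      finally show "(\<Sum>j\<in>{0..<N}. \<eta>) \<le> \<epsilon> / 4" .
      show "(\<Sum>j\<in>{N..<n}. \<delta> j) \<le> \<epsilon> / 4" using sum_delta_le[of N n] N by linarith
    qed simp
    finally show ?thesis by (simp add: mult.commute)
  qed
  have "closure (span (range z)) \<subseteq> {x. \<bar>coord x l\<bar> \<le> \<epsilon> * norm x}" if "K \<le> l" for l
  proof (rule closure_minimal)
    show "closed {x. \<bar>coord x l\<bar> \<le> \<epsilon> * norm x}"
      by (intro closed_Collect_le continuous_intros bounded_linear.continuous_on[OF bounded_linear_coord])
  qed (use bound that in blast)
  then show ?thesis by blast
qed

end

text \<open>
  The coordinates of every element tend to \<open>0\<close>. For a subspace \<open>Z\<close>, uniform tails mean that the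
  inclusion of \<open>Z\<close> into $c_0$ is a compact operator.
\<close>

definition uniform_tails :: "'y set \<Rightarrow> bool" where
  "uniform_tails Z \<longleftrightarrow> (\<forall>\<epsilon>>0. \<exists>K. \<forall>x\<in>Z. \<forall>l\<ge>K. \<bar>coord x l\<bar> \<le> \<epsilon> * norm x)"

lemma exists_flat_subspace:
  assumes X: "infinite_dim_subspace X"
  obtains Z e where "Z \<subseteq> X" "infinite_dim_subspace Z" "asymptotic_l2_basis_of e Z" "uniform_tails Z"
proof -
  obtain \<kappa> z where z: "almost_block \<kappa> z" "\<And>j. z j \<in> X" "\<And>j. \<forall>l. \<bar>coord (z j) l\<bar> \<le> \<delta> j"
    using exists_almost_block[where X = X and G = "\<lambda>j z. \<forall>l. \<bar>coord z l\<bar> \<le> \<delta> j"]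
      exists_small_coord[OF X delta_pos] by metis
  define Z where "Z = closure (span (range z))"
  have flat: "\<bar>coord (z j) l\<bar> \<le> \<delta> j" for j l using z(3) by blast
  have z0: "z j \<noteq> 0" for j using almost_block_norm[OF z(1), of j] by auto
  show thesis
  proof (rule that)
    show "Z \<subseteq> X" unfolding Z_def
      using X z(2) by (intro closure_minimal span_minimal) (auto simp: infinite_dim_subspace_def)
    show "infinite_dim_subspace Z"
      unfolding Z_def using z0 almost_block_basis_const[OF z(1)] by (rule basic_infinite_dim)
    show "asymptotic_l2_basis_of z Z" unfolding Z_def by (rule flat_asymptotic_l2[OF z(1) flat])
    show "uniform_tails Z" unfolding Z_def uniform_tails_def
      using flat_uniform_tails[OF z(1) flat] by blast
  qed
qed

section \<open>Bounded sequences in subspaces with uniform tails\<close>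

lemma norm_Q_le_l1: "norm (Q k y) \<le> (\<Sum>l<k. \<bar>coord y l\<bar>)"
  unfolding proj_def using Ti_nrm_restr_le_l1[of "{..<k}" "coord y"]
  by (simp add: norm_J c00_restr_finite)

text \<open>
  A diagonal argument gives convergence of each coordinate. The limit lies in the space since it
  is boundedly complete, and the uniform tails turn pointwise convergence into uniform
  convergence.
\<close>

lemma uniform_tails_subsequence:
  assumes Z: "uniform_tails Z" and x: "\<And>n. x n \<in> Z" and B: "\<And>n. norm (x n) \<le> B"
  shows "\<exists>r y \<rho>. strict_mono (r :: nat \<Rightarrow> nat) \<and>
    (\<forall>\<epsilon>>0. \<forall>\<^sub>F n in sequentially. \<forall>l. \<bar>coord (x (r n) - y) l\<bar> \<le> \<epsilon>) \<and>
    (\<lambda>n. norm (x (r n) - y)) \<longlonglongrightarrow> \<rho>"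
proof -
  have B0: "0 \<le> B" using B[of 0] norm_ge_zero order.trans by blast
  have cB: "\<bar>coord (x n) l\<bar> \<le> B" for n l using abs_coord_le B order.trans by blast
  obtain k :: "nat \<Rightarrow> nat" where k: "strict_mono k" "\<And>l. \<exists>c. (\<lambda>n. coord (x (k n)) l) \<longlonglongrightarrow> c"
    using function_convergent_subsequence[of UNIV "\<lambda>n. coord (x n)" B] cB by auto
  obtain s where s: "\<And>l. (\<lambda>n. coord (x (k n)) l) \<longlonglongrightarrow> s l" using k(2) by metis
  have "Ti_nrm (restr {..<m} s) \<le> B" for m
  proof -
    have "(\<lambda>n. (\<Sum>l<m. \<bar>s l - coord (x (k n)) l\<bar>) + B) \<longlonglongrightarrow> (\<Sum>l<m. \<bar>s l - s l\<bar>) + B"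
      by (intro tendsto_intros s)
    then have lim: "(\<lambda>n. (\<Sum>l<m. \<bar>s l - coord (x (k n)) l\<bar>) + B) \<longlonglongrightarrow> B" by simp
    have le: "Ti_nrm (restr {..<m} s) \<le> (\<Sum>l<m. \<bar>s l - coord (x (k n)) l\<bar>) + B" for n
    proof -
      define u where "u = restr {..<m} (\<lambda>l. s l - coord (x (k n)) l)"
      define v where "v = restr {..<m} (coord (x (k n)))"
      have "restr {..<m} s = (\<lambda>l. u l + v l)" by (auto simp: u_def v_def restr_def)
      then have "Ti_nrm (restr {..<m} s) \<le> Ti_nrm u + Ti_nrm v"
        by (simp add: Ti_nrm_add_le u_def v_def c00_restr_finite)
      also have "Ti_nrm u \<le> (\<Sum>l<m. \<bar>s l - coord (x (k n)) l\<bar>)"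
        unfolding u_def by (rule Ti_nrm_restr_le_l1) simp
      also have "Ti_nrm v = norm (Q m (x (k n)))" by (simp add: v_def proj_def norm_J c00_restr_finite)
      also have "\<dots> \<le> B" using norm_proj_le[of "{..<m}"] B order.trans by blast
      finally show ?thesis by simp
    qed
    show ?thesis by (rule LIMSEQ_le_const[OF lim]) (use le in blast)
  qed
  then obtain y where y: "coord y = s" by (rule boundedly_complete)
  have sup: "\<forall>\<^sub>F n in sequentially. \<forall>l. \<bar>coord (x (k n) - y) l\<bar> \<le> \<epsilon>" if \<epsilon>: "0 < \<epsilon>" for \<epsilon>
  proof -
    define \<eta> where "\<eta> = \<epsilon> / (2 * (B + 1))"
    have \<eta>: "0 < \<eta>" "\<eta> * B \<le> \<epsilon> / 2" using \<epsilon> B0 by (simp_all add: \<eta>_def field_simps)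
    obtain K where K: "\<And>u l. u \<in> Z \<Longrightarrow> K \<le> l \<Longrightarrow> \<bar>coord u l\<bar> \<le> \<eta> * norm u"
      using Z \<eta>(1) unfolding uniform_tails_def by blast
    have xK: "\<bar>coord (x n) l\<bar> \<le> \<epsilon> / 2" if "K \<le> l" for n l
    proof -
      have "\<bar>coord (x n) l\<bar> \<le> \<eta> * norm (x n)" by (rule K[OF x that])
      also have "\<dots> \<le> \<eta> * B" using \<eta>(1) B by (intro mult_left_mono) auto
      finally show ?thesis using \<eta>(2) by simp
    qed
    have sK: "\<bar>s l\<bar> \<le> \<epsilon> / 2" if "K \<le> l" for l
      by (rule LIMSEQ_le_const2[OF tendsto_rabs[OF s]]) (use xK[OF that] in blast)
    have "\<forall>\<^sub>F n in sequentially. \<forall>l\<in>{..<K}. \<bar>coord (x (k n)) l - s l\<bar> < \<epsilon>"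
      using tendstoD[OF s \<epsilon>] by (intro eventually_ball_finite) (auto simp: dist_real_def)
    then show ?thesis
    proof eventually_elim
      case (elim n)
      have "\<bar>coord (x (k n) - y) l\<bar> \<le> \<epsilon>" for l
      proof (cases "l < K")
        case True
        then show ?thesis using elim by (auto simp: coord_diff y intro: less_imp_le)
      next
        case False
        then show ?thesis using xK[of l "k n"] sK[of l] by (simp add: coord_diff y)
      qed
      then show ?case by blast
    qed
  qed
  have range: "\<forall>n. norm (x (k n) - y) \<in> {0..B + norm y}"
  proof
    fix n
    show "norm (x (k n) - y) \<in> {0..B + norm y}"
      using norm_triangle_ineq4[of "x (k n)" y] B[of "k n"] by simp
  qed
  have "seq_compact {0..B + norm y}" by (intro compact_imp_seq_compact compact_Icc)
  then obtain \<rho> q where q: "\<rho> \<in> {0..B + norm y}" "strict_mono (q :: nat \<Rightarrow> nat)"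
      "((\<lambda>n. norm (x (k n) - y)) \<circ> q) \<longlonglongrightarrow> \<rho>"
    using range by (rule seq_compactE[where f = "\<lambda>n. norm (x (k n) - y)"])
  show ?thesis
  proof (rule exI[of _ "k \<circ> q"], rule exI[of _ y], rule exI[of _ \<rho>], intro conjI allI impI)
    show "strict_mono (k \<circ> q)" by (rule strict_mono_o[OF k(1) q(2)])
    show "\<forall>\<^sub>F n in sequentially. \<forall>l. \<bar>coord (x ((k \<circ> q) n) - y) l\<bar> \<le> \<epsilon>" if "0 < \<epsilon>" for \<epsilon>
      using eventually_subseq[OF q(2) sup[OF that]] by simp
    show "(\<lambda>n. norm (x ((k \<circ> q) n) - y)) \<longlonglongrightarrow> \<rho>" using q(3) by (simp add: o_def)
  qed
qed

text \<open>
  Think of \<open>K\<close> as the place up to which the vectors chosen earlier reach, and of \<open>K'\<close> as the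
  place from which the next one may start.
\<close>

definition near_block :: "real \<Rightarrow> real \<Rightarrow> nat \<Rightarrow> nat \<Rightarrow> 'y \<Rightarrow> bool" where
  "near_block \<epsilon> \<rho> K K' d \<longleftrightarrow> K \<le> K' \<and> norm (Q K d) \<le> \<epsilon> \<and> norm (d - Q K' d) \<le> \<epsilon> \<and>
     (\<forall>l. \<bar>coord d l\<bar> \<le> \<epsilon>) \<and> \<bar>norm d - \<rho>\<bar> \<le> \<epsilon>"

text \<open>
  Stated with \<open>frequently\<close>, which is all that a subsequence gives. An iterated limit of the
  whole sequences can still be approximated along such indices, and no subsequences have to be
  substituted into it.
\<close>

lemma uniform_tails_near_block:
  assumes Z: "uniform_tails Z" and x: "range x \<subseteq> Z" and bdd: "bounded (range x)"
  shows "\<exists>y \<rho>. 0 \<le> \<rho> \<and>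
    (\<forall>\<epsilon>>0. \<forall>K. \<exists>\<^sub>F n in sequentially. \<exists>K'. near_block \<epsilon> \<rho> K K' (x n - y))"
proof -
  obtain B where B: "\<And>n. norm (x n) \<le> B" using bdd by (auto simp: bounded_iff)
  have xZ: "x n \<in> Z" for n using x by blast
  obtain r y \<rho> where r: "strict_mono (r :: nat \<Rightarrow> nat)"
    and sup: "\<forall>\<epsilon>>0. \<forall>\<^sub>F n in sequentially. \<forall>l. \<bar>coord (x (r n) - y) l\<bar> \<le> \<epsilon>"
    and \<rho>: "(\<lambda>n. norm (x (r n) - y)) \<longlonglongrightarrow> \<rho>"
    using uniform_tails_subsequence[of Z x B, OF Z xZ B] by (elim exE conjE)
  show ?thesis
  proof (rule exI[of _ y], rule exI[of _ \<rho>], intro conjI allI impI)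
    show "0 \<le> \<rho>" by (rule LIMSEQ_le_const[OF \<rho>]) simp
    fix \<epsilon> :: real and K :: nat assume \<epsilon>: "0 < \<epsilon>"
    define \<eta> where "\<eta> = \<epsilon> / (real K + 1)"
    have \<eta>: "0 < \<eta>" "\<eta> \<le> \<epsilon>" "real K * \<eta> \<le> \<epsilon>" using \<epsilon> by (simp_all add: \<eta>_def field_simps)
    have "\<forall>\<^sub>F n in sequentially. \<bar>norm (x (r n) - y) - \<rho>\<bar> < \<epsilon>"
      using tendstoD[OF \<rho> \<epsilon>] by (simp add: dist_real_def)
    with sup[rule_format, OF \<eta>(1)]
    have ev: "\<forall>\<^sub>F n in sequentially. \<exists>K'. near_block \<epsilon> \<rho> K K' (x (r n) - y)"
    proof eventually_elim
      case (elim n)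
      define d where "d = x (r n) - y"
      have d: "\<bar>coord d l\<bar> \<le> \<eta>" for l using elim(1) by (simp add: d_def)
      have "norm (Q K d) \<le> (\<Sum>l<K. \<bar>coord d l\<bar>)" by (rule norm_Q_le_l1)
      also have "\<dots> \<le> (\<Sum>l<K. \<eta>)" by (intro sum_mono d)
      also have "\<dots> \<le> \<epsilon>" using \<eta>(3) by simp
      finally have QK: "norm (Q K d) \<le> \<epsilon>" .
      obtain N where N: "\<And>n. n \<ge> N \<Longrightarrow> norm (Q n d - d) < \<epsilon>"
        using LIMSEQ_D[OF Q_tendsto \<epsilon>] by blast
      have "norm (d - Q (max K N) d) \<le> \<epsilon>"
        using N[of "max K N"] by (simp add: norm_minus_commute less_imp_le)
      then have "near_block \<epsilon> \<rho> K (max K N) d"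
        unfolding near_block_def using QK elim(2) d \<eta>(2) by (auto simp: d_def intro: order.trans)
      then show ?case unfolding d_def by blast
    qed
    show "\<exists>\<^sub>F n in sequentially. \<exists>K'. near_block \<epsilon> \<rho> K K' (x n - y)"
      unfolding frequently_def
    proof
      assume "\<forall>\<^sub>F n in sequentially. \<not> (\<exists>K'. near_block \<epsilon> \<rho> K K' (x n - y))"
      from eventually_conj[OF eventually_subseq[OF r this] ev]
      have "\<forall>\<^sub>F n :: nat in sequentially. False" by eventually_elim blast
      then show False by simp
    qed
  qed
qed

end

section \<open>Iterated limits\<close>

text \<open>
  The indices are chosen from the outermost limit inwards. Each choice may depend, through the
  state \<open>\<kappa> t\<close>, on the earlier ones, which is what makes the chosen vectors successive.
\<close>

lemma iterated_limit_selection: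
  fixes P :: "nat \<Rightarrow> nat \<Rightarrow> nat \<Rightarrow> nat \<Rightarrow> bool"
  assumes "has_iterated_limit is f \<nu> L" "distinct is" "0 < \<epsilon>"
    and "\<And>i K. i \<in> set is \<Longrightarrow> \<exists>\<^sub>F n in sequentially. \<exists>K'. P i K K' n"
  shows "\<exists>\<nu>' \<kappa>. \<kappa> 0 = K \<and> \<bar>f \<nu>' - L\<bar> < \<epsilon> \<and> (\<forall>j. j \<notin> set is \<longrightarrow> \<nu>' j = \<nu> j) \<and>
    (\<forall>t<length is. P (is ! t) (\<kappa> t) (\<kappa> (Suc t)) (\<nu>' (is ! t)))"
  using assms
proof (induction "is" arbitrary: \<nu> L K \<epsilon>)
  case Nil
  then show ?case by (intro exI[of _ \<nu>] exI[of _ "\<lambda>_. K"]) simp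
next
  case (Cons i "is")
  obtain g where g: "\<And>k. has_iterated_limit is f (\<nu>(i := k)) (g k)" "g \<longlonglongrightarrow> L"
    using Cons.prems(1) by auto
  have \<epsilon>2: "0 < \<epsilon> / 2" using Cons.prems(3) by simp
  have "\<exists>\<^sub>F n in sequentially. dist (g n) L < \<epsilon> / 2 \<and> (\<exists>K'. P i K K' n)"
    using Cons.prems(4)[of i] tendstoD[OF g(2) \<epsilon>2]
    by (intro frequently_eventually_conj) auto
  then obtain n K' where n: "P i K K' n" "\<bar>g n - L\<bar> < \<epsilon> / 2"
    by (auto simp: dist_real_def dest!: frequently_ex)
  have "distinct is" using Cons.prems(2) by simp
  then have "\<exists>\<nu>' \<kappa>. \<kappa> 0 = K' \<and> \<bar>f \<nu>' - g n\<bar> < \<epsilon> / 2 \<and> (\<forall>j. j \<notin> set is \<longrightarrow> \<nu>' j = (\<nu>(i := n)) j) \<and>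
      (\<forall>t<length is. P (is ! t) (\<kappa> t) (\<kappa> (Suc t)) (\<nu>' (is ! t)))"
    by (rule Cons.IH[OF g(1) _ \<epsilon>2]) (rule Cons.prems(4), simp)
  then obtain \<nu>' \<kappa> where IH: "\<kappa> 0 = K'" "\<bar>f \<nu>' - g n\<bar> < \<epsilon> / 2"
    "\<forall>j. j \<notin> set is \<longrightarrow> \<nu>' j = (\<nu>(i := n)) j"
    "\<forall>t<length is. P (is ! t) (\<kappa> t) (\<kappa> (Suc t)) (\<nu>' (is ! t))"
    by (elim exE conjE)
  have i: "\<nu>' i = n" using IH(3) Cons.prems(2) by simp
  show ?case
  proof (rule exI[of _ \<nu>'], rule exI[of _ "case_nat K \<kappa>"], intro conjI allI impI)
    show "\<bar>f \<nu>' - L\<bar> < \<epsilon>" using IH(2) n(2) by linarith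
    fix t assume t: "t < length (i # is)"
    show "P ((i # is) ! t) (case_nat K \<kappa> t) (case_nat K \<kappa> (Suc t)) (\<nu>' ((i # is) ! t))"
      using n(1) i IH(1) IH(4) t by (cases t) auto
  qed (use IH(3) in auto)
qed

context Ti_completion begin

text \<open>
  The vectors \<open>d t\<close> are replaced by truly successive vectors \<open>v t\<close>, and \<open>Y\<close> by its initial part.
  The sum \<open>V\<close> then dominates both the initial part of \<open>Y\<close> and the sum of the \<open>v t\<close>, and the two
  $\ell_2$ estimates apply to the latter.
\<close>

lemma near_block_sum_estimates:
  fixes m :: nat and \<epsilon> :: real and Y :: 'y and \<rho> :: "nat \<Rightarrow> real" and d :: "nat \<Rightarrow> 'y"
  assumes Y: "norm (Y - Q (\<kappa> 0) Y) \<le> \<epsilon>" and \<epsilon>: "0 < \<epsilon>"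
    and d: "\<And>t. t < m \<Longrightarrow> near_block \<epsilon> (\<rho> t) (\<kappa> t) (\<kappa> (Suc t)) (d t)" and \<rho>: "\<And>t. 0 \<le> \<rho> t"
  defines "S \<equiv> Y + (\<Sum>t<m. d t)" and "R \<equiv> L2_set \<rho> {..<m}"
  shows "norm S \<le> norm Y + 2 * R + (20 + 30 * real m) * \<epsilon>"
    and "norm Y \<le> norm S + (20 + 30 * real m) * \<epsilon>"
    and "R \<le> 8 * norm S + (20 + 30 * real m) * \<epsilon>"
proof -
  define v where "v t = proj {\<kappa> t..<\<kappa> (Suc t)} (d t)" for t
  define V where "V = Q (\<kappa> 0) Y + (\<Sum>t<m. v t)"
  have \<kappa>: "\<kappa> t \<le> \<kappa> (Suc t)" if "t < m" for t using d[OF that] by (simp add: near_block_def)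
  have vd: "norm (d t - v t) \<le> 2 * \<epsilon>" if t: "t < m" for t
  proof -
    have "d t - v t = (d t - Q (\<kappa> (Suc t)) (d t)) + Q (\<kappa> t) (d t)"
      using \<kappa>[OF t] by (simp add: v_def proj_atLeastLessThan)
    then have "norm (d t - v t) \<le> norm (d t - Q (\<kappa> (Suc t)) (d t)) + norm (Q (\<kappa> t) (d t))"
      by (simp only: norm_triangle_ineq)
    then show ?thesis using d[OF t] by (simp add: near_block_def)
  qed
  have blk: "block_sequence \<kappa> m v"
    unfolding block_sequence_def using \<kappa> by (simp add: v_def proj_proj)
  have SV: "norm (S - V) \<le> (1 + 2 * real m) * \<epsilon>"
  proof -
    have "S - V = (Y - Q (\<kappa> 0) Y) + (\<Sum>t<m. d t - v t)" by (simp add: S_def V_def sum_subtractf)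
    then have "norm (S - V) \<le> norm (Y - Q (\<kappa> 0) Y) + norm (\<Sum>t<m. d t - v t)"
      by (simp only: norm_triangle_ineq)
    also have "\<dots> \<le> \<epsilon> + (\<Sum>t<m. 2 * \<epsilon>)"
      using vd by (intro add_mono Y sum_norm_le) simp
    finally show ?thesis by (simp add: algebra_simps)
  qed
  have close: "\<bar>norm S - norm V\<bar> \<le> (1 + 2 * real m) * \<epsilon>"
    using norm_triangle_ineq3[of S V] SV by linarith
  have v\<rho>: "\<bar>norm (v t) - \<rho> t\<bar> \<le> 3 * \<epsilon>" if "t < m" for t
    using norm_triangle_ineq3[of "d t" "v t"] vd[OF that] d[OF that] unfolding near_block_def by linarith
  have const: "L2_set (\<lambda>_. 3 * \<epsilon>) {..<m} \<le> 3 * real m * \<epsilon>"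
    using L2_set_le_sum[of "{..<m}" "\<lambda>_. 3 * \<epsilon>"] \<epsilon> by simp
  have "L2_set (\<lambda>t. norm (v t)) {..<m} \<le> L2_set (\<lambda>t. \<rho> t + 3 * \<epsilon>) {..<m}"
    using v\<rho> by (intro L2_set_mono) fastforce+
  also have "\<dots> \<le> R + L2_set (\<lambda>_. 3 * \<epsilon>) {..<m}" unfolding R_def by (rule L2_set_triangle_ineq)
  finally have vR: "L2_set (\<lambda>t. norm (v t)) {..<m} \<le> R + 3 * real m * \<epsilon>" using const by simp
  have "R \<le> L2_set (\<lambda>t. norm (v t) + 3 * \<epsilon>) {..<m}"
    unfolding R_def using v\<rho> \<rho> by (intro L2_set_mono) fastforce+
  also have "\<dots> \<le> L2_set (\<lambda>t. norm (v t)) {..<m} + L2_set (\<lambda>_. 3 * \<epsilon>) {..<m}"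
    by (rule L2_set_triangle_ineq)
  finally have Rv: "R \<le> L2_set (\<lambda>t. norm (v t)) {..<m} + 3 * real m * \<epsilon>" using const by simp
  have \<kappa>0: "\<kappa> 0 \<le> \<kappa> t" if "t \<le> m" for t
    using that
  proof (induction t)
    case (Suc t)
    then show ?case using \<kappa>[of t] by simp
  qed simp
  have QV: "Q (\<kappa> 0) V = Q (\<kappa> 0) Y"
  proof -
    have "Q (\<kappa> 0) (v t) = 0" if "t < m" for t
    proof -
      have "{..<\<kappa> 0} \<inter> {\<kappa> t..<\<kappa> (Suc t)} = {}" using \<kappa>0[of t] that by auto
      then show ?thesis by (simp add: v_def proj_proj proj_empty)
    qed
    then show ?thesis
      by (simp add: V_def linear_add[OF linear_proj] linear_sum[OF linear_proj] proj_proj)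
  qed
  have YV: "norm Y \<le> norm V + \<epsilon>"
  proof -
    have "norm Y \<le> norm (Q (\<kappa> 0) Y) + norm (Y - Q (\<kappa> 0) Y)" by (rule norm_triangle_sub)
    moreover have "norm (Q (\<kappa> 0) Y) \<le> norm V" unfolding QV[symmetric] by (rule norm_proj_le) simp
    ultimately show ?thesis using Y by linarith
  qed
  have sv: "norm (\<Sum>t<m. v t) \<le> norm V"
    using norm_diff_Q_le[of V "\<kappa> 0"] by (simp add: QV) (simp add: V_def)
  have "norm V \<le> norm (Q (\<kappa> 0) Y) + norm (\<Sum>t<m. v t)" unfolding V_def by (rule norm_triangle_ineq)
  also have "\<dots> \<le> norm Y + 2 * L2_set (\<lambda>t. norm (v t)) {..<m}"
    by (intro add_mono norm_proj_le block_upper_l2[OF blk]) simp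
  finally have upper: "norm V \<le> norm Y + 2 * L2_set (\<lambda>t. norm (v t)) {..<m}" .
  have "L2_set (\<lambda>t. norm (v t)) {..<m} \<le> 8 * norm (\<Sum>t<m. v t) + 4 * \<epsilon> * sqrt m"
  proof (rule block_lower_l2[OF blk])
    fix t l assume "t < m"
    then show "\<bar>coord (v t) l\<bar> \<le> \<epsilon>"
      using d[of t] \<epsilon> by (simp add: v_def coord_proj restr_def near_block_def)
  qed (use \<epsilon> in simp)
  also have "\<dots> \<le> 8 * norm V + 4 * \<epsilon> * real m"
    using sv \<epsilon> by (intro add_mono mult_left_mono) (auto simp: sqrt_nat_le)
  finally have lower: "L2_set (\<lambda>t. norm (v t)) {..<m} \<le> 8 * norm V + 4 * (real m * \<epsilon>)" by (simp add: mult_ac)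
  have e: "0 \<le> real m * \<epsilon>" using \<epsilon> by simp
  have expand: "(1 + 2 * real m) * \<epsilon> = \<epsilon> + 2 * (real m * \<epsilon>)" "(20 + 30 * real m) * \<epsilon> = 20 * \<epsilon> + 30 * (real m * \<epsilon>)"
    "3 * real m * \<epsilon> = 3 * (real m * \<epsilon>)" by (simp_all add: algebra_simps)
  note facts = close vR Rv YV upper lower e \<epsilon>
  show "norm S \<le> norm Y + 2 * R + (20 + 30 * real m) * \<epsilon>"
    using facts unfolding expand by linarith
  show "norm Y \<le> norm S + (20 + 30 * real m) * \<epsilon>"
    using facts unfolding expand by linarith
  show "R \<le> 8 * norm S + (20 + 30 * real m) * \<epsilon>"
    using facts unfolding expand by linarith
qed

text \<open>
  Up to constants, \<open>L\<close> is the sum of \<open>norm Y\<close> and \<open>R\<close>. Neither of them depends on the order in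
  which the limits are taken, that is, on the list.
\<close>

lemma iterated_limit_estimates:
  fixes x :: "nat \<Rightarrow> nat \<Rightarrow> 'y"
  assumes lim: "has_iterated_limit is (\<lambda>\<nu>. norm (\<Sum>i=1..m. x i (\<nu> i))) \<nu> L"
    and dist: "distinct is" and set_is: "set is = {1..m}"
    and \<rho>: "\<And>i. 0 \<le> \<rho> i"
    and gd: "\<And>i \<epsilon> K. i \<in> {1..m} \<Longrightarrow> 0 < \<epsilon> \<Longrightarrow> \<exists>\<^sub>F n in sequentially. \<exists>K'. near_block \<epsilon> (\<rho> i) K K' (x i n - y i)"
  defines "Y \<equiv> \<Sum>i=1..m. y i" and "R \<equiv> L2_set \<rho> {1..m}"
  shows "L \<le> norm Y + 2 * R" and "norm Y \<le> L" and "R \<le> 8 * L"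
proof -
  have len: "length is = m" using distinct_card[OF dist] set_is by simp
  have bij: "bij_betw ((!) is) {..<m} {1..m}"
    using bij_betw_nth[OF dist, of "{..<m}" "{1..m}"] len set_is by simp
  have R: "R = L2_set (\<lambda>t. \<rho> (is ! t)) {..<m}"
    unfolding R_def L2_set_def using sum.reindex_bij_betw[OF bij, of "\<lambda>i. (\<rho> i)\<^sup>2"] by simp
  (* The bound for R loses 8 * \<epsilon> in addition to the (20 + 30 * m) * \<epsilon> of the finite sums. *)
  define M where "M = 40 + 30 * real m"
  have M: "0 < M" by (simp add: M_def)
  have approx: "L \<le> norm Y + 2 * R + e \<and> norm Y \<le> L + e \<and> R \<le> 8 * L + e" if e: "0 < e" for e
  proof -
    define \<epsilon> where "\<epsilon> = e / M"
    have \<epsilon>: "0 < \<epsilon>" using e M by (simp add: \<epsilon>_def)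
    obtain K where K: "norm (Q K Y - Y) < \<epsilon>" using LIMSEQ_D[OF Q_tendsto \<epsilon>] by blast
    have "\<exists>\<nu>' \<kappa>. \<kappa> 0 = K \<and> \<bar>norm (\<Sum>i=1..m. x i (\<nu>' i)) - L\<bar> < \<epsilon> \<and>
        (\<forall>j. j \<notin> set is \<longrightarrow> \<nu>' j = \<nu> j) \<and>
        (\<forall>t<length is. near_block \<epsilon> (\<rho> (is ! t)) (\<kappa> t) (\<kappa> (Suc t)) (x (is ! t) (\<nu>' (is ! t)) - y (is ! t)))"
      using lim dist \<epsilon> by (rule iterated_limit_selection) (use gd set_is \<epsilon> in blast)
    then obtain \<nu>' \<kappa> where \<kappa>: "\<kappa> 0 = K" and close: "\<bar>norm (\<Sum>i=1..m. x i (\<nu>' i)) - L\<bar> < \<epsilon>"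
      and g: "\<And>t. t < m \<Longrightarrow> near_block \<epsilon> (\<rho> (is ! t)) (\<kappa> t) (\<kappa> (Suc t)) (x (is ! t) (\<nu>' (is ! t)) - y (is ! t))"
      using len by auto
    have S: "(\<Sum>i=1..m. x i (\<nu>' i)) = Y + (\<Sum>t<m. x (is ! t) (\<nu>' (is ! t)) - y (is ! t))"
      using sum.reindex_bij_betw[OF bij, of "\<lambda>i. x i (\<nu>' i) - y i"] by (simp add: Y_def sum_subtractf)
    have YK: "norm (Y - Q (\<kappa> 0) Y) \<le> \<epsilon>" using K by (simp add: \<kappa> norm_minus_commute)
    note est = near_block_sum_estimates[where m = m, OF YK \<epsilon> g \<rho>, folded S R]
    have "(20 + 30 * real m) * \<epsilon> = e - 20 * \<epsilon>"
      using M by (simp add: \<epsilon>_def M_def field_simps)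
    then show ?thesis using est close \<epsilon> by linarith
  qed
  show "L \<le> norm Y + 2 * R" "norm Y \<le> L" "R \<le> 8 * L"
    by (rule field_le_epsilon; use approx in blast)+
qed

lemma uniform_tails_asymptotically_symmetric:
  assumes Z: "uniform_tails Z"
  shows "asymptotically_symmetric Z"
  unfolding asymptotically_symmetric_def
proof (intro exI[of _ 17] allI impI)
  fix m and x :: "nat \<Rightarrow> nat \<Rightarrow> 'y" and \<sigma> L L'
  assume x: "\<forall>i\<in>{1..m}. range (x i) \<subseteq> Z \<and> bounded (range (x i))"
    and \<sigma>: "\<sigma> permutes {1..m}"
    and L: "has_iterated_limit [1..<Suc m] (\<lambda>\<nu>. norm (\<Sum>i=1..m. x i (\<nu> i))) (\<lambda>_. 0) L"
    and L': "has_iterated_limit (map \<sigma> [1..<Suc m]) (\<lambda>\<nu>. norm (\<Sum>i=1..m. x i (\<nu> i))) (\<lambda>_. 0) L'"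
  have "\<exists>y \<rho>. 0 \<le> \<rho> \<and> (i \<in> {1..m} \<longrightarrow>
      (\<forall>\<epsilon>>0. \<forall>K. \<exists>\<^sub>F n in sequentially. \<exists>K'. near_block \<epsilon> \<rho> K K' (x i n - y)))" for i
  proof (cases "i \<in> {1..m}")
    case True
    then have "range (x i) \<subseteq> Z" "bounded (range (x i))" using x by blast+
    then show ?thesis using uniform_tails_near_block[OF Z, of "x i"] by blast
  qed auto
  then obtain y \<rho> where \<rho>: "\<And>i. 0 \<le> \<rho> i"
    and g: "\<And>i \<epsilon> K. i \<in> {1..m} \<Longrightarrow> 0 < \<epsilon> \<Longrightarrow>
      \<exists>\<^sub>F n in sequentially. \<exists>K'. near_block \<epsilon> (\<rho> i) K K' (x i n - y i)" by metis
  have set1: "set [1..<Suc m] = {1..m}" by auto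
  have d2: "distinct (map \<sigma> [1..<Suc m])"
    using permutes_inj[OF \<sigma>] by (simp add: distinct_map inj_on_subset)
  have set2: "set (map \<sigma> [1..<Suc m]) = {1..m}"
    unfolding set_map set1 by (rule permutes_image[OF \<sigma>])
  have "L \<le> norm (\<Sum>i=1..m. y i) + 2 * L2_set \<rho> {1..m}"
    by (rule iterated_limit_estimates(1)[OF L distinct_upt set1 \<rho> g])
  also have "\<dots> \<le> L' + 2 * (8 * L')"
    using iterated_limit_estimates(2,3)[OF L' d2 set2 \<rho> g] by (intro add_mono mult_left_mono) auto
  finally show "L \<le> 17 * L'" by simp
qed

end

theorem corollary3p8:
  fixes J :: "(nat \<Rightarrow> real) \<Rightarrow> 'y::banach" and X :: "'y set"
  assumes "is_Ti_completion J"
    and "infinite_dim_subspace X"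
  shows "(\<exists>Z e. Z \<subseteq> X \<and> infinite_dim_subspace Z \<and> asymptotic_l2_basis_of e Z) \<and>
         (\<exists>Z. Z \<subseteq> X \<and> infinite_dim_subspace Z \<and> asymptotically_symmetric Z)"
proof -
  interpret Ti_completion J by unfold_locales (rule assms(1))
  obtain Z e where "Z \<subseteq> X" "infinite_dim_subspace Z" "asymptotic_l2_basis_of e Z" "uniform_tails Z"
    by (rule exists_flat_subspace[OF assms(2)])
  then show ?thesis using uniform_tails_asymptotically_symmetric by blast
qed

end
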